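(* There is no expanding Ricci breather on compact Riemannian manifolds other than expanding gradient Ricci solitons. That is: let $M$ be a closed connected manifold and $\mathbf{g}(t)$, $t\in[t_1,t_2]$ with $t_1<t_2$, a solution to the Ricci flow $\frac{\partial}{\partial t}\mathbf{g}_{ij}=-2R_{ij}$ on $M$ such that $\mathbf{g}(t_2)=\alpha\,\Phi^*\mathbf{g}(t_1)$ for some constant $\alpha>1$ and some diffeomorphism $\Phi$ of $M$. Then $\mathbf{g}(t)$ is an expanding gradient Ricci soliton.
   Context: A metric $\mathbf{g}(t)$ evolving by the Ricci flow is called a breather if for some $t_1<t_2$ and $\alpha>0$ the metrics $\alpha\mathbf{g}(t_1)$ and $\mathbf{g}(t_2)$ differ only by a diffeomorphism; the cases $\alpha=1$, $\alpha<1$, $\alpha>1$ correspond to steady, shrinking and expanding breathers, respectively. A metric $\mathbf{g}$ is an expanding gradient Ricci soliton if there exist a smooth function $f$ and a constant $\tau>0$ with $R_{ij}+\nabla_i\nabla_j f+\frac{1}{2\tau}\mathbf{g}_{ij}=0$, where $R_{ij}$ is the Ricci tensor and $\nabla$ the Levi-Civita connection of $\mathbf{g}$. *)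

theory Defs
  imports "HOL-Analysis.Analysis"
begin

section \<open>Smooth functions\<close>

text \<open>
  The derivatives are taken within \<open>S\<close>. For open \<open>S\<close> this is the usual notion; for
  \<open>S = {a..b} \<times> U\<close> with \<open>a < b\<close> and \<open>U\<close> open, where derivatives within \<open>S\<close> are still unique, it is
  smoothness up to the boundary (one-sided derivatives at the end points of the interval).
\<close>

primrec C_k_on ::
    "nat \<Rightarrow> 'a::euclidean_space set \<Rightarrow> ('a \<Rightarrow> 'b::real_normed_vector) \<Rightarrow> bool" where
  "C_k_on 0 S f \<longleftrightarrow> continuous_on S f"
| "C_k_on (Suc k) S f \<longleftrightarrow>
     (\<exists>f'. (\<forall>x\<in>S. (f has_derivative f' x) (at x within S)) \<and> (\<forall>v. C_k_on k S (\<lambda>x. f' x v)))"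

definition smooth_on ::
    "'a::euclidean_space set \<Rightarrow> ('a \<Rightarrow> 'b::real_normed_vector) \<Rightarrow> bool" where
  "smooth_on S f \<longleftrightarrow> (\<forall>k. C_k_on k S f)"


section \<open>Smooth manifolds\<close>

text \<open>
  A chart is a pair of its domain and its coordinate map; the values of the coordinate map
  outside the domain are irrelevant.
\<close>

type_synonym ('m, 'n) chart = "'m set \<times> ('m \<Rightarrow> real ^ 'n)"

abbreviation chart_dom :: "('m, 'n) chart \<Rightarrow> 'm set" where
  "chart_dom c \<equiv> fst c"

abbreviation chart_image :: "('m, 'n) chart \<Rightarrow> (real ^ 'n) set" where
  "chart_image c \<equiv> snd c ` fst c"

abbreviation chart_inv :: "('m, 'n) chart \<Rightarrow> real ^ 'n \<Rightarrow> 'm" where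
  "chart_inv c \<equiv> inv_into (fst c) (snd c)"

definition is_chart :: "'m topology \<Rightarrow> ('m, 'n::finite) chart \<Rightarrow> bool" where
  "is_chart X c \<longleftrightarrow>
     openin X (chart_dom c) \<and> open (chart_image c) \<and>
     homeomorphic_map (subtopology X (chart_dom c)) (top_of_set (chart_image c)) (snd c)"

definition local_rep ::
    "('m, 'n) chart \<Rightarrow> ('p, 'k) chart \<Rightarrow> ('m \<Rightarrow> 'p) \<Rightarrow> real ^ 'n \<Rightarrow> real ^ 'k" where
  "local_rep c d F x = snd d (F (chart_inv c x))"

definition local_rep_dom ::
    "('m, 'n) chart \<Rightarrow> ('p, 'k) chart \<Rightarrow> ('m \<Rightarrow> 'p) \<Rightarrow> (real ^ 'n) set" where
  "local_rep_dom c d F = snd c ` {p \<in> chart_dom c. F p \<in> chart_dom d}"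

text \<open>
  The atlas \<open>A\<close> need not be maximal. The transition map from \<open>c\<close> to \<open>d\<close> is the local
  representative of the identity.
\<close>

definition smooth_manifold :: "'m topology \<Rightarrow> ('m, 'n::finite) chart set \<Rightarrow> bool" where
  "smooth_manifold X A \<longleftrightarrow>
     Hausdorff_space X \<and> second_countable X \<and>
     (\<forall>c\<in>A. is_chart X c) \<and> topspace X = (\<Union>c\<in>A. chart_dom c) \<and>
     (\<forall>c\<in>A. \<forall>d\<in>A. smooth_on (local_rep_dom c d id) (local_rep c d id))"

definition smooth_map ::
    "'m topology \<Rightarrow> ('m, 'n::finite) chart set \<Rightarrow> 'p topology \<Rightarrow> ('p, 'k::finite) chart set
      \<Rightarrow> ('m \<Rightarrow> 'p) \<Rightarrow> bool" where
  "smooth_map X A Y B F \<longleftrightarrow>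
     continuous_map X Y F \<and>
     (\<forall>c\<in>A. \<forall>d\<in>B. smooth_on (local_rep_dom c d F) (local_rep c d F))"

definition diffeomorphism ::
    "'m topology \<Rightarrow> ('m, 'n::finite) chart set \<Rightarrow> 'p topology \<Rightarrow> ('p, 'k::finite) chart set
      \<Rightarrow> ('m \<Rightarrow> 'p) \<Rightarrow> bool" where
  "diffeomorphism X A Y B F \<longleftrightarrow>
     bij_betw F (topspace X) (topspace Y) \<and>
     smooth_map X A Y B F \<and> smooth_map Y B X A (inv_into (topspace X) F)"

definition smooth_function :: "('m, 'n::finite) chart set \<Rightarrow> ('m \<Rightarrow> real) \<Rightarrow> bool" where
  "smooth_function A f \<longleftrightarrow> (\<forall>c\<in>A. smooth_on (chart_image c) (\<lambda>x. f (chart_inv c x)))"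


section \<open>Covariant 2-tensor fields and Riemannian metrics\<close>

text \<open>
  A covariant 2-tensor field is given classically, by its component matrix in each chart of
  the atlas, as a function of the coordinates; the components in different charts have to be
  related by the tensor transformation law.
\<close>

type_synonym ('m, 'n) tensor2 = "('m, 'n) chart \<Rightarrow> real ^ 'n \<Rightarrow> real ^ 'n ^ 'n"

definition pullback ::
    "('m, 'n::finite) chart \<Rightarrow> ('p, 'k::finite) chart \<Rightarrow> ('m \<Rightarrow> 'p) \<Rightarrow> ('p, 'k) tensor2
      \<Rightarrow> real ^ 'n \<Rightarrow> real ^ 'n ^ 'n" where
  \<comment> \<open>the components in the chart \<open>c\<close> of the pullback of \<open>T\<close> under \<open>F\<close>, computed from the
      components of \<open>T\<close> in the chart \<open>d\<close>: \<open>\<Sum>a b. \<partial>\<^sub>iF\<^sup>a \<partial>\<^sub>jF\<^sup>b T\<^sub>a\<^sub>b(F x)\<close>\<close>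
  "pullback c d F T x =
     (let J = matrix (frechet_derivative (local_rep c d F) (at x))
      in transpose J ** T d (local_rep c d F x) ** J)"

definition smooth_tensor2 :: "('m, 'n::finite) chart set \<Rightarrow> ('m, 'n) tensor2 \<Rightarrow> bool" where
  "smooth_tensor2 A T \<longleftrightarrow>
     (\<forall>c\<in>A. smooth_on (chart_image c) (T c)) \<and>
     (\<forall>c\<in>A. \<forall>d\<in>A. \<forall>x\<in>local_rep_dom c d id. T c x = pullback c d id T x)"

definition riemannian_metric :: "('m, 'n::finite) chart set \<Rightarrow> ('m, 'n) tensor2 \<Rightarrow> bool" where
  "riemannian_metric A g \<longleftrightarrow>
     smooth_tensor2 A g \<and>
     (\<forall>c\<in>A. \<forall>x\<in>chart_image c.
        transpose (g c x) = g c x \<and> (\<forall>v. v \<noteq> 0 \<longrightarrow> v \<bullet> (g c x *v v) > 0))"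


section \<open>Levi-Civita connection and curvature in coordinates\<close>

text \<open>Here \<open>G\<close> is the component matrix of a metric in a fixed chart.\<close>

definition partial_deriv :: "'n::finite \<Rightarrow> (real ^ 'n \<Rightarrow> real) \<Rightarrow> real ^ 'n \<Rightarrow> real" where
  "partial_deriv i f x = frechet_derivative f (at x) (axis i 1)"

definition christoffel ::
    "(real ^ 'n::finite \<Rightarrow> real ^ 'n ^ 'n) \<Rightarrow> 'n \<Rightarrow> 'n \<Rightarrow> 'n \<Rightarrow> real ^ 'n \<Rightarrow> real" where
  \<comment> \<open>\<open>christoffel G k i j\<close> is \<open>\<Gamma>\<^sup>k\<^sub>i\<^sub>j\<close>\<close>
  "christoffel G k i j x =
     (\<Sum>l\<in>UNIV. matrix_inv (G x) $ k $ l *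
        (partial_deriv i (\<lambda>y. G y $ j $ l) x + partial_deriv j (\<lambda>y. G y $ i $ l) x
          - partial_deriv l (\<lambda>y. G y $ i $ j) x)) / 2"

definition riemann ::
    "(real ^ 'n::finite \<Rightarrow> real ^ 'n ^ 'n) \<Rightarrow> 'n \<Rightarrow> 'n \<Rightarrow> 'n \<Rightarrow> 'n \<Rightarrow> real ^ 'n \<Rightarrow> real" where
  \<comment> \<open>\<open>riemann G l i j k\<close> is the \<open>\<partial>\<^sub>l\<close>-component of
      \<open>R(\<partial>\<^sub>i,\<partial>\<^sub>j)\<partial>\<^sub>k = \<nabla>\<^sub>i\<nabla>\<^sub>j\<partial>\<^sub>k - \<nabla>\<^sub>j\<nabla>\<^sub>i\<partial>\<^sub>k\<close>\<close>
  "riemann G l i j k x =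
     partial_deriv i (christoffel G l j k) x - partial_deriv j (christoffel G l i k) x
     + (\<Sum>m\<in>UNIV. christoffel G l i m x * christoffel G m j k x
                   - christoffel G l j m x * christoffel G m i k x)"

text \<open>The Ricci tensor is the trace over \<open>l = i\<close>, so it is positive on round spheres.\<close>

definition ricci ::
    "(real ^ 'n::finite \<Rightarrow> real ^ 'n ^ 'n) \<Rightarrow> real ^ 'n \<Rightarrow> real ^ 'n ^ 'n" where
  "ricci G x = (\<chi> j k. \<Sum>i\<in>UNIV. riemann G i i j k x)"

definition hessian ::
    "(real ^ 'n::finite \<Rightarrow> real ^ 'n ^ 'n) \<Rightarrow> (real ^ 'n \<Rightarrow> real) \<Rightarrow> real ^ 'n \<Rightarrow> real ^ 'n ^ 'n" where
  "hessian G f x =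
     (\<chi> i j. partial_deriv i (partial_deriv j f) x
              - (\<Sum>k\<in>UNIV. christoffel G k i j x * partial_deriv k f x))"


section \<open>Ricci flow and expanding solitons\<close>

definition ricci_flow ::
    "('m, 'n::finite) chart set \<Rightarrow> real \<Rightarrow> real \<Rightarrow> (real \<Rightarrow> ('m, 'n) tensor2) \<Rightarrow> bool" where
  "ricci_flow A t1 t2 g \<longleftrightarrow>
     (\<forall>t\<in>{t1..t2}. riemannian_metric A (g t)) \<and>
     (\<forall>c\<in>A. smooth_on ({t1..t2} \<times> chart_image c) (\<lambda>(t, x). g t c x)) \<and>
     (\<forall>c\<in>A. \<forall>x\<in>chart_image c. \<forall>t\<in>{t1..t2}.
        ((\<lambda>s. g s c x) has_vector_derivative (- 2) *\<^sub>R ricci (g t c) x) (at t within {t1..t2}))"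

definition expanding_gradient_ricci_soliton ::
    "('m, 'n::finite) chart set \<Rightarrow> ('m, 'n) tensor2 \<Rightarrow> bool" where
  "expanding_gradient_ricci_soliton A g \<longleftrightarrow>
     riemannian_metric A g \<and>
     (\<exists>f \<tau>. smooth_function A f \<and> \<tau> > 0 \<and>
        (\<forall>c\<in>A. \<forall>x\<in>chart_image c.
           ricci (g c) x + hessian (g c) (\<lambda>y. f (chart_inv c y)) x
             + (1 / (2 * \<tau>)) *\<^sub>R g c x = 0))"

end

theory Submission
  imports Defs
begin

text \<open>
  Compact expanding breathers are Einstein metrics of negative scalar curvature; an Einstein metric
  \<open>Rc = k g\<close> with \<open>k < 0\<close> is an expanding gradient soliton with potential \<open>f = 0\<close> and \<open>\<tau> = - 1 / (2 k)\<close>.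
  The argument is the one of Hamilton and Ivey; it compares the minimum of the scalar curvature \<open>R\<close>
  with the volume.

  Let \<open>n\<close> be the dimension, \<open>r \<le> 0\<close> the smaller of \<open>0\<close> and the minimum of \<open>R\<close> at time \<open>t\<^sub>1\<close>, and put
  \<open>q(t) = 1 - (2/n) r (t - t\<^sub>1)\<close> (the function \<open>dil\<close> below) and \<open>\<rho> = r / q\<close>, so that \<open>\<rho>' = (2/n) \<rho>\<^sup>2\<close>. Three facts are combined.

    \<^item> Along the flow \<open>\<partial>\<^sub>tR = \<Delta>R + 2 |Rc|\<^sup>2\<close> and \<open>|Rc|\<^sup>2 \<ge> R\<^sup>2 / n\<close>, so the minimum principle gives
      \<open>R \<ge> \<rho>\<close> (lemma \<open>R_ge\<close>).
    \<^item> \<open>\<partial>\<^sub>t log det g = - 2 R \<le> - 2 \<rho> = n \<partial>\<^sub>t log q\<close>, hence \<open>det g(t\<^sub>2) \<le> q(t\<^sub>2)\<^sup>n det g(t\<^sub>1)\<close> in every chart,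
      and equality at a point forces \<open>R = \<rho>\<close> there at all times (lemmas \<open>density_antimono\<close> and
      \<open>R_eq_of_density_eq\<close>).
    \<^item> The scalar curvature is natural under diffeomorphisms, so \<open>R\<close> attains the value \<open>r / \<alpha>\<close> at time
      \<open>t\<^sub>2\<close> if \<open>r\<close> is attained at time \<open>t\<^sub>1\<close>. As \<open>R \<ge> \<rho>\<close>, this means \<open>q(t\<^sub>2) \<le> \<alpha>\<close>.

  Together these say that the diffeomorphism \<open>\<Phi>\<close> does not increase the volume element of \<open>g(t\<^sub>1)\<close>
  anywhere. It maps the closed manifold onto itself and therefore preserves the total volume, so it
  preserves the volume element pointwise (lemma \<open>volume_density_preserved\<close>). Hence \<open>q(t\<^sub>2) = \<alpha> > 1\<close>,
  which makes \<open>r\<close> negative, and \<open>R = \<rho>\<close> everywhere. Then \<open>R\<close> is constant in space, the evolution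
  equation becomes \<open>|Rc|\<^sup>2 = R\<^sup>2 / n\<close>, and this is the equality case of the Cauchy--Schwarz inequality:
  \<open>Rc = (R / n) g\<close>.

  The evolution equation and the naturality of \<open>R\<close> are identities between partial derivatives. They are
  proved algebraically, over an arbitrary commutative ring with commuting derivations, from the two
  properties that characterise the Levi-Civita connection; the germs of smooth functions at a point of
  space-time are such a ring.
\<close>

section \<open>Tensor calculus over a ring with commuting derivations\<close>

definition derivation :: "('r::{comm_ring_1,real_algebra_1} \<Rightarrow> 'r) \<Rightarrow> bool" where
  "derivation d \<longleftrightarrow> (\<forall>x y. d (x + y) = d x + d y) \<and> (\<forall>x y. d (x * y) = d x * y + x * d y)
     \<and> (\<forall>r x. d (r *\<^sub>R x) = r *\<^sub>R d x)"

lemma derivation_add: "derivation d \<Longrightarrow> d (x + y) = d x + d y"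
  and derivation_mult: "derivation d \<Longrightarrow> d (x * y) = d x * y + x * d y"
  and derivation_scaleR: "derivation d \<Longrightarrow> d (r *\<^sub>R x) = r *\<^sub>R d x"
  by (auto simp: derivation_def)

lemma derivation_0 [simp]: "derivation d \<Longrightarrow> d 0 = 0"
  using derivation_scaleR[of d 0 0] by simp

lemma derivation_1 [simp]: "derivation d \<Longrightarrow> d 1 = 0"
  using derivation_mult[of d 1 1] by simp

lemma derivation_uminus: "derivation d \<Longrightarrow> d (- x) = - d x"
  using derivation_scaleR[of d "-1" x] by simp

lemma derivation_diff: "derivation d \<Longrightarrow> d (x - y) = d x - d y"
  using derivation_add[of d x "-y"] by (simp add: derivation_uminus)

lemma derivation_sum: "derivation d \<Longrightarrow> d (sum f A) = (\<Sum>a\<in>A. d (f a))"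
  by (induction A rule: infinite_finite_induct) (auto simp: derivation_add)

lemmas derivation_rules =
  derivation_add derivation_mult derivation_scaleR derivation_uminus derivation_diff derivation_sum

definition entrywise :: "('r \<Rightarrow> 's) \<Rightarrow> 'r ^ 'n ^ 'm \<Rightarrow> 's ^ 'n ^ 'm" where
  "entrywise d M = (\<chi> i j. d (M $ i $ j))"

lemma entrywise_nth [simp]: "entrywise d M $ i $ j = d (M $ i $ j)"
  by (simp add: entrywise_def)

lemma entrywise_transpose: "entrywise d (transpose M) = transpose (entrywise d M)"
  by (simp add: entrywise_def transpose_def)

context
  fixes d :: "'r::{comm_ring_1,real_algebra_1} \<Rightarrow> 'r"
  assumes d: "derivation d"
begin

lemma entrywise_add: "entrywise d (M + N) = entrywise d M + entrywise d N"
  by (simp add: vec_eq_iff derivation_rules[OF d])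

lemma entrywise_diff: "entrywise d (M - N) = entrywise d M - entrywise d N"
  by (simp add: vec_eq_iff derivation_rules[OF d])

lemma entrywise_uminus: "entrywise d (- M) = - entrywise d M"
  by (simp add: vec_eq_iff derivation_rules[OF d])

lemma entrywise_scaleR: "entrywise d (c *\<^sub>R M) = c *\<^sub>R entrywise d M"
  by (simp add: vec_eq_iff derivation_rules[OF d])

lemma entrywise_mult: "entrywise d (M ** N) = entrywise d M ** N + M ** entrywise d N"
  by (simp add: vec_eq_iff derivation_rules[OF d] matrix_matrix_mult_def sum.distrib)

lemma entrywise_one: "entrywise d (mat 1 :: 'r ^ 'n ^ 'n) = 0"
  using d by (simp add: vec_eq_iff mat_def)

lemmas entrywise_rules = entrywise_add entrywise_diff entrywise_uminus entrywise_scaleR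
  entrywise_mult entrywise_one

end

lemma matrix_mul_algebra:
  fixes A B C :: "'r::comm_ring_1 ^ 'n ^ 'n"
  shows "(A + B) ** C = A ** C + B ** C" "A ** (B + C) = A ** B + A ** C"
    "(A - B) ** C = A ** C - B ** C" "A ** (B - C) = A ** B - A ** C"
    "(- A) ** C = - (A ** C)" "A ** (- C) = - (A ** C)"
    "(A ** B) ** C = A ** (B ** C)"
  by (simp_all only: matrix_mul_assoc)
     (simp_all add: vec_eq_iff matrix_matrix_mult_def sum.distrib algebra_simps sum_subtractf sum_negf)

lemma transpose_algebra:
  fixes A B :: "'r::comm_ring_1 ^ 'n ^ 'n"
  shows "transpose (A + B) = transpose A + transpose B" "transpose (- A) = - transpose A"
    "transpose (A - B) = transpose A - transpose B"
  by (simp_all add: vec_eq_iff transpose_def)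

lemma matrix_mul_scaleR:
  fixes A B :: "'r::real_algebra_1 ^ 'n ^ 'n"
  shows "(c *\<^sub>R A) ** B = c *\<^sub>R (A ** B)" "A ** (c *\<^sub>R B) = c *\<^sub>R (A ** B)"
  by (simp_all add: scalar_matrix_assoc matrix_scalar_ac)

text \<open>
  Traces are iterated sums; this moves a further summation index out of a trace.
\<close>

lemma sum_mult_swap:
  fixes h :: "'i \<Rightarrow> 'j \<Rightarrow> 'r::comm_ring_1"
  shows "(\<Sum>k\<in>A. \<Sum>m\<in>B. h k m * (\<Sum>p\<in>C. f p k m)) = (\<Sum>p\<in>C. \<Sum>k\<in>A. \<Sum>m\<in>B. h k m * f p k m)"
proof -
  have "(\<Sum>k\<in>A. \<Sum>m\<in>B. h k m * (\<Sum>p\<in>C. f p k m)) = (\<Sum>k\<in>A. \<Sum>p\<in>C. \<Sum>m\<in>B. h k m * f p k m)"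
    by (rule sum.cong[OF refl], simp add: sum_distrib_left, subst sum.swap) simp
  also have "\<dots> = (\<Sum>p\<in>C. \<Sum>k\<in>A. \<Sum>m\<in>B. h k m * f p k m)"
    by (rule sum.swap)
  finally show ?thesis .
qed

text \<open>
  \<open>D i\<close> plays the role of the \<open>i\<close>-th partial derivative, \<open>G\<close> that of the metric in coordinates.
\<close>

locale metric_algebra =
  fixes D :: "'n::finite \<Rightarrow> 'r::{comm_ring_1,real_algebra_1} \<Rightarrow> 'r" and G H :: "'r ^ 'n ^ 'n"
  assumes D: "\<And>i. derivation (D i)"
    and D_commute: "\<And>i j x. D i (D j x) = D j (D i x)"
    and G_sym: "transpose G = G"
    and HG: "H ** G = mat 1"
    and GH: "G ** H = mat 1"
begin

lemma H_sym: "transpose H = H"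
proof -
  have "transpose H ** G = mat 1"
    using arg_cong[OF GH, of transpose] by (simp add: matrix_transpose_mul G_sym)
  then have "transpose H ** (G ** H) = H"
    by (metis matrix_mul_assoc matrix_mul_lid)
  then show ?thesis by (simp add: GH)
qed

lemma G_swap: "G $ i $ j = G $ j $ i"
  using arg_cong[OF G_sym, of "\<lambda>M. M $ j $ i"] by (simp add: transpose_def)

lemma H_swap: "H $ i $ j = H $ j $ i"
  using arg_cong[OF H_sym, of "\<lambda>M. M $ j $ i"] by (simp add: transpose_def)

lemma entrywise_D_commute: "entrywise (D i) (entrywise (D j) M) = entrywise (D j) (entrywise (D i) M)"
  by (simp add: vec_eq_iff D_commute)

end

text \<open>
  \<open>om k $ l $ j\<close> stands for \<open>\<Gamma>\<^sup>l\<^sub>k\<^sub>j\<close>. A torsion-free metric connection is all that the calculus needs;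
  its explicit formula would only lengthen the computations. With \<open>om k\<close> read as a matrix, the
  curvature \<open>curv i j $ l $ k\<close>, which is \<open>R\<^sup>l\<^sub>i\<^sub>j\<^sub>k\<close>, is the usual expression \<open>d\<omega> + \<omega> \<and> \<omega>\<close>.
\<close>

locale levi_civita = metric_algebra D G H
  for D :: "'n::finite \<Rightarrow> 'r::{comm_ring_1,real_algebra_1} \<Rightarrow> 'r" and G H :: "'r ^ 'n ^ 'n" +
  fixes om :: "'n \<Rightarrow> 'r ^ 'n ^ 'n"
  assumes om_swap: "\<And>l k j. om k $ l $ j = om j $ l $ k"
    and D_metric: "\<And>k. entrywise (D k) G = transpose (om k) ** G + G ** om k"
begin

definition curv :: "'n \<Rightarrow> 'n \<Rightarrow> 'r ^ 'n ^ 'n" where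
  "curv i j = entrywise (D i) (om j) - entrywise (D j) (om i) + om i ** om j - om j ** om i"

definition ric :: "'r ^ 'n ^ 'n" where
  "ric = (\<chi> j k. \<Sum>i\<in>UNIV. curv i j $ i $ k)"

definition scal :: 'r where
  "scal = (\<Sum>j\<in>UNIV. \<Sum>k\<in>UNIV. H $ j $ k * ric $ j $ k)"

lemma scal_trace: "scal = trace (H ** ric)"
proof -
  have "scal = (\<Sum>k\<in>UNIV. \<Sum>j\<in>UNIV. H $ k $ j * ric $ j $ k)"
    unfolding scal_def by (subst sum.swap) (simp add: H_swap)
  then show ?thesis by (simp add: trace_def matrix_matrix_mult_def)
qed

lemma D_H: "entrywise (D k) H = - (om k ** H) - H ** transpose (om k)"
proof -
  let ?D = "entrywise (D k)"
  have "?D H ** G + H ** ?D G = 0"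
    using arg_cong[OF HG, of ?D] by (simp add: entrywise_rules[OF D])
  then have "?D H ** G = - (H ** ?D G)"
    by (simp add: eq_neg_iff_add_eq_0)
  then have "(?D H ** G) ** H = - (H ** ?D G) ** H" by simp
  then have "?D H ** (G ** H) = - (H ** (transpose (om k) ** (G ** H))) - (H ** G) ** (om k ** H)"
    by (simp add: D_metric matrix_mul_algebra)
  then show ?thesis by (simp add: GH HG)
qed

lemma D_H_entry:
  "D k (H $ i $ j) = - (\<Sum>p\<in>UNIV. om k $ i $ p * H $ p $ j) - (\<Sum>p\<in>UNIV. om k $ j $ p * H $ i $ p)"
  using arg_cong[OF D_H[of k], of "\<lambda>M. M $ i $ j"]
  by (simp add: matrix_matrix_mult_def transpose_def mult.commute)

lemma curv_swap: "curv j i = - curv i j"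
  by (simp add: curv_def)

text \<open>
  Antisymmetry of \<open>R\<^sub>i\<^sub>j\<^sub>k\<^sub>l\<close> in the last two indices: differentiate \<open>G\<close> twice with the metric property
  and use that \<open>D i\<close> and \<open>D j\<close> commute.
\<close>

lemma curv_antisym: "transpose (curv i j) ** G = - (G ** curv i j)"
proof -
  have "transpose (curv i j) ** G + G ** curv i j
      = entrywise (D i) (entrywise (D j) G) - entrywise (D j) (entrywise (D i) G)"
    by (simp add: D_metric entrywise_rules[OF D] curv_def transpose_algebra matrix_mul_algebra
        entrywise_transpose matrix_transpose_mul algebra_simps)
  then have "transpose (curv i j) ** G + G ** curv i j = 0"
    by (simp add: entrywise_D_commute)
  then show ?thesis by (simp add: eq_neg_iff_add_eq_0)
qed

lemma curv_H_antisym: "curv i j ** H = - transpose (curv i j ** H)"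
proof -
  have "H ** (transpose (curv i j) ** G) ** H = - (H ** (G ** curv i j) ** H)"
    by (simp add: curv_antisym matrix_mul_algebra)
  moreover have "H ** (transpose (curv i j) ** G) ** H = H ** transpose (curv i j)"
    by (metis GH matrix_mul_assoc matrix_mul_rid)
  moreover have "H ** (G ** curv i j) ** H = curv i j ** H"
    by (metis HG matrix_mul_assoc matrix_mul_lid)
  ultimately show ?thesis by (simp add: matrix_transpose_mul H_sym)
qed

definition dcurv :: "'n \<Rightarrow> 'n \<Rightarrow> 'n \<Rightarrow> 'r ^ 'n ^ 'n" where
  "dcurv k i j = entrywise (D k) (curv i j) + om k ** curv i j - curv i j ** om k"

text \<open>
  The second Bianchi identity \<open>d\<Omega> + [\<omega>, \<Omega>] = 0\<close>. The connection acts here only on the matrix indices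
  of the curvature, not on the form indices \<open>i\<close> and \<open>j\<close>.
\<close>

lemma bianchi: "dcurv k i j + dcurv i j k + dcurv j k i = 0"
  unfolding dcurv_def curv_def
  by (simp add: entrywise_rules[OF D] matrix_mul_algebra entrywise_D_commute[of i k]
       entrywise_D_commute[of j k]  entrywise_D_commute[of j i])

text \<open>
  The covariant derivative \<open>\<nabla>\<^sub>kR\<^sup>l\<^sub>i\<^sub>j\<^sub>m\<close>, with the correction terms for all indices.
\<close>

definition nabla_curv :: "'n \<Rightarrow> 'n \<Rightarrow> 'n \<Rightarrow> 'n \<Rightarrow> 'n \<Rightarrow> 'r" where
  "nabla_curv k i j l m = dcurv k i j $ l $ m
     - (\<Sum>p\<in>UNIV. om k $ p $ i * curv p j $ l $ m) - (\<Sum>p\<in>UNIV. om k $ p $ j * curv i p $ l $ m)"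

lemma nabla_curv_swap: "nabla_curv k j i l m = - nabla_curv k i j l m"
  unfolding nabla_curv_def dcurv_def curv_swap[of i j]
  using curv_swap[of _ i] curv_swap[of j]
  by (simp add: entrywise_rules[OF D] matrix_mul_algebra sum_negf)

text \<open>
  The corrections for the form indices cancel in the cyclic sum because the connection is torsion
  free, so the second Bianchi identity holds for the full covariant derivative.
\<close>

lemma nabla_curv_cyclic:
  "nabla_curv k i j l m + nabla_curv i j k l m + nabla_curv j k i l m = 0"
proof -
  have *: "(\<Sum>p\<in>UNIV. om a $ p $ b * curv p c $ l $ m) = - (\<Sum>p\<in>UNIV. om b $ p $ a * curv c p $ l $ m)"
    for a b c
    unfolding sum_negf[symmetric]
    by (rule sum.cong) (simp_all add: om_swap[of a _ b] curv_swap[of _ c])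
  have "dcurv k i j $ l $ m + dcurv i j k $ l $ m + dcurv j k i $ l $ m = 0"
    using arg_cong[OF bianchi[of k i j], of "\<lambda>M. M $ l $ m"] by simp
  then show ?thesis
    unfolding nabla_curv_def *[of k i j] *[of i j k] *[of j k i] by (simp add: algebra_simps)
qed

definition nabla_ric :: "'n \<Rightarrow> 'r ^ 'n ^ 'n" where
  "nabla_ric k = entrywise (D k) ric - transpose (om k) ** ric - ric ** om k"

lemma nabla_ric_entry:
  "nabla_ric k $ j $ m = D k (ric $ j $ m) - (\<Sum>p\<in>UNIV. om k $ p $ j * ric $ p $ m)
     - (\<Sum>p\<in>UNIV. ric $ j $ p * om k $ p $ m)"
  by (simp add: nabla_ric_def matrix_matrix_mult_def transpose_def)

lemma trace_nabla_curv: "(\<Sum>i\<in>UNIV. nabla_curv k i j i m) = nabla_ric k $ j $ m"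
proof -
  have A: "(\<Sum>i\<in>UNIV. D k (curv i j $ i $ m)) = D k (ric $ j $ m)"
    by (simp add: ric_def derivation_sum[OF D])
  have B: "(\<Sum>i\<in>UNIV. \<Sum>p\<in>UNIV. om k $ i $ p * curv i j $ p $ m)
      = (\<Sum>i\<in>UNIV. \<Sum>p\<in>UNIV. om k $ p $ i * curv p j $ i $ m)"
    by (rule sum.swap)
  have C: "(\<Sum>i\<in>UNIV. \<Sum>p\<in>UNIV. curv i j $ i $ p * om k $ p $ m)
      = (\<Sum>p\<in>UNIV. ric $ j $ p * om k $ p $ m)"
    by (subst sum.swap) (simp add: ric_def sum_distrib_right)
  have E: "(\<Sum>i\<in>UNIV. \<Sum>p\<in>UNIV. om k $ p $ j * curv i p $ i $ m)
      = (\<Sum>p\<in>UNIV. om k $ p $ j * ric $ p $ m)"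
    by (subst sum.swap) (simp add: ric_def sum_distrib_left)
  show ?thesis
    by (simp add: nabla_curv_def dcurv_def matrix_matrix_mult_def sum.distrib sum_subtractf
        nabla_ric_entry A B C E)
qed

text \<open>
  The other contraction of the curvature, \<open>H\<^sup>k\<^sup>m R\<^sup>l\<^sub>j\<^sub>k\<^sub>m\<close>. By antisymmetry it is the Ricci tensor with
  one index raised.
\<close>

definition curv_up :: "'n \<Rightarrow> 'n \<Rightarrow> 'r" where
  "curv_up j l = (\<Sum>k\<in>UNIV. \<Sum>m\<in>UNIV. H $ k $ m * curv j k $ l $ m)"

lemma curv_up_ric: "curv_up j l = (\<Sum>m\<in>UNIV. H $ l $ m * ric $ j $ m)"
proof -
  have "curv_up j l = (\<Sum>k\<in>UNIV. (curv j k ** H) $ l $ k)"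
    by (simp add: curv_up_def matrix_matrix_mult_def H_swap mult.commute)
  also have "\<dots> = (\<Sum>k\<in>UNIV. (curv k j ** H) $ k $ l)"
  proof (rule sum.cong[OF refl])
    fix k
    have "(curv j k ** H) $ l $ k = - (curv j k ** H) $ k $ l"
      using arg_cong[OF curv_H_antisym[of j k], of "\<lambda>M. M $ l $ k"] by (simp add: transpose_def)
    also have "\<dots> = (curv k j ** H) $ k $ l"
      unfolding curv_swap[of j k] by (simp add: matrix_mul_algebra)
    finally show "(curv j k ** H) $ l $ k = (curv k j ** H) $ k $ l" .
  qed
  also have "\<dots> = (\<Sum>m\<in>UNIV. \<Sum>k\<in>UNIV. curv k j $ k $ m * H $ m $ l)"
    unfolding matrix_matrix_mult_def by simp (rule sum.swap)
  also have "\<dots> = (\<Sum>m\<in>UNIV. H $ l $ m * ric $ j $ m)"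
    by (simp add: ric_def H_swap[of l] mult.commute sum_distrib_left)
  finally show ?thesis .
qed

text \<open>
  Contraction commutes with covariant differentiation since \<open>\<nabla>H = 0\<close>; the right-hand side is
  \<open>\<nabla>\<^sub>i\<close> of the tensor \<open>curv_up\<close>.
\<close>

lemma trace_nabla_curv_up:
  "(\<Sum>k\<in>UNIV. \<Sum>m\<in>UNIV. H $ k $ m * nabla_curv i j k l m)
     = D i (curv_up j l) + (\<Sum>p\<in>UNIV. om i $ l $ p * curv_up j p)
       - (\<Sum>p\<in>UNIV. om i $ p $ j * curv_up p l)"
proof -
  let ?c = "curv j"
  let ?S1 = "\<Sum>k\<in>UNIV. \<Sum>m\<in>UNIV. \<Sum>p\<in>UNIV. om i $ k $ p * H $ p $ m * ?c k $ l $ m"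
  let ?S2 = "\<Sum>k\<in>UNIV. \<Sum>m\<in>UNIV. \<Sum>p\<in>UNIV. om i $ m $ p * H $ k $ p * ?c k $ l $ m"
  have a: "(\<Sum>k\<in>UNIV. \<Sum>m\<in>UNIV. H $ k $ m * D i (?c k $ l $ m))
      = D i (curv_up j l) - (\<Sum>k\<in>UNIV. \<Sum>m\<in>UNIV. D i (H $ k $ m) * ?c k $ l $ m)"
    by (simp add: curv_up_def derivation_rules[OF D] sum.distrib)
  have b: "(\<Sum>k\<in>UNIV. \<Sum>m\<in>UNIV. D i (H $ k $ m) * ?c k $ l $ m) = - ?S1 - ?S2"
    by (simp add: D_H_entry algebra_simps sum.distrib sum_subtractf sum_negf sum_distrib_left)
  have c: "(\<Sum>k\<in>UNIV. \<Sum>m\<in>UNIV. H $ k $ m * (\<Sum>p\<in>UNIV. ?c k $ l $ p * om i $ p $ m)) = ?S2"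
    by (rule sum.cong[OF refl], simp add: sum_distrib_left, subst sum.swap) (simp add: mult_ac)
  have d: "(\<Sum>k\<in>UNIV. \<Sum>m\<in>UNIV. H $ k $ m * (\<Sum>p\<in>UNIV. om i $ p $ k * ?c p $ l $ m)) = ?S1"
  proof -
    have "(\<Sum>k\<in>UNIV. \<Sum>m\<in>UNIV. H $ k $ m * (\<Sum>p\<in>UNIV. om i $ p $ k * ?c p $ l $ m))
       = (\<Sum>m\<in>UNIV. \<Sum>k\<in>UNIV. \<Sum>p\<in>UNIV. H $ k $ m * (om i $ p $ k * ?c p $ l $ m))"
      by (subst sum.swap) (simp add: sum_distrib_left)
    also have "\<dots> = (\<Sum>m\<in>UNIV. \<Sum>p\<in>UNIV. \<Sum>k\<in>UNIV. H $ k $ m * (om i $ p $ k * ?c p $ l $ m))"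
      by (rule sum.cong[OF refl], rule sum.swap)
    also have "\<dots> = (\<Sum>p\<in>UNIV. \<Sum>m\<in>UNIV. \<Sum>k\<in>UNIV. H $ k $ m * (om i $ p $ k * ?c p $ l $ m))"
      by (rule sum.swap)
    finally show ?thesis by (simp add: mult_ac)
  qed
  have swap_out: "(\<Sum>k\<in>UNIV. \<Sum>m\<in>UNIV. H $ k $ m * (\<Sum>p\<in>UNIV. u p * f p k m))
      = (\<Sum>p\<in>UNIV. u p * (\<Sum>k\<in>UNIV. \<Sum>m\<in>UNIV. H $ k $ m * f p k m))"
    for u :: "'n \<Rightarrow> 'r" and f :: "'n \<Rightarrow> 'n \<Rightarrow> 'n \<Rightarrow> 'r"
    unfolding sum_mult_swap by (simp add: sum_distrib_left mult.left_commute)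
  have "(\<Sum>k\<in>UNIV. \<Sum>m\<in>UNIV. H $ k $ m * nabla_curv i j k l m)
     = (\<Sum>k\<in>UNIV. \<Sum>m\<in>UNIV. H $ k $ m * D i (?c k $ l $ m))
       + (\<Sum>k\<in>UNIV. \<Sum>m\<in>UNIV. H $ k $ m * (\<Sum>p\<in>UNIV. om i $ l $ p * ?c k $ p $ m))
       - (\<Sum>k\<in>UNIV. \<Sum>m\<in>UNIV. H $ k $ m * (\<Sum>p\<in>UNIV. ?c k $ l $ p * om i $ p $ m))
       - (\<Sum>k\<in>UNIV. \<Sum>m\<in>UNIV. H $ k $ m * (\<Sum>p\<in>UNIV. om i $ p $ j * curv p k $ l $ m))
       - (\<Sum>k\<in>UNIV. \<Sum>m\<in>UNIV. H $ k $ m * (\<Sum>p\<in>UNIV. om i $ p $ k * ?c p $ l $ m))"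
    by (simp add: nabla_curv_def dcurv_def matrix_matrix_mult_def distrib_left right_diff_distrib
        sum.distrib sum_subtractf)
  then show ?thesis
    unfolding a b c d swap_out by (simp add: curv_up_def)
qed

lemma trace_nabla_ric_up:
  "(\<Sum>m\<in>UNIV. H $ l $ m * nabla_ric i $ j $ m)
     = D i (curv_up j l) + (\<Sum>p\<in>UNIV. om i $ l $ p * curv_up j p)
       - (\<Sum>p\<in>UNIV. om i $ p $ j * curv_up p l)"
proof -
  let ?S1 = "\<Sum>m\<in>UNIV. \<Sum>p\<in>UNIV. om i $ l $ p * H $ p $ m * ric $ j $ m"
  let ?S2 = "\<Sum>m\<in>UNIV. \<Sum>p\<in>UNIV. om i $ m $ p * H $ l $ p * ric $ j $ m"
  have a: "(\<Sum>m\<in>UNIV. H $ l $ m * D i (ric $ j $ m))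
      = D i (curv_up j l) - (\<Sum>m\<in>UNIV. D i (H $ l $ m) * ric $ j $ m)"
    by (simp add: curv_up_ric derivation_rules[OF D] sum.distrib)
  have b: "(\<Sum>m\<in>UNIV. D i (H $ l $ m) * ric $ j $ m) = - ?S1 - ?S2"
    by (simp add: D_H_entry algebra_simps sum.distrib sum_subtractf sum_negf sum_distrib_left)
  have c: "(\<Sum>m\<in>UNIV. H $ l $ m * (\<Sum>p\<in>UNIV. ric $ j $ p * om i $ p $ m)) = ?S2"
    by (simp add: sum_distrib_left, subst sum.swap) (simp add: mult_ac)
  have d: "(\<Sum>p\<in>UNIV. om i $ l $ p * curv_up j p) = ?S1"
    by (simp add: curv_up_ric sum_distrib_left, subst sum.swap) (simp add: mult_ac)
  have e: "(\<Sum>m\<in>UNIV. H $ l $ m * (\<Sum>p\<in>UNIV. om i $ p $ j * ric $ p $ m))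
      = (\<Sum>p\<in>UNIV. om i $ p $ j * curv_up p l)"
    by (simp add: curv_up_ric sum_distrib_left, subst sum.swap) (simp add: mult_ac)
  show ?thesis
    unfolding nabla_ric_entry
    by (simp add: right_diff_distrib sum_subtractf a b c d e)
qed

lemma D_scal: "(\<Sum>k\<in>UNIV. \<Sum>m\<in>UNIV. H $ k $ m * nabla_ric j $ k $ m) = D j scal"
proof -
  let ?S1 = "\<Sum>k\<in>UNIV. \<Sum>m\<in>UNIV. \<Sum>p\<in>UNIV. om j $ k $ p * H $ p $ m * ric $ k $ m"
  let ?S2 = "\<Sum>k\<in>UNIV. \<Sum>m\<in>UNIV. \<Sum>p\<in>UNIV. om j $ m $ p * H $ k $ p * ric $ k $ m"
  have a: "(\<Sum>k\<in>UNIV. \<Sum>m\<in>UNIV. H $ k $ m * D j (ric $ k $ m))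
      = D j scal - (\<Sum>k\<in>UNIV. \<Sum>m\<in>UNIV. D j (H $ k $ m) * ric $ k $ m)"
    by (simp add: scal_def derivation_rules[OF D] sum.distrib)
  have b: "(\<Sum>k\<in>UNIV. \<Sum>m\<in>UNIV. D j (H $ k $ m) * ric $ k $ m) = - ?S1 - ?S2"
    by (simp add: D_H_entry algebra_simps sum.distrib sum_subtractf sum_negf sum_distrib_left)
  have c: "(\<Sum>k\<in>UNIV. \<Sum>m\<in>UNIV. H $ k $ m * (\<Sum>p\<in>UNIV. ric $ k $ p * om j $ p $ m)) = ?S2"
    by (rule sum.cong[OF refl], simp add: sum_distrib_left, subst sum.swap) (simp add: mult_ac)
  have d: "(\<Sum>k\<in>UNIV. \<Sum>m\<in>UNIV. H $ k $ m * (\<Sum>p\<in>UNIV. om j $ p $ k * ric $ p $ m)) = ?S1"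
  proof -
    have "(\<Sum>k\<in>UNIV. \<Sum>m\<in>UNIV. H $ k $ m * (\<Sum>p\<in>UNIV. om j $ p $ k * ric $ p $ m))
       = (\<Sum>m\<in>UNIV. \<Sum>k\<in>UNIV. \<Sum>p\<in>UNIV. H $ k $ m * (om j $ p $ k * ric $ p $ m))"
      by (subst sum.swap) (simp add: sum_distrib_left)
    also have "\<dots> = (\<Sum>m\<in>UNIV. \<Sum>p\<in>UNIV. \<Sum>k\<in>UNIV. H $ k $ m * (om j $ p $ k * ric $ p $ m))"
      by (rule sum.cong[OF refl], rule sum.swap)
    also have "\<dots> = (\<Sum>p\<in>UNIV. \<Sum>m\<in>UNIV. \<Sum>k\<in>UNIV. H $ k $ m * (om j $ p $ k * ric $ p $ m))"
      by (rule sum.swap)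
    finally show ?thesis by (simp add: mult_ac)
  qed
  show ?thesis
    unfolding nabla_ric_entry
    by (simp add: right_diff_distrib sum_subtractf a b c d)
qed

text \<open>
  Contract the cyclic sum once over the upper index and once with \<open>H\<close>: two of the three terms are the
  divergence of the Ricci tensor, the third is \<open>- D j scal\<close>.
\<close>

lemma contracted_bianchi:
  "2 *\<^sub>R (\<Sum>k\<in>UNIV. \<Sum>m\<in>UNIV. H $ k $ m * nabla_ric k $ j $ m) = D j scal"
proof -
  note out = sum_mult_swap[of "\<lambda>k m. H $ k $ m"]
  have 1: "(\<Sum>i\<in>UNIV. \<Sum>k\<in>UNIV. \<Sum>m\<in>UNIV. H $ k $ m * nabla_curv k i j i m)
      = (\<Sum>k\<in>UNIV. \<Sum>m\<in>UNIV. H $ k $ m * nabla_ric k $ j $ m)"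
    by (simp add: trace_nabla_curv flip: out)
  have 2: "(\<Sum>i\<in>UNIV. \<Sum>k\<in>UNIV. \<Sum>m\<in>UNIV. H $ k $ m * nabla_curv i j k i m)
      = (\<Sum>k\<in>UNIV. \<Sum>m\<in>UNIV. H $ k $ m * nabla_ric k $ j $ m)"
    by (simp add: trace_nabla_curv_up trace_nabla_ric_up)
  have 3: "(\<Sum>i\<in>UNIV. \<Sum>k\<in>UNIV. \<Sum>m\<in>UNIV. H $ k $ m * nabla_curv j k i i m) = - D j scal"
  proof -
    have eq: "nabla_curv j k i i m = - nabla_curv j i k i m" for i k m
      by (rule nabla_curv_swap)
    show ?thesis
      by (simp only: eq mult_minus_right sum_negf trace_nabla_curv D_scal flip: out)
  qed
  have "(\<Sum>i\<in>UNIV. \<Sum>k\<in>UNIV. \<Sum>m\<in>UNIV.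
      H $ k $ m * (nabla_curv k i j i m + nabla_curv i j k i m + nabla_curv j k i i m)) = 0"
    by (simp add: nabla_curv_cyclic)
  then show ?thesis
    by (simp add: distrib_left sum.distrib 1 2 3 scaleR_2)
qed

end

text \<open>
  \<open>T\<close> is the time derivative, and the last assumption is the Ricci flow equation.
\<close>

locale levi_civita_flow = levi_civita D G H om
  for D :: "'n::finite \<Rightarrow> 'r::{comm_ring_1,real_algebra_1} \<Rightarrow> 'r" and G H :: "'r ^ 'n ^ 'n" and om +
  fixes T :: "'r \<Rightarrow> 'r"
  assumes T: "derivation T"
    and T_D: "\<And>i x. T (D i x) = D i (T x)"
    and T_metric: "entrywise T G = - 2 *\<^sub>R ric"
begin

abbreviation om_dot :: "'n \<Rightarrow> 'r ^ 'n ^ 'n" where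
  "om_dot k \<equiv> entrywise T (om k)"

lemma T_entrywise_D: "entrywise T (entrywise (D i) M) = entrywise (D i) (entrywise T M)"
  by (simp add: vec_eq_iff T_D)

text \<open>
  The curvature changes by the exterior covariant derivative of the change of the connection.
\<close>

lemma T_curv:
  "entrywise T (curv i j) = (entrywise (D i) (om_dot j) + om i ** om_dot j - om_dot j ** om i)
     - (entrywise (D j) (om_dot i) + om j ** om_dot i - om_dot i ** om j)"
  unfolding curv_def
  by (simp add: entrywise_rules[OF T] T_entrywise_D algebra_simps)

lemma T_om: "transpose (om_dot k) ** G + G ** om_dot k = - 2 *\<^sub>R nabla_ric k"
proof -
  have "entrywise T (entrywise (D k) G) = - 2 *\<^sub>R entrywise (D k) ric"
    by (simp add: T_entrywise_D T_metric entrywise_rules[OF D])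
  then have "transpose (om_dot k) ** G + transpose (om k) ** (- 2 *\<^sub>R ric)
      + ((- 2 *\<^sub>R ric) ** om k + G ** om_dot k) = - 2 *\<^sub>R entrywise (D k) ric"
    by (simp only: D_metric entrywise_rules[OF T] entrywise_transpose T_metric)
  then show ?thesis
    by (simp add: nabla_ric_def matrix_mul_algebra matrix_mul_scaleR algebra_simps)
qed

definition om_dot_low :: "'n \<Rightarrow> 'n \<Rightarrow> 'n \<Rightarrow> 'r" where
  "om_dot_low k i j = (G ** om_dot k) $ i $ j"

lemma om_dot_low_swap: "om_dot_low k i j = om_dot_low j i k"
  by (simp add: om_dot_low_def matrix_matrix_mult_def om_swap[of k _ j])

lemma om_dot_low_nabla_ric: "om_dot_low k j i + om_dot_low k i j = - 2 *\<^sub>R nabla_ric k $ i $ j"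
proof -
  have "(transpose (om_dot k) ** G) $ i $ j = om_dot_low k j i"
    by (simp add: om_dot_low_def matrix_matrix_mult_def transpose_def mult.commute G_swap)
  then show ?thesis
    using arg_cong[OF T_om[of k], of "\<lambda>M. M $ i $ j"] by (simp add: om_dot_low_def)
qed

lemma trace_om_dot_low: "(\<Sum>i\<in>UNIV. \<Sum>j\<in>UNIV. H $ i $ j * om_dot_low k i j) = (\<Sum>i\<in>UNIV. om_dot k $ i $ i)"
proof -
  have "(\<Sum>i\<in>UNIV. \<Sum>j\<in>UNIV. H $ i $ j * om_dot_low k i j) = (\<Sum>i\<in>UNIV. \<Sum>j\<in>UNIV. H $ j $ i * om_dot_low k i j)"
    by (simp add: H_swap)
  also have "\<dots> = (\<Sum>j\<in>UNIV. (H ** (G ** om_dot k)) $ j $ j)"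
    by (subst sum.swap) (simp add: om_dot_low_def matrix_matrix_mult_def)
  also have "H ** (G ** om_dot k) = om_dot k"
    by (simp add: matrix_mul_assoc HG)
  finally show ?thesis .
qed

text \<open>
  Up to sign, the two traces of the tensor \<open>\<partial>\<^sub>t\<Gamma>\<close> are \<open>D scal\<close> (this lemma) and \<open>2 div Rc - D scal\<close>,
  which vanishes by the contracted Bianchi identity (lemma \<open>om_dot_trace_0\<close>). These are the only facts
  about \<open>\<partial>\<^sub>t\<Gamma>\<close> that enter the evolution of the scalar curvature.
\<close>

lemma trace_om_dot: "(\<Sum>i\<in>UNIV. om_dot k $ i $ i) = - D k scal"
proof -
  have "(\<Sum>i\<in>UNIV. \<Sum>j\<in>UNIV. H $ i $ j * om_dot_low k j i) = (\<Sum>i\<in>UNIV. \<Sum>j\<in>UNIV. H $ i $ j * om_dot_low k i j)"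
    by (subst sum.swap) (simp add: H_swap)
  then have "2 *\<^sub>R (\<Sum>i\<in>UNIV. om_dot k $ i $ i)
      = (\<Sum>i\<in>UNIV. \<Sum>j\<in>UNIV. H $ i $ j * (om_dot_low k j i + om_dot_low k i j))"
    by (simp add: distrib_left sum.distrib trace_om_dot_low scaleR_2)
  also have "\<dots> = 2 *\<^sub>R (- D k scal)"
    unfolding om_dot_low_nabla_ric by (simp add: scaleR_sum_right sum_negf flip: D_scal)
  finally show ?thesis by (simp only: scaleR_cancel_left) simp
qed

definition om_dot_trace :: "'n \<Rightarrow> 'r" where
  "om_dot_trace l = (\<Sum>j\<in>UNIV. \<Sum>k\<in>UNIV. om_dot j $ l $ k * H $ j $ k)"

lemma om_dot_trace_0: "om_dot_trace l = 0"
proof -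
  have 1: "(\<Sum>j\<in>UNIV. \<Sum>k\<in>UNIV. H $ j $ k * om_dot_low j i k) = 0" for i
  proof -
    have "(\<Sum>j\<in>UNIV. \<Sum>k\<in>UNIV. H $ j $ k * om_dot_low j k i) = (\<Sum>j\<in>UNIV. \<Sum>k\<in>UNIV. H $ k $ j * om_dot_low i k j)"
      by (simp add: om_dot_low_swap[of _ _ i] H_swap)
    also have "\<dots> = - D i scal"
      by (subst sum.swap) (simp only: trace_om_dot_low trace_om_dot)
    finally have "- D i scal + (\<Sum>j\<in>UNIV. \<Sum>k\<in>UNIV. H $ j $ k * om_dot_low j i k)
       = (\<Sum>j\<in>UNIV. \<Sum>k\<in>UNIV. H $ j $ k * (om_dot_low j k i + om_dot_low j i k))"
      by (simp add: distrib_left sum.distrib)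
    also have "\<dots> = - D i scal"
      unfolding om_dot_low_nabla_ric
      by (simp add: scaleR_sum_right sum_negf flip: contracted_bianchi)
    finally show ?thesis by simp
  qed
  have 2: "(\<Sum>l\<in>UNIV. G $ i $ l * om_dot_trace l) = 0" for i
  proof -
    have "(\<Sum>l\<in>UNIV. G $ i $ l * om_dot_trace l)
        = (\<Sum>j\<in>UNIV. \<Sum>l\<in>UNIV. \<Sum>k\<in>UNIV. G $ i $ l * (om_dot j $ l $ k * H $ j $ k))"
      unfolding om_dot_trace_def sum_distrib_left by (rule sum.swap)
    also have "\<dots> = (\<Sum>j\<in>UNIV. \<Sum>k\<in>UNIV. \<Sum>l\<in>UNIV. G $ i $ l * (om_dot j $ l $ k * H $ j $ k))"
      by (rule sum.cong[OF refl], rule sum.swap)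
    also have "\<dots> = (\<Sum>j\<in>UNIV. \<Sum>k\<in>UNIV. H $ j $ k * om_dot_low j i k)"
      by (simp add: om_dot_low_def matrix_matrix_mult_def sum_distrib_left mult_ac)
    finally show ?thesis using 1 by simp
  qed
  have "G *v (\<chi> l. om_dot_trace l) = 0"
    by (simp add: matrix_vector_mult_def vec_eq_iff 2)
  then have "(H ** G) *v (\<chi> l. om_dot_trace l) = 0"
    by (simp flip: matrix_vector_mul_assoc)
  then show ?thesis by (simp add: HG vec_eq_iff)
qed

text \<open>
  Tracing the formula for \<open>\<partial>\<^sub>tRc\<close> gives the divergence of \<open>om_dot_trace\<close>, which is zero, minus the
  divergence of the other trace, which is \<open>- D scal\<close>: so only the Laplacian of \<open>scal\<close> remains.
\<close>

lemma H_T_ric: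
  "(\<Sum>j\<in>UNIV. \<Sum>k\<in>UNIV. H $ j $ k * T (ric $ j $ k))
    = (\<Sum>j\<in>UNIV. \<Sum>k\<in>UNIV. H $ j $ k * (D j (D k scal) - (\<Sum>p\<in>UNIV. om j $ p $ k * D p scal)))"
proof -
  define U where "U = (\<lambda>j i k. D i (om_dot j $ i $ k) + (\<Sum>p\<in>UNIV. om i $ i $ p * om_dot j $ p $ k)
        - (\<Sum>p\<in>UNIV. om_dot j $ i $ p * om i $ p $ k) - (\<Sum>p\<in>UNIV. om j $ i $ p * om_dot i $ p $ k))"
  have Tr: "T (ric $ j $ k) = (\<Sum>i\<in>UNIV. U j i k)
      + (D j (D k scal) - (\<Sum>p\<in>UNIV. om j $ p $ k * D p scal))" for j k
  proof -
    have a: "(\<Sum>i\<in>UNIV. om_dot i $ i $ k) = - D k scal" for k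
      by (simp add: om_swap[of _ _ k] flip: trace_om_dot)
    have "(\<Sum>i\<in>UNIV. D j (om_dot i $ i $ k)) = - D j (D k scal)"
      using a[of k] by (simp add: derivation_uminus[OF D] flip: derivation_sum[OF D])
    moreover have "(\<Sum>i\<in>UNIV. \<Sum>p\<in>UNIV. om_dot i $ i $ p * om j $ p $ k)
        = - (\<Sum>p\<in>UNIV. om j $ p $ k * D p scal)"
    proof (subst sum.swap)
      show "(\<Sum>p\<in>UNIV. \<Sum>i\<in>UNIV. om_dot i $ i $ p * om j $ p $ k) = - (\<Sum>p\<in>UNIV. om j $ p $ k * D p scal)"
        unfolding sum_distrib_right[symmetric] a by (simp add: sum_negf mult.commute)
    qed
    moreover have "T (ric $ j $ k) = (\<Sum>i\<in>UNIV. entrywise T (curv i j) $ i $ k)"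
      by (simp add: ric_def derivation_sum[OF T])
    ultimately show ?thesis
      by (simp add: T_curv U_def matrix_matrix_mult_def sum.distrib sum_subtractf)
  qed
  have HU: "(\<Sum>j\<in>UNIV. \<Sum>k\<in>UNIV. H $ j $ k * (\<Sum>i\<in>UNIV. U j i k)) = 0"
  proof -
    have D0: "(\<Sum>j\<in>UNIV. \<Sum>k\<in>UNIV. D i (om_dot j $ i $ k) * H $ j $ k)
       = (\<Sum>j\<in>UNIV. \<Sum>k\<in>UNIV. \<Sum>p\<in>UNIV. om_dot j $ i $ k * om i $ j $ p * H $ p $ k)
         + (\<Sum>j\<in>UNIV. \<Sum>k\<in>UNIV. \<Sum>p\<in>UNIV. om_dot j $ i $ k * om i $ k $ p * H $ j $ p)" for i
    proof -
      have "D i (om_dot_trace i) = 0" by (simp add: om_dot_trace_0 D)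
      then show ?thesis
        unfolding om_dot_trace_def
        by (simp add: derivation_rules[OF D] D_H_entry sum.distrib right_diff_distrib sum_subtractf
            sum_negf sum_distrib_left algebra_simps)
    qed
    have D0': "(\<Sum>j\<in>UNIV. \<Sum>k\<in>UNIV. H $ j $ k * D i (om_dot j $ i $ k))
       = (\<Sum>j\<in>UNIV. \<Sum>k\<in>UNIV. \<Sum>p\<in>UNIV. om_dot j $ i $ k * om i $ j $ p * H $ p $ k)
         + (\<Sum>j\<in>UNIV. \<Sum>k\<in>UNIV. \<Sum>p\<in>UNIV. om_dot j $ i $ k * om i $ k $ p * H $ j $ p)" for i
      unfolding D0[of i, symmetric] by (simp only: mult.commute)
    have V0: "(\<Sum>j\<in>UNIV. \<Sum>k\<in>UNIV. H $ j $ k * (\<Sum>p\<in>UNIV. om i $ i $ p * om_dot j $ p $ k)) = 0" for i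
    proof -
      have "0 = (\<Sum>p\<in>UNIV. om i $ i $ p * om_dot_trace p)" by (simp add: om_dot_trace_0)
      also have "\<dots> = (\<Sum>j\<in>UNIV. \<Sum>p\<in>UNIV. \<Sum>k\<in>UNIV. om i $ i $ p * (om_dot j $ p $ k * H $ j $ k))"
        unfolding om_dot_trace_def sum_distrib_left by (rule sum.swap)
      also have "\<dots> = (\<Sum>j\<in>UNIV. \<Sum>k\<in>UNIV. \<Sum>p\<in>UNIV. om i $ i $ p * (om_dot j $ p $ k * H $ j $ k))"
        by (rule sum.cong[OF refl], rule sum.swap)
      finally show ?thesis by (simp add: sum_distrib_left mult_ac)
    qed
    have W: "(\<Sum>j\<in>UNIV. \<Sum>k\<in>UNIV. H $ j $ k * (\<Sum>p\<in>UNIV. om_dot j $ i $ p * om i $ p $ k))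
       = (\<Sum>j\<in>UNIV. \<Sum>k\<in>UNIV. \<Sum>p\<in>UNIV. om_dot j $ i $ k * om i $ k $ p * H $ j $ p)" for i
      by (rule sum.cong[OF refl], simp add: sum_distrib_left, subst sum.swap) (simp add: mult_ac)
    have X: "(\<Sum>i\<in>UNIV. \<Sum>j\<in>UNIV. \<Sum>k\<in>UNIV. H $ j $ k * (\<Sum>p\<in>UNIV. om j $ i $ p * om_dot i $ p $ k))
       = (\<Sum>i\<in>UNIV. \<Sum>j\<in>UNIV. \<Sum>k\<in>UNIV. \<Sum>p\<in>UNIV. om_dot j $ i $ k * om i $ j $ p * H $ p $ k)"
    proof -
      have "(\<Sum>i\<in>UNIV. \<Sum>j\<in>UNIV. \<Sum>k\<in>UNIV. \<Sum>p\<in>UNIV. om_dot j $ i $ k * om i $ j $ p * H $ p $ k)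
         = (\<Sum>j\<in>UNIV. \<Sum>i\<in>UNIV. \<Sum>k\<in>UNIV. \<Sum>p\<in>UNIV. om_dot j $ i $ k * om i $ j $ p * H $ p $ k)"
        by (rule sum.swap)
      also have "\<dots> = (\<Sum>j\<in>UNIV. \<Sum>k\<in>UNIV. \<Sum>i\<in>UNIV. \<Sum>p\<in>UNIV. om_dot j $ i $ k * om i $ j $ p * H $ p $ k)"
        by (rule sum.cong[OF refl], rule sum.swap)
      also have "\<dots> = (\<Sum>j\<in>UNIV. \<Sum>k\<in>UNIV. \<Sum>p\<in>UNIV. \<Sum>i\<in>UNIV. om_dot j $ i $ k * om i $ j $ p * H $ p $ k)"
        by (rule sum.cong[OF refl], rule sum.cong[OF refl], rule sum.swap)
      also have "\<dots> = (\<Sum>j\<in>UNIV. \<Sum>p\<in>UNIV. \<Sum>k\<in>UNIV. \<Sum>i\<in>UNIV. om_dot j $ i $ k * om i $ j $ p * H $ p $ k)"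
        by (rule sum.cong[OF refl], rule sum.swap)
      finally show ?thesis
        by (simp add: sum_distrib_left mult_ac om_swap[of _ _ k for k])
    qed
    have "(\<Sum>j\<in>UNIV. \<Sum>k\<in>UNIV. H $ j $ k * (\<Sum>i\<in>UNIV. U j i k))
        = (\<Sum>j\<in>UNIV. \<Sum>i\<in>UNIV. \<Sum>k\<in>UNIV. H $ j $ k * U j i k)"
      by (rule sum.cong[OF refl], simp add: sum_distrib_left, rule sum.swap)
    also have "\<dots> = (\<Sum>i\<in>UNIV. \<Sum>j\<in>UNIV. \<Sum>k\<in>UNIV. H $ j $ k * U j i k)"
      by (rule sum.swap)
    also have "\<dots> = 0"
      unfolding U_def
      by (simp only: distrib_left right_diff_distrib sum.distrib sum_subtractf V0 W X D0'
          sum.neutral_const) simp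
    finally show ?thesis .
  qed
  show ?thesis
    unfolding Tr by (simp add: distrib_left sum.distrib HU)
qed

text \<open>
  \<open>\<partial>\<^sub>tR = \<Delta>R + 2 |Rc|\<^sup>2\<close>; the second summand comes from \<open>\<partial>\<^sub>tH = 2 H Rc H\<close>.
\<close>

theorem T_scal:
  "T scal = 2 *\<^sub>R (\<Sum>j\<in>UNIV. \<Sum>k\<in>UNIV. (H ** ric ** H) $ j $ k * ric $ j $ k)
     + (\<Sum>j\<in>UNIV. \<Sum>k\<in>UNIV. H $ j $ k * (D j (D k scal) - (\<Sum>p\<in>UNIV. om j $ p $ k * D p scal)))"
proof -
  let ?T = "entrywise T"
  have "?T H ** G + H ** ?T G = 0"
    using arg_cong[OF HG, of ?T] by (simp add: entrywise_rules[OF T])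
  then have "?T H ** G = 2 *\<^sub>R (H ** ric)"
    by (simp add: T_metric matrix_mul_algebra matrix_mul_scaleR)
  then have "(?T H ** G) ** H = (2 *\<^sub>R (H ** ric)) ** H" by simp
  then have TH: "?T H = 2 *\<^sub>R (H ** ric ** H)"
    by (simp add: matrix_mul_algebra GH matrix_mul_scaleR)
  have "T scal = (\<Sum>j\<in>UNIV. \<Sum>k\<in>UNIV. ?T H $ j $ k * ric $ j $ k)
      + (\<Sum>j\<in>UNIV. \<Sum>k\<in>UNIV. H $ j $ k * T (ric $ j $ k))"
    by (simp add: scal_def derivation_rules[OF T] sum.distrib)
  then show ?thesis
    unfolding TH H_T_ric by (simp add: scaleR_sum_right)
qed

end

section \<open>Uniqueness, naturality and existence of the Levi-Civita connection\<close>

text \<open>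
  The difference of two such connections, with its upper index lowered, is symmetric in one pair of
  indices and antisymmetric in an overlapping pair, and hence zero.
\<close>

lemma levi_civita_unique:
  assumes "levi_civita D G H om" "levi_civita D G H om'"
  shows "om = om'"
proof -
  interpret a: levi_civita D G H om by fact
  interpret b: levi_civita D G H om' by fact
  define S where "S k = om k - om' k" for k
  define s where "s k i j = (G ** S k) $ i $ j" for k i j
  have S_swap: "S k $ l $ j = S j $ l $ k" for k l j
    by (simp add: S_def a.om_swap[of k] b.om_swap[of k])
  have sym: "s k i j = s j i k" for k i j
    by (simp add: s_def matrix_matrix_mult_def S_swap[of k])
  have anti: "s k i j = - s k j i" for k i j
  proof -
    have "transpose (S k) ** G + G ** S k = 0"
      using a.D_metric[of k] b.D_metric[of k]
      by (simp add: S_def transpose_algebra matrix_mul_algebra algebra_simps)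
    from arg_cong[OF this, of "\<lambda>M. M $ i $ j"]
    have "(\<Sum>l\<in>UNIV. S k $ l $ i * G $ l $ j) + s k i j = 0"
      by (simp add: s_def matrix_matrix_mult_def transpose_def)
    moreover have "(\<Sum>l\<in>UNIV. S k $ l $ i * G $ l $ j) = s k j i"
      by (simp add: s_def matrix_matrix_mult_def a.G_swap[of _ j] mult.commute)
    ultimately show ?thesis by (simp add: eq_neg_iff_add_eq_0 add.commute)
  qed
  have "s k i j = 0" for k i j
  proof -
    have "s k i j = - s k i j"
      by (metis sym anti minus_minus)
    then have "s k i j + s k i j = 0" by (simp add: eq_neg_iff_add_eq_0)
    then have "2 *\<^sub>R s k i j = 0" by (simp only: scaleR_2)
    then show ?thesis by simp
  qed
  then have "G ** S k = 0" for k by (simp add: vec_eq_iff s_def)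
  then have "H ** (G ** S k) = 0" for k by simp
  then have "S k = 0" for k by (simp add: matrix_mul_assoc a.HG)
  then show ?thesis by (simp add: S_def fun_eq_iff)
qed

text \<open>
  \<open>P\<close> is composition with a local diffeomorphism, \<open>J\<close> its Jacobian matrix and \<open>K\<close> the inverse of
  \<open>J\<close>. The last two assumptions are the symmetry of its second derivatives and the chain rule.
\<close>

locale levi_civita_pullback = levi_civita D G H om
  for D :: "'n::finite \<Rightarrow> 'r::{comm_ring_1,real_algebra_1} \<Rightarrow> 'r" and G H :: "'r ^ 'n ^ 'n" and om +
  fixes P :: "'r \<Rightarrow> 's::{comm_ring_1,real_algebra_1}"
    and D' :: "'n \<Rightarrow> 's \<Rightarrow> 's" and J K :: "'s ^ 'n ^ 'n"
  assumes P_add: "\<And>x y. P (x + y) = P x + P y"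
    and P_mult: "\<And>x y. P (x * y) = P x * P y"
    and P_one: "P 1 = 1"
    and D': "\<And>i. derivation (D' i)"
    and D'_commute: "\<And>i j x. D' i (D' j x) = D' j (D' i x)"
    and KJ: "K ** J = mat 1" and JK: "J ** K = mat 1"
    and D'_J: "\<And>i j a. D' i (J $ a $ j) = D' j (J $ a $ i)"
    and chain: "\<And>i x. D' i (P x) = (\<Sum>a\<in>UNIV. J $ a $ i * P (D a x))"
begin

lemma P_zero: "P 0 = 0"
  using P_add[of 0 0] by simp

lemma P_minus: "P (- x) = - P x"
  using P_add[of x "- x"] P_zero by (simp add: eq_neg_iff_add_eq_0 add.commute)

lemma P_diff: "P (x - y) = P x - P y"
  using P_add[of x "- y"] by (simp add: P_minus)

lemma P_sum: "P (sum f A) = (\<Sum>a\<in>A. P (f a))"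
  by (induction A rule: infinite_finite_induct) (auto simp: P_add P_zero)

lemmas P_rules = P_zero P_add P_mult P_minus P_diff P_sum P_one

abbreviation PM :: "'r ^ 'n ^ 'n \<Rightarrow> 's ^ 'n ^ 'n" where
  "PM \<equiv> entrywise P"

lemma PM_mult: "PM (M ** N) = PM M ** PM N"
  by (simp add: vec_eq_iff matrix_matrix_mult_def P_rules)

lemma PM_one: "PM (mat 1) = mat 1"
  by (simp add: vec_eq_iff mat_def P_rules)

definition smat :: "'s \<Rightarrow> 's ^ 'n ^ 'n \<Rightarrow> 's ^ 'n ^ 'n" where
  "smat c M = (\<chi> i j. c * M $ i $ j)"

lemma smat_nth [simp]: "smat c M $ i $ j = c * M $ i $ j"
  by (simp add: smat_def)

lemma smat_mult: "smat c M ** N = smat c (M ** N)" "M ** smat c N = smat c (M ** N)"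
  by (simp_all add: vec_eq_iff matrix_matrix_mult_def sum_distrib_left mult_ac)

lemma smat_smat: "smat a (smat b M) = smat (a * b) M"
  by (simp add: vec_eq_iff mult_ac)

lemma sum_mult_matrix: "(\<Sum>a\<in>A. f a) ** N = (\<Sum>a\<in>A. f a ** N)" "N ** (\<Sum>a\<in>A. f a) = (\<Sum>a\<in>A. N ** f a)"
  for f :: "'i \<Rightarrow> 's ^ 'n ^ 'n"
  by (induction A rule: infinite_finite_induct) (auto simp: matrix_mul_algebra)

text \<open>
  The connection form pulled back as a matrix of one-forms, before the frame is changed by \<open>J\<close>.
\<close>

definition \<theta> :: "'n \<Rightarrow> 's ^ 'n ^ 'n" where
  "\<theta> i = (\<Sum>a\<in>UNIV. smat (J $ a $ i) (PM (om a)))"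

lemma D'_PM: "entrywise (D' i) (PM M) = (\<Sum>a\<in>UNIV. smat (J $ a $ i) (PM (entrywise (D a) M)))"
  by (simp add: vec_eq_iff chain)

lemma D'_\<theta>: "entrywise (D' i) (\<theta> j) = (\<Sum>a\<in>UNIV. smat (D' i (J $ a $ j)) (PM (om a)))
    + (\<Sum>a\<in>UNIV. \<Sum>b\<in>UNIV. smat (J $ a $ j * J $ b $ i) (PM (entrywise (D b) (om a))))"
  by (simp add: vec_eq_iff \<theta>_def derivation_rules[OF D'] chain sum.distrib sum_distrib_left mult_ac)

lemma \<theta>_\<theta>: "\<theta> i ** \<theta> j = (\<Sum>a\<in>UNIV. \<Sum>b\<in>UNIV. smat (J $ a $ i * J $ b $ j) (PM (om a ** om b)))"
  unfolding \<theta>_def sum_mult_matrix(1)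
  unfolding sum_mult_matrix(2) by (simp add: smat_mult smat_smat PM_mult mult.commute)

lemma curv_\<theta>:
  "entrywise (D' i) (\<theta> j) - entrywise (D' j) (\<theta> i) + \<theta> i ** \<theta> j - \<theta> j ** \<theta> i
    = (\<Sum>a\<in>UNIV. \<Sum>b\<in>UNIV. smat (J $ a $ i * J $ b $ j) (PM (curv a b)))"
proof -
  have 1: "(\<Sum>a\<in>UNIV. \<Sum>b\<in>UNIV. smat (J $ a $ j * J $ b $ i) (PM (entrywise (D b) (om a))))
     = (\<Sum>a\<in>UNIV. \<Sum>b\<in>UNIV. smat (J $ a $ i * J $ b $ j) (PM (entrywise (D a) (om b))))"
    by (subst sum.swap) (simp add: mult.commute)
  have 2: "(\<Sum>a\<in>UNIV. \<Sum>b\<in>UNIV. smat (J $ a $ j * J $ b $ i) (PM (om a ** om b)))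
     = (\<Sum>a\<in>UNIV. \<Sum>b\<in>UNIV. smat (J $ a $ i * J $ b $ j) (PM (om b ** om a)))"
    by (subst sum.swap) (simp add: mult.commute)
  have 3: "smat c (PM (curv a b)) = smat c (PM (entrywise (D a) (om b))) - smat c (PM (entrywise (D b) (om a)))
      + smat c (PM (om a ** om b)) - smat c (PM (om b ** om a))" for c a b
    by (simp add: vec_eq_iff curv_def P_rules algebra_simps)
  have 4: "(\<Sum>a\<in>UNIV. smat (D' j (J $ a $ i)) (PM (om a))) = (\<Sum>a\<in>UNIV. smat (D' i (J $ a $ j)) (PM (om a)))"
    by (rule sum.cong[OF refl]) (simp only: D'_J[of j])
  show ?thesis
    unfolding D'_\<theta>[of i j] D'_\<theta>[of j i] \<theta>_\<theta>[of i j] \<theta>_\<theta>[of j i] 1 2 3 4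
    by (simp add: sum.distrib sum_subtractf)
qed

text \<open>
  The transformation law of the Christoffel symbols.
\<close>

definition om' :: "'n \<Rightarrow> 's ^ 'n ^ 'n" where
  "om' i = K ** (\<theta> i ** J + entrywise (D' i) J)"

definition "G' = transpose J ** PM G ** J"

definition "H' = K ** PM H ** transpose K"

lemma om'_swap: "om' k $ l $ j = om' j $ l $ k"
proof -
  have "(\<theta> k ** J) $ c $ j = (\<theta> j ** J) $ c $ k" for c
  proof -
    have "(\<theta> k ** J) $ c $ j = (\<Sum>b\<in>UNIV. \<Sum>a\<in>UNIV. J $ a $ k * P (om a $ c $ b) * J $ b $ j)" for k j
      by (simp add: \<theta>_def matrix_matrix_mult_def sum_distrib_right)
    note * = this
    have "P (om a $ c $ b) = P (om b $ c $ a)" for a b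
      by (simp only: om_swap[of a])
    then show ?thesis
      unfolding *[of k] *[of j] by (subst sum.swap) (simp only: mult_ac)
  qed
  then show ?thesis
    by (simp add: om'_def matrix_matrix_mult_def[of K] D'_J[of k _ j])
qed

lemma D'_K: "entrywise (D' i) K = - (K ** entrywise (D' i) J ** K)"
proof -
  have "entrywise (D' i) K ** J + K ** entrywise (D' i) J = 0"
    using arg_cong[OF KJ, of "entrywise (D' i)"] by (simp add: entrywise_rules[OF D'])
  then have "entrywise (D' i) K ** J = - (K ** entrywise (D' i) J)"
    by (simp add: eq_neg_iff_add_eq_0)
  then have "(entrywise (D' i) K ** J) ** K = - (K ** entrywise (D' i) J) ** K" by simp
  then show ?thesis
    by (simp add: matrix_mul_algebra JK)
qed

lemma JK_cancel: "J ** (K ** M) = M" and KJ_cancel: "K ** (J ** M) = M"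
  by (simp_all add: matrix_mul_assoc JK KJ)

lemma transpose_KJ: "transpose K ** (transpose J ** M) = M" "transpose J ** (transpose K ** M) = M"
  by (simp_all add: matrix_mul_assoc JK KJ flip: matrix_transpose_mul)

sublocale target: levi_civita D' G' H' om'
proof
  have PGH: "PM H ** (PM G ** M) = M" "PM G ** (PM H ** M) = M" for M
    by (simp_all add: matrix_mul_assoc HG GH PM_one flip: PM_mult)
  have PG: "transpose (PM G) = PM G"
    by (simp add: G_sym flip: entrywise_transpose)
  show "derivation (D' i)" for i by (rule D')
  show "D' i (D' j x) = D' j (D' i x)" for i j x by (rule D'_commute)
  show "transpose G' = G'"
    by (simp add: G'_def matrix_transpose_mul PG matrix_mul_algebra)
  show "H' ** G' = mat 1"
    by (simp add: H'_def G'_def matrix_mul_algebra transpose_KJ PGH KJ)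
  show "G' ** H' = mat 1"
    by (simp add: H'_def G'_def matrix_mul_algebra JK_cancel PGH flip: matrix_transpose_mul)
      (simp add: KJ)
  show "om' k $ l $ j = om' j $ l $ k" for k l j by (rule om'_swap)
  show "entrywise (D' k) G' = transpose (om' k) ** G' + G' ** om' k" for k
  proof -
    have "entrywise (D' k) (PM G) = transpose (\<theta> k) ** PM G + PM G ** \<theta> k"
    proof -
      have "transpose (\<theta> k) = (\<Sum>a\<in>UNIV. smat (J $ a $ k) (transpose (PM (om a))))"
        by (simp add: vec_eq_iff \<theta>_def transpose_def)
      moreover have "smat c (PM (transpose (om a) ** G + G ** om a))
          = smat c (transpose (PM (om a)) ** PM G) + smat c (PM G ** PM (om a))" for c a
        by (simp add: vec_eq_iff P_add distrib_left flip: PM_mult entrywise_transpose)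
      ultimately show ?thesis
        by (simp add: D'_PM D_metric \<theta>_def sum_mult_matrix smat_mult sum.distrib)
    qed
    then show ?thesis
      by (simp add: G'_def om'_def entrywise_rules[OF D'] entrywise_transpose transpose_algebra
          matrix_mul_algebra matrix_transpose_mul transpose_KJ JK_cancel algebra_simps)
  qed
qed

text \<open>
  A change of frame conjugates the curvature form.
\<close>

lemma curv_target: "target.curv i j = K ** (\<Sum>a\<in>UNIV. \<Sum>b\<in>UNIV. smat (J $ a $ i * J $ b $ j) (PM (curv a b))) ** J"
  unfolding curv_\<theta>[symmetric] target.curv_def om'_def
  by (simp add: entrywise_rules[OF D'] D'_K matrix_mul_algebra JK_cancel algebra_simps
      target.entrywise_D_commute[of i j])

lemma ric_target: "target.ric = transpose J ** PM ric ** J"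
proof -
  have 1: "(\<Sum>i\<in>UNIV. target.curv i j $ i $ k)
     = (\<Sum>b\<in>UNIV. \<Sum>e\<in>UNIV. J $ b $ j * P (ric $ b $ e) * J $ e $ k)" for j k
  proof -
    have "(\<Sum>i\<in>UNIV. target.curv i j $ i $ k)
      = (\<Sum>i\<in>UNIV. \<Sum>a\<in>UNIV. \<Sum>b\<in>UNIV. (K ** smat (J $ a $ i * J $ b $ j) (PM (curv a b)) ** J) $ i $ k)"
      by (simp add: curv_target sum_mult_matrix)
    also have "\<dots> = (\<Sum>a\<in>UNIV. \<Sum>i\<in>UNIV. \<Sum>b\<in>UNIV. J $ a $ i * J $ b $ j * (K ** PM (curv a b) ** J) $ i $ k)"
      by (subst sum.swap) (simp add: smat_mult)
    also have "\<dots> = (\<Sum>a\<in>UNIV. \<Sum>b\<in>UNIV. \<Sum>i\<in>UNIV. J $ a $ i * J $ b $ j * (K ** PM (curv a b) ** J) $ i $ k)"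
      by (rule sum.cong[OF refl], rule sum.swap)
    also have "\<dots> = (\<Sum>a\<in>UNIV. \<Sum>b\<in>UNIV. J $ b $ j * (J ** (K ** (PM (curv a b) ** J))) $ a $ k)"
      unfolding matrix_matrix_mult_def[of J "K ** _"]
      by (simp add: sum_distrib_left mult_ac matrix_mul_algebra)
    also have "\<dots> = (\<Sum>b\<in>UNIV. \<Sum>a\<in>UNIV. J $ b $ j * (PM (curv a b) ** J) $ a $ k)"
      by (subst sum.swap) (simp add: JK_cancel)
    also have "\<dots> = (\<Sum>b\<in>UNIV. J $ b $ j * (\<Sum>a\<in>UNIV. \<Sum>e\<in>UNIV. P (curv a b $ a $ e) * J $ e $ k))"
      by (simp add: matrix_matrix_mult_def sum_distrib_left)
    also have "\<dots> = (\<Sum>b\<in>UNIV. J $ b $ j * (\<Sum>e\<in>UNIV. \<Sum>a\<in>UNIV. P (curv a b $ a $ e) * J $ e $ k))"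
      by (rule sum.cong[OF refl], rule arg_cong[where f = "\<lambda>x. _ * x"], rule sum.swap)
    finally show ?thesis
      by (simp add: ric_def P_sum sum_distrib_left sum_distrib_right mult_ac)
  qed
  show ?thesis
    unfolding target.ric_def 1 vec_eq_iff
    by (simp add: matrix_matrix_mult_def transpose_def sum_distrib_right, subst sum.swap) simp
qed

theorem scal_target: "target.scal = P scal"
proof -
  have "trace (H' ** target.ric) = trace (K ** (PM H ** (PM ric ** J)))"
    unfolding H'_def ric_target by (simp only: matrix_mul_algebra transpose_KJ)
  also have "\<dots> = trace ((PM H ** (PM ric ** J)) ** K)"
    by (rule trace_mul_sym)
  also have "\<dots> = trace (PM (H ** ric))"
    by (simp only: matrix_mul_algebra JK PM_mult matrix_mul_rid)
  also have "\<dots> = P (trace (H ** ric))"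
    by (simp add: trace_def P_sum)
  finally show ?thesis by (simp add: scal_trace target.scal_trace)
qed

end

text \<open>
  The classical Christoffel symbols do form a torsion-free metric connection.
\<close>

lemma (in metric_algebra) levi_civita_christoffel:
  assumes om: "\<And>k l j. om k $ l $ j = (1 / 2) *\<^sub>R
     (\<Sum>m\<in>UNIV. H $ l $ m * (D k (G $ j $ m) + D j (G $ k $ m) - D m (G $ k $ j)))"
  shows "levi_civita D G H om"
proof
  show "om k $ l $ j = om j $ l $ k" for k l j
    by (simp add: om G_swap[of k j] add.commute)
  have om_dot_low: "(G ** om k) $ i $ j = (1 / 2) *\<^sub>R (D k (G $ j $ i) + D j (G $ k $ i) - D i (G $ k $ j))" for k i j
  proof -
    let ?u = "\<chi> m. D k (G $ j $ m) + D j (G $ k $ m) - D m (G $ k $ j)"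
    have "om k $ l $ j = (1 / 2) *\<^sub>R (H *v ?u) $ l" for l
      by (simp add: om matrix_vector_mult_def)
    then have "(G ** om k) $ i $ j = (1 / 2) *\<^sub>R (G *v (H *v ?u)) $ i"
      by (simp add: matrix_matrix_mult_def matrix_vector_mult_def[of G] scaleR_sum_right)
    then show ?thesis
      by (simp add: matrix_vector_mul_assoc GH)
  qed
  have up: "(transpose (om k) ** G) $ i $ j = (G ** om k) $ j $ i" for k i j
    by (simp add: matrix_matrix_mult_def transpose_def G_swap[of j] mult.commute)
  show "entrywise (D k) G = transpose (om k) ** G + G ** om k" for k
  proof -
    have "D k (G $ i $ j) = (transpose (om k) ** G) $ i $ j + (G ** om k) $ i $ j" for i j
    proof -
      have "(transpose (om k) ** G) $ i $ j + (G ** om k) $ i $ j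
          = (1 / 2) *\<^sub>R (D k (G $ i $ j) + D k (G $ j $ i))"
        unfolding up om_dot_low by (simp flip: scaleR_add_right)
      also have "\<dots> = D k (G $ i $ j)"
        unfolding G_swap[of j i] by (rule scaleR_half_double)
      finally show ?thesis by (rule sym)
    qed
    then show ?thesis by (simp add: vec_eq_iff)
  qed
qed

lemma (in levi_civita) levi_civita_scale:
  assumes "c \<noteq> 0"
  shows "levi_civita D (c *\<^sub>R G) ((1 / c) *\<^sub>R H) om"
proof
  show "transpose (c *\<^sub>R G) = c *\<^sub>R G" by (simp add: transpose_scalar G_sym)
  show "((1 / c) *\<^sub>R H) ** (c *\<^sub>R G) = mat 1" "(c *\<^sub>R G) ** ((1 / c) *\<^sub>R H) = mat 1"
    using assms by (simp_all add: matrix_mul_scaleR HG GH)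
  show "entrywise (D k) (c *\<^sub>R G) = transpose (om k) ** (c *\<^sub>R G) + (c *\<^sub>R G) ** om k" for k
    by (simp add: entrywise_rules[OF D] D_metric matrix_mul_scaleR scaleR_add_right)
qed (rule D D_commute om_swap)+

lemma (in levi_civita) scal_scale:
  assumes "c \<noteq> 0"
  shows "levi_civita.scal D ((1 / c) *\<^sub>R H) om = (1 / c) *\<^sub>R scal"
proof -
  interpret c: levi_civita D "c *\<^sub>R G" "(1 / c) *\<^sub>R H" om
    by (rule levi_civita_scale) fact
  show ?thesis
    by (simp add: scal_def c.scal_def scaleR_sum_right)
qed

section \<open>Calculus of smooth functions\<close>

lemma C_k_on_cong:
  assumes "\<And>x. x \<in> S \<Longrightarrow> f x = g x"
  shows "C_k_on k S f \<longleftrightarrow> C_k_on k S g"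
proof (cases k)
  case 0
  then show ?thesis using assms by (simp cong: continuous_on_cong)
next
  case (Suc k)
  have "(f has_derivative h) (at x within S) \<longleftrightarrow> (g has_derivative h) (at x within S)" if "x \<in> S" for x h
    using that assms has_derivative_transform[of x S f g] has_derivative_transform[of x S g f] by auto
  then have "(\<forall>x\<in>S. (f has_derivative f' x) (at x within S)) \<longleftrightarrow> (\<forall>x\<in>S. (g has_derivative f' x) (at x within S))"
    for f' by blast
  then show ?thesis unfolding Suc C_k_on.simps by (simp only:)
qed

lemma C_k_on_subset: "C_k_on k S f \<Longrightarrow> T \<subseteq> S \<Longrightarrow> C_k_on k T f"
proof (induction k arbitrary: f)
  case 0
  then show ?case by (auto intro: continuous_on_subset)
next
  case (Suc k)
  then show ?case unfolding C_k_on.simps by (meson has_derivative_subset subsetD)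
qed

lemma C_k_on_Suc: "C_k_on (Suc k) S f \<Longrightarrow> C_k_on k S f"
proof (induction k arbitrary: f)
  case 0
  then show ?case
    by (auto simp: continuous_on_eq_continuous_within intro: has_derivative_continuous)
next
  case (Suc k)
  then show ?case by (metis C_k_on.simps(2))
qed

lemma C_k_on_SucE:
  assumes "C_k_on (Suc k) S f"
  obtains f' where "\<And>x. x \<in> S \<Longrightarrow> (f has_derivative f' x) (at x within S)"
    and "\<And>v. C_k_on k S (\<lambda>x. f' x v)" and "C_k_on k S f"
  using C_k_on_Suc[OF assms] assms unfolding C_k_on.simps by blast

lemma C_k_on_const: "C_k_on k S (\<lambda>x. c)"
proof (induction k arbitrary: c)
  case 0
  then show ?case by simp
next
  case (Suc k)
  then show ?case unfolding C_k_on.simps by (intro exI[of _ "\<lambda>_ _. 0"]) auto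
qed

lemma C_k_on_bounded_linear:
  assumes "bounded_linear h" "C_k_on k S f"
  shows "C_k_on k S (\<lambda>x. h (f x))"
  using assms(2)
proof (induction k arbitrary: f)
  case 0
  then show ?case using assms(1)
    by (auto intro: bounded_linear.continuous_on)
next
  case (Suc k)
  then obtain f' where f': "\<And>x. x \<in> S \<Longrightarrow> (f has_derivative f' x) (at x within S)"
      "\<And>v. C_k_on k S (\<lambda>x. f' x v)" by auto
  then show ?case
    unfolding C_k_on.simps
    by (intro exI[of _ "\<lambda>x v. h (f' x v)"])
       (auto intro: Suc.IH bounded_linear.has_derivative[OF assms(1)])
qed

lemma C_k_on_id: "C_k_on k S (\<lambda>x. x)"
proof (cases k)
  case (Suc k)
  then show ?thesis
    unfolding Suc C_k_on.simps by (intro exI[of _ "\<lambda>_ v. v"]) (auto intro: C_k_on_const)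
qed simp

lemma C_k_on_add:
  assumes "C_k_on k S f" "C_k_on k S g"
  shows "C_k_on k S (\<lambda>x. f x + g x)"
  using assms
proof (induction k arbitrary: f g)
  case 0
  then show ?case by (auto intro: continuous_on_add)
next
  case (Suc k)
  obtain f' where f': "\<And>x. x \<in> S \<Longrightarrow> (f has_derivative f' x) (at x within S)"
      "\<And>v. C_k_on k S (\<lambda>x. f' x v)" and f: "C_k_on k S f"
    using Suc.prems(1) by (rule C_k_on_SucE) blast
  obtain g' where g': "\<And>x. x \<in> S \<Longrightarrow> (g has_derivative g' x) (at x within S)"
      "\<And>v. C_k_on k S (\<lambda>x. g' x v)" and g: "C_k_on k S g"
    using Suc.prems(2) by (rule C_k_on_SucE) blast
  show ?case
    unfolding C_k_on.simps
    by (intro exI[of _ "\<lambda>x v. f' x v + g' x v"] conjI ballI allI Suc.IH has_derivative_add f' g')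
qed

lemma C_k_on_bilinear:
  assumes "bounded_bilinear pr" "C_k_on k S f" "C_k_on k S g"
  shows "C_k_on k S (\<lambda>x. pr (f x) (g x))"
  using assms(2,3)
proof (induction k arbitrary: f g)
  case 0
  then show ?case using assms(1) by (auto intro: bounded_bilinear.continuous_on)
next
  case (Suc k)
  obtain f' where f': "\<And>x. x \<in> S \<Longrightarrow> (f has_derivative f' x) (at x within S)"
      "\<And>v. C_k_on k S (\<lambda>x. f' x v)" and f: "C_k_on k S f"
    using Suc.prems(1) by (rule C_k_on_SucE) blast
  obtain g' where g': "\<And>x. x \<in> S \<Longrightarrow> (g has_derivative g' x) (at x within S)"
      "\<And>v. C_k_on k S (\<lambda>x. g' x v)" and g: "C_k_on k S g"
    using Suc.prems(2) by (rule C_k_on_SucE) blast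
  show ?case
    unfolding C_k_on.simps
    by (intro exI[of _ "\<lambda>x v. pr (f x) (g' x v) + pr (f' x v) (g x)"] conjI ballI allI
        C_k_on_add Suc.IH f g f' g' bounded_bilinear.FDERIV[OF assms(1)])
qed

lemmas C_k_on_mult = C_k_on_bilinear[OF bounded_bilinear_mult]
lemmas C_k_on_scaleR = C_k_on_bilinear[OF bounded_bilinear_scaleR]

lemma C_k_on_uminus: "C_k_on k S f \<Longrightarrow> C_k_on k S (\<lambda>x. - f x)"
  by (rule C_k_on_bounded_linear[OF bounded_linear_minus[OF bounded_linear_ident]])

lemma C_k_on_diff: "C_k_on k S f \<Longrightarrow> C_k_on k S g \<Longrightarrow> C_k_on k S (\<lambda>x. f x - g x)"
  using C_k_on_add[of k S f "\<lambda>x. - g x"] by (simp add: C_k_on_uminus)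

lemma C_k_on_sum: "(\<And>a. a \<in> A \<Longrightarrow> C_k_on k S (f a)) \<Longrightarrow> C_k_on k S (\<lambda>x. \<Sum>a\<in>A. f a x)"
  by (induction A rule: infinite_finite_induct) (auto intro: C_k_on_add C_k_on_const)

lemma C_k_on_prod:
  fixes f :: "'i \<Rightarrow> 'a::euclidean_space \<Rightarrow> real"
  shows "(\<And>a. a \<in> A \<Longrightarrow> C_k_on k S (f a)) \<Longrightarrow> C_k_on k S (\<lambda>x. \<Prod>a\<in>A. f a x)"
  by (induction A rule: infinite_finite_induct) (auto intro: C_k_on_mult C_k_on_const)

lemma C_k_on_inverse:
  fixes f :: "'a::euclidean_space \<Rightarrow> real"
  assumes "C_k_on k S f" "\<And>x. x \<in> S \<Longrightarrow> f x \<noteq> 0"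
  shows "C_k_on k S (\<lambda>x. inverse (f x))"
  using assms
proof (induction k)
  case 0
  then show ?case by (auto intro: continuous_on_inverse)
next
  case (Suc k)
  then obtain f' where f': "\<And>x. x \<in> S \<Longrightarrow> (f has_derivative f' x) (at x within S)"
      "\<And>v. C_k_on k S (\<lambda>x. f' x v)" by auto
  have inv: "C_k_on k S (\<lambda>x. inverse (f x))"
    using Suc.IH[OF C_k_on_Suc[OF Suc.prems(1)]] Suc.prems(2) by blast
  show ?case
    unfolding C_k_on.simps
  proof (intro exI[of _ "\<lambda>x v. - (inverse (f x) * f' x v * inverse (f x))"] conjI ballI allI)
    show "C_k_on k S (\<lambda>x. - (inverse (f x) * f' x v * inverse (f x)))" for v
      by (intro C_k_on_uminus C_k_on_mult inv f')
    show "((\<lambda>x. inverse (f x)) has_derivative (\<lambda>v. - (inverse (f x) * f' x v * inverse (f x)))) (at x within S)"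
      if "x \<in> S" for x
      by (rule Deriv.has_derivative_inverse) (use that Suc.prems f' in auto)
  qed
qed

text \<open>
  In coordinates \<open>f'(\<phi> x)(\<phi>'(x) v)\<close> is a sum of products of partial derivatives, to which the
  induction hypothesis applies.
\<close>

lemma C_k_on_compose:
  fixes f :: "'b::euclidean_space \<Rightarrow> 'c::real_normed_vector"
  assumes "C_k_on k T f" "C_k_on k S \<phi>" "\<phi> ` S \<subseteq> T"
  shows "C_k_on k S (\<lambda>x. f (\<phi> x))"
  using assms
proof (induction k arbitrary: f)
  case 0
  then show ?case by (auto intro: continuous_on_compose2)
next
  case (Suc k)
  obtain f' where f': "\<And>x. x \<in> T \<Longrightarrow> (f has_derivative f' x) (at x within T)"
      "\<And>v. C_k_on k T (\<lambda>x. f' x v)"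
    using Suc.prems(1) by (rule C_k_on_SucE) blast
  obtain \<phi>' where \<phi>': "\<And>x. x \<in> S \<Longrightarrow> (\<phi> has_derivative \<phi>' x) (at x within S)"
      "\<And>v. C_k_on k S (\<lambda>x. \<phi>' x v)" and \<phi>: "C_k_on k S \<phi>"
    using Suc.prems(2) by (rule C_k_on_SucE) blast
  have eq: "f' (\<phi> x) (\<phi>' x v) = (\<Sum>b\<in>Basis. (\<phi>' x v \<bullet> b) *\<^sub>R f' (\<phi> x) b)" if "x \<in> S" for x v
  proof -
    have "linear (f' (\<phi> x))" using f'(1) that Suc.prems(3) by (auto intro: has_derivative_linear)
    then have "f' (\<phi> x) (\<Sum>b\<in>Basis. (\<phi>' x v \<bullet> b) *\<^sub>R b) = (\<Sum>b\<in>Basis. (\<phi>' x v \<bullet> b) *\<^sub>R f' (\<phi> x) b)"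
      by (simp add: linear_sum linear_scale)
    then show ?thesis by (simp only: euclidean_representation)
  qed
  show ?case
    unfolding C_k_on.simps
  proof (intro exI[of _ "\<lambda>x v. f' (\<phi> x) (\<phi>' x v)"] conjI ballI allI)
    show "((\<lambda>x. f (\<phi> x)) has_derivative (\<lambda>v. f' (\<phi> x) (\<phi>' x v))) (at x within S)" if "x \<in> S" for x
      by (rule has_derivative_in_compose[OF \<phi>'(1)[OF that]])
         (use that Suc.prems(3) f'(1) has_derivative_subset in blast)
    have "C_k_on k S (\<lambda>x. \<Sum>b\<in>Basis. (\<phi>' x v \<bullet> b) *\<^sub>R f' (\<phi> x) b)" for v
      by (intro C_k_on_sum C_k_on_scaleR C_k_on_bounded_linear[OF bounded_linear_inner_left]
          \<phi>' Suc.IH f' \<phi> Suc.prems)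
    then show "C_k_on k S (\<lambda>x. f' (\<phi> x) (\<phi>' x v))" for v
      by (subst C_k_on_cong[OF eq])
  qed
qed

lemma smooth_on_cong: "(\<And>x. x \<in> S \<Longrightarrow> f x = g x) \<Longrightarrow> smooth_on S f \<longleftrightarrow> smooth_on S g"
  unfolding smooth_on_def using C_k_on_cong by blast

lemma smooth_on_subset: "smooth_on S f \<Longrightarrow> T \<subseteq> S \<Longrightarrow> smooth_on T f"
  unfolding smooth_on_def using C_k_on_subset by blast

lemma smooth_on_imp_continuous_on: "smooth_on S f \<Longrightarrow> continuous_on S f"
  unfolding smooth_on_def by (metis C_k_on.simps(1))

lemma smooth_on_const: "smooth_on S (\<lambda>x. c)"
  and smooth_on_id: "smooth_on S (\<lambda>x. x)"
  and smooth_on_add: "smooth_on S f \<Longrightarrow> smooth_on S g \<Longrightarrow> smooth_on S (\<lambda>x. f x + g x)"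
  and smooth_on_diff: "smooth_on S f \<Longrightarrow> smooth_on S g \<Longrightarrow> smooth_on S (\<lambda>x. f x - g x)"
  and smooth_on_uminus: "smooth_on S f \<Longrightarrow> smooth_on S (\<lambda>x. - f x)"
  and smooth_on_bounded_linear: "bounded_linear h \<Longrightarrow> smooth_on S f \<Longrightarrow> smooth_on S (\<lambda>x. h (f x))"
  for f g :: "'a::euclidean_space \<Rightarrow> 'b::real_normed_vector"
  by (auto simp: smooth_on_def intro: C_k_on_const C_k_on_id C_k_on_add C_k_on_diff C_k_on_uminus
      C_k_on_bounded_linear)

lemma smooth_on_mult: "smooth_on S f \<Longrightarrow> smooth_on S g \<Longrightarrow> smooth_on S (\<lambda>x. f x * g x)"
  and smooth_on_inverse: "smooth_on S f \<Longrightarrow> (\<And>x. x \<in> S \<Longrightarrow> f x \<noteq> 0) \<Longrightarrow> smooth_on S (\<lambda>x. inverse (f x))"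
  for f g :: "'a::euclidean_space \<Rightarrow> real"
  by (auto simp: smooth_on_def intro: C_k_on_mult C_k_on_inverse)

lemma smooth_on_sum: "(\<And>a. a \<in> A \<Longrightarrow> smooth_on S (f a)) \<Longrightarrow> smooth_on S (\<lambda>x. \<Sum>a\<in>A. f a x)"
  by (auto simp: smooth_on_def intro: C_k_on_sum)

lemma smooth_on_prod:
  fixes f :: "'i \<Rightarrow> 'a::euclidean_space \<Rightarrow> real"
  shows "(\<And>a. a \<in> A \<Longrightarrow> smooth_on S (f a)) \<Longrightarrow> smooth_on S (\<lambda>x. \<Prod>a\<in>A. f a x)"
  by (auto simp: smooth_on_def intro: C_k_on_prod)

lemma smooth_on_compose:
  fixes f :: "'b::euclidean_space \<Rightarrow> 'c::real_normed_vector"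
  shows "smooth_on T f \<Longrightarrow> smooth_on S \<phi> \<Longrightarrow> \<phi> ` S \<subseteq> T \<Longrightarrow> smooth_on S (\<lambda>x. f (\<phi> x))"
  by (auto simp: smooth_on_def intro: C_k_on_compose)

lemmas smooth_on_vec_nth = smooth_on_bounded_linear[OF bounded_linear_vec_nth]

lemma smooth_on_det:
  fixes M :: "'a::euclidean_space \<Rightarrow> real ^ 'n ^ 'n"
  assumes "\<And>i j. smooth_on S (\<lambda>x. M x $ i $ j)"
  shows "smooth_on S (\<lambda>x. det (M x))"
  unfolding det_def
  by (intro smooth_on_sum smooth_on_mult smooth_on_const smooth_on_prod assms)

lemma matrix_inv_mult:
  fixes M :: "'a::semiring_1 ^ 'n ^ 'n"
  assumes "invertible M"
  shows "M ** matrix_inv M = mat 1" "matrix_inv M ** M = mat 1"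
  using someI_ex[OF assms[unfolded invertible_def]] unfolding matrix_inv_def by auto

lemma matrix_inv_eqI:
  fixes M :: "'a::semiring_1 ^ 'n ^ 'n"
  assumes "M ** N = mat 1" "N ** M = mat 1"
  shows "matrix_inv M = N"
proof -
  have "invertible M" using assms unfolding invertible_def by blast
  then have "N ** (M ** matrix_inv M) = N" by (simp add: matrix_inv_mult)
  then show ?thesis by (simp add: matrix_mul_assoc assms)
qed

text \<open>
  Cramer's rule expresses the inverse matrix by polynomials and one division, which shows that it
  depends smoothly on the matrix.
\<close>

lemma matrix_inv_cramer:
  fixes M :: "real ^ 'n ^ 'n"
  assumes "det M \<noteq> 0"
  shows "matrix_inv M $ i $ j = det (\<chi> a b. if b = i then axis j 1 $ a else M $ a $ b) * inverse (det M)"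
proof -
  have "M ** matrix_inv M = mat 1"
    using assms matrix_inv_mult(1) invertible_det_nz by blast
  then have "M *v (matrix_inv M *v axis j 1) = axis j 1"
    by (simp add: matrix_vector_mul_assoc)
  then have "matrix_inv M *v axis j 1
      = (\<chi> k. det (\<chi> a b. if b = k then axis j 1 $ a else M $ a $ b) / det M)"
    using cramer[OF assms] by blast
  moreover have "(matrix_inv M *v axis j 1) $ i = matrix_inv M $ i $ j"
    by (simp add: matrix_vector_mul_component inner_axis)
  ultimately show ?thesis by (simp add: divide_inverse)
qed

lemma smooth_on_matrix_inv:
  fixes M :: "'a::euclidean_space \<Rightarrow> real ^ 'n ^ 'n"
  assumes M: "\<And>i j. smooth_on S (\<lambda>x. M x $ i $ j)" and "\<And>x. x \<in> S \<Longrightarrow> det (M x) \<noteq> 0"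
  shows "smooth_on S (\<lambda>x. matrix_inv (M x) $ i $ j)"
proof -
  have "smooth_on S (\<lambda>x. ((\<chi> a b. if b = i then axis j 1 $ a else M x $ a $ b) :: real ^ 'n ^ 'n) $ k $ l)" for k l
    by (cases "l = i") (auto intro: smooth_on_const M)
  then have "smooth_on S (\<lambda>x. det (\<chi> a b. if b = i then axis j 1 $ a else M x $ a $ b) * inverse (det (M x)))"
    by (intro smooth_on_mult smooth_on_inverse smooth_on_det assms)
  then show ?thesis
    using assms(2) by (subst smooth_on_cong[OF matrix_inv_cramer]) auto
qed

section \<open>Directional derivatives and their symmetry\<close>

definition dir_deriv :: "'a::euclidean_space \<Rightarrow> ('a \<Rightarrow> real) \<Rightarrow> 'a \<Rightarrow> real" where
  "dir_deriv v f x = frechet_derivative f (at x) v"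

lemma dir_deriv_eqI: "(f has_derivative f') (at x) \<Longrightarrow> dir_deriv v f x = f' v"
  unfolding dir_deriv_def by (metis frechet_derivative_at)

lemma smooth_on_has_derivative:
  assumes "smooth_on S f" "open S" "x \<in> S"
  shows "(f has_derivative (\<lambda>v. dir_deriv v f x)) (at x)"
proof -
  have "C_k_on (Suc 0) S f" using assms by (simp add: smooth_on_def del: C_k_on.simps)
  then obtain f' where "(f has_derivative f') (at x within S)"
    using assms(3) by (elim C_k_on_SucE) blast
  then have "(f has_derivative f') (at x)"
    by (simp only: at_within_open[OF assms(3,2)])
  then show ?thesis by (simp add: dir_deriv_eqI)
qed

lemma smooth_on_frechet_derivative:
  assumes "smooth_on S f" "open S" "x \<in> S"
  shows "(f has_derivative frechet_derivative f (at x)) (at x)"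
proof -
  have "C_k_on (Suc 0) S f" using assms by (simp add: smooth_on_def del: C_k_on.simps)
  then obtain f' where "\<And>y. y \<in> S \<Longrightarrow> (f has_derivative f' y) (at y within S)"
    by (rule C_k_on_SucE) blast
  then have "(f has_derivative f' x) (at x)"
    using assms(3) by (simp only: at_within_open[OF assms(3,2), symmetric])
  then show ?thesis by (metis frechet_derivative_at)
qed

lemma smooth_on_Pair:
  assumes "smooth_on S f" "smooth_on S g"
  shows "smooth_on S (\<lambda>x. (f x, g x))"
proof -
  have "smooth_on S (\<lambda>x. (f x, 0) + (0, g x))"
    by (intro smooth_on_add smooth_on_bounded_linear[OF _ assms(1)] smooth_on_bounded_linear[OF _ assms(2)]
        bounded_linear_Pair bounded_linear_ident bounded_linear_zero)
  then show ?thesis by simp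
qed

lemma det_scaleR:
  fixes A :: "real ^ 'n ^ 'n"
  shows "det (c *\<^sub>R A) = c ^ CARD('n) * det A"
  by (simp add: det_def prod.distrib sum_distrib_left mult_ac)

lemma smooth_on_dir_deriv:
  assumes "smooth_on S f" "open S"
  shows "smooth_on S (dir_deriv v f)"
  unfolding smooth_on_def
proof
  fix k
  have "C_k_on (Suc k) S f" using assms by (simp add: smooth_on_def del: C_k_on.simps)
  then obtain f' where f': "\<And>x. x \<in> S \<Longrightarrow> (f has_derivative f' x) (at x within S)"
      "\<And>v. C_k_on k S (\<lambda>x. f' x v)" by (rule C_k_on_SucE) blast
  have "dir_deriv v f x = f' x v" if "x \<in> S" for x
    using f'(1)[OF that] unfolding at_within_open[OF that assms(2)] by (rule dir_deriv_eqI)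
  then show "C_k_on k S (dir_deriv v f)"
    using f'(2)[of v] by (simp cong: C_k_on_cong)
qed

lemma dir_deriv_cong:
  assumes "open S" "x \<in> S" "\<And>y. y \<in> S \<Longrightarrow> f y = g y"
  shows "dir_deriv v f x = dir_deriv v g x"
proof -
  have "(f has_derivative h) (at x) \<longleftrightarrow> (g has_derivative h) (at x)" for h
    using has_derivative_transform_within_open[of f h x UNIV S g]
      has_derivative_transform_within_open[of g h x UNIV S f] assms by auto
  then show ?thesis by (simp add: dir_deriv_def frechet_derivative_def)
qed

lemma dir_deriv_linear:
  assumes "smooth_on S f" "open S" "x \<in> S"
  shows "linear (\<lambda>v. dir_deriv v f x)"
  using smooth_on_has_derivative[OF assms] by (rule has_derivative_linear)

lemma has_real_derivative_line:
  assumes "smooth_on S F" "open S" "y + s *\<^sub>R u \<in> S"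
  shows "((\<lambda>s. F (y + s *\<^sub>R u)) has_real_derivative dir_deriv u F (y + s *\<^sub>R u)) (at s)"
proof -
  have "((\<lambda>s. y + s *\<^sub>R u) has_derivative (\<lambda>r. r *\<^sub>R u)) (at s)"
    by (auto intro!: derivative_eq_intros)
  from has_derivative_compose[OF this smooth_on_has_derivative[OF assms]]
  have "((\<lambda>s. F (y + s *\<^sub>R u)) has_derivative (\<lambda>r. dir_deriv (r *\<^sub>R u) F (y + s *\<^sub>R u))) (at s)" .
  moreover have "dir_deriv (r *\<^sub>R u) F (y + s *\<^sub>R u) = dir_deriv u F (y + s *\<^sub>R u) * r" for r
    using linear_scale[OF dir_deriv_linear[OF assms], of r u] by simp
  ultimately show ?thesis by (simp add: has_field_derivative_def)
qed

lemma has_real_derivative_entry: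
  fixes M :: "real \<Rightarrow> real ^ 'n ^ 'm"
  assumes "(M has_vector_derivative M') (at t within S)"
  shows "((\<lambda>s. M s $ i $ j) has_real_derivative M' $ i $ j) (at t within S)"
proof -
  have "bounded_linear (\<lambda>A::real^'n^'m. A $ i $ j)"
    by (intro bounded_linear_compose[OF bounded_linear_vec_nth] bounded_linear_vec_nth)
  from bounded_linear.has_vector_derivative[OF this assms] show ?thesis
    by (simp add: has_real_derivative_iff_has_vector_derivative)
qed

lemma dir_deriv_rules:
  assumes "smooth_on S f" "smooth_on S g" "open S" "x \<in> S"
  shows "dir_deriv v (\<lambda>x. f x + g x) x = dir_deriv v f x + dir_deriv v g x"
    and "dir_deriv v (\<lambda>x. f x * g x) x = dir_deriv v f x * g x + f x * dir_deriv v g x"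
    and "dir_deriv v (\<lambda>x. c * f x) x = c * dir_deriv v f x"
proof -
  note f = smooth_on_has_derivative[OF assms(1,3,4)] and g = smooth_on_has_derivative[OF assms(2-4)]
  show "dir_deriv v (\<lambda>x. f x + g x) x = dir_deriv v f x + dir_deriv v g x"
    by (rule dir_deriv_eqI) (rule has_derivative_add[OF f g])
  show "dir_deriv v (\<lambda>x. f x * g x) x = dir_deriv v f x * g x + f x * dir_deriv v g x"
    using dir_deriv_eqI[OF has_derivative_mult[OF f g]] by simp
  show "dir_deriv v (\<lambda>x. c * f x) x = c * dir_deriv v f x"
    by (rule dir_deriv_eqI) (rule has_derivative_mult_right[OF f])
qed

lemma dir_deriv_compose:
  fixes \<phi> :: "'a::euclidean_space \<Rightarrow> 'b::euclidean_space"
  assumes "smooth_on T f" "open T" "\<phi> x \<in> T" "(\<phi> has_derivative \<phi>') (at x)"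
  shows "dir_deriv v (\<lambda>x. f (\<phi> x)) x = dir_deriv (\<phi>' v) f (\<phi> x)"
  by (rule dir_deriv_eqI)
     (rule has_derivative_compose[OF assms(4) smooth_on_has_derivative[OF assms(1-3)]])

lemma dir_deriv_translate: "dir_deriv v (\<lambda>y. f (z + y)) x = dir_deriv v f (z + x)"
proof -
  have "((\<lambda>y. f (z + y)) has_derivative h) (at x) \<longleftrightarrow> (f has_derivative h) (at (z + x))" for h
  proof
    assume "(f has_derivative h) (at (z + x))"
    moreover have "((\<lambda>y. z + y) has_derivative (\<lambda>v. v)) (at x)"
      by (auto intro!: derivative_eq_intros)
    ultimately show "((\<lambda>y. f (z + y)) has_derivative h) (at x)"
      using has_derivative_compose by fastforce
  next
    assume "((\<lambda>y. f (z + y)) has_derivative h) (at x)"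
    then have "((\<lambda>y. f (z + y)) has_derivative h) (at (z + x - z))" by simp
    moreover have "((\<lambda>y. y - z) has_derivative (\<lambda>v. v)) (at (z + x))"
      by (auto intro!: derivative_eq_intros)
    ultimately have "((\<lambda>y. f (z + (y - z))) has_derivative h) (at (z + x))"
      using has_derivative_compose[of "\<lambda>y. y - z" "\<lambda>v. v" "z + x" UNIV "\<lambda>y. f (z + y)" h] by simp
    then show "(f has_derivative h) (at (z + x))" by simp
  qed
  then show ?thesis by (simp add: dir_deriv_def frechet_derivative_def)
qed

text \<open>
  Two applications of the mean value theorem. The left-hand side is symmetric in \<open>v\<close> and \<open>w\<close>, so
  both mixed second derivatives take a common value at points close to \<open>x\<close>.
\<close>

lemma second_difference_mean_value:
  assumes f: "smooth_on S f" "open S"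
    and h: "h > 0"
    and inS: "\<And>s t. 0 \<le> s \<Longrightarrow> s \<le> h \<Longrightarrow> 0 \<le> t \<Longrightarrow> t \<le> h \<Longrightarrow> x + s *\<^sub>R v + t *\<^sub>R w \<in> S"
  obtains s t where "0 < s" "s < h" "0 < t" "t < h"
    "f (x + h *\<^sub>R v + h *\<^sub>R w) - f (x + h *\<^sub>R v) - f (x + h *\<^sub>R w) + f x
      = h\<^sup>2 * dir_deriv w (dir_deriv v f) (x + s *\<^sub>R v + t *\<^sub>R w)"
proof -
  let ?g = "\<lambda>s. f (x + s *\<^sub>R v + h *\<^sub>R w) - f (x + s *\<^sub>R v)"
  note der = has_real_derivative_line[OF _ f(2)]
  have "\<exists>s. s > 0 \<and> s < h \<and> ?g h - ?g 0
      = (h - 0) * (dir_deriv v f (x + s *\<^sub>R v + h *\<^sub>R w) - dir_deriv v f (x + s *\<^sub>R v))"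
  proof (rule MVT2[OF h])
    fix s assume s: "0 \<le> s" "s \<le> h"
    have "x + h *\<^sub>R w + s *\<^sub>R v \<in> S" "x + s *\<^sub>R v \<in> S"
      using inS[of s h] inS[of s 0] s h by (simp_all add: algebra_simps)
    then show "(?g has_real_derivative (dir_deriv v f (x + s *\<^sub>R v + h *\<^sub>R w) - dir_deriv v f (x + s *\<^sub>R v))) (at s)"
      using DERIV_diff[OF der[OF f(1), of "x + h *\<^sub>R w" s v] der[OF f(1), of x s v]]
      by (simp add: algebra_simps)
  qed
  then obtain s where s: "0 < s" "s < h" and 1: "?g h - ?g 0
      = h * (dir_deriv v f (x + s *\<^sub>R v + h *\<^sub>R w) - dir_deriv v f (x + s *\<^sub>R v))"
    by auto
  let ?k = "\<lambda>t. dir_deriv v f (x + s *\<^sub>R v + t *\<^sub>R w)"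
  have "\<exists>t. t > 0 \<and> t < h \<and> ?k h - ?k 0 = (h - 0) * dir_deriv w (dir_deriv v f) (x + s *\<^sub>R v + t *\<^sub>R w)"
    by (rule MVT2[OF h]) (use s inS in \<open>auto intro!: der smooth_on_dir_deriv f\<close>)
  then obtain t where "0 < t" "t < h"
    "?k h - ?k 0 = h * dir_deriv w (dir_deriv v f) (x + s *\<^sub>R v + t *\<^sub>R w)"
    by auto
  with s 1 that show ?thesis
    by (simp add: power2_eq_square algebra_simps)
qed

lemma dir_deriv_commute:
  assumes f: "smooth_on S f" "open S" and x: "x \<in> S"
  shows "dir_deriv v (dir_deriv w f) x = dir_deriv w (dir_deriv v f) x"
proof (rule ccontr)
  let ?A = "dir_deriv w (dir_deriv v f)" and ?B = "dir_deriv v (dir_deriv w f)"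
  assume ne: "\<not> ?thesis"
  define e where "e = \<bar>?A x - ?B x\<bar> / 2"
  have e: "e > 0" using ne by (simp add: e_def)
  have "isCont ?A x" "isCont ?B x"
    using f x by (metis continuous_on_eq_continuous_at smooth_on_dir_deriv smooth_on_imp_continuous_on)+
  then obtain d1 d2 where d: "d1 > 0" "\<And>y. dist y x < d1 \<Longrightarrow> dist (?A y) (?A x) < e"
      "d2 > 0" "\<And>y. dist y x < d2 \<Longrightarrow> dist (?B y) (?B x) < e"
    using e unfolding continuous_at_eps_delta by (metis dist_commute)
  obtain d3 where d3: "d3 > 0" "ball x d3 \<subseteq> S" using f(2) x openE by blast
  define m where "m = min d1 (min d2 d3)"
  have m: "m > 0" using d d3 by (simp add: m_def)
  \<comment> \<open>small enough for the parallelogram with sides \<open>h v\<close> and \<open>h w\<close> to stay within distance \<open>m\<close> of \<open>x\<close>\<close>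
  define h where "h = m / (2 * (norm v + norm w + 1))"
  have h: "h > 0" using m by (simp add: h_def add_nonneg_pos)
  have near: "dist (x + s *\<^sub>R a + t *\<^sub>R b) x < m"
    if "0 \<le> s" "s \<le> h" "0 \<le> t" "t \<le> h" "norm a + norm b = norm v + norm w" for s t a b
  proof -
    have "dist (x + s *\<^sub>R a + t *\<^sub>R b) x = norm (s *\<^sub>R a + t *\<^sub>R b)" by (simp add: dist_norm algebra_simps)
    also have "\<dots> \<le> s * norm a + t * norm b"
      using norm_triangle_ineq[of "s *\<^sub>R a" "t *\<^sub>R b"] that by simp
    also have "\<dots> \<le> h * norm a + h * norm b"
      using that by (intro add_mono mult_right_mono) auto
    also have "\<dots> = h * (norm v + norm w)" using that(5) by (metis distrib_left)
    also have "\<dots> < h * (2 * (norm v + norm w + 1))"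
    proof (rule mult_strict_left_mono[OF _ h])
      show "norm v + norm w < 2 * (norm v + norm w + 1)"
        using norm_ge_zero[of v] norm_ge_zero[of w] by argo
    qed
    also have "\<dots> = m"
      using norm_ge_zero[of v] norm_ge_zero[of w] unfolding h_def by (simp add: add_nonneg_eq_0_iff)
    finally show ?thesis .
  qed
  have inS: "x + s *\<^sub>R a + t *\<^sub>R b \<in> S"
    if "0 \<le> s" "s \<le> h" "0 \<le> t" "t \<le> h" "norm a + norm b = norm v + norm w" for s t a b
  proof -
    have "dist (x + s *\<^sub>R a + t *\<^sub>R b) x < d3" using near[OF that] by (simp add: m_def)
    then show ?thesis using d3(2) by (metis dist_commute mem_ball subsetD)
  qed
  obtain s t where st: "0 < s" "s < h" "0 < t" "t < h"
    "f (x + h *\<^sub>R v + h *\<^sub>R w) - f (x + h *\<^sub>R v) - f (x + h *\<^sub>R w) + f x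
      = h\<^sup>2 * ?A (x + s *\<^sub>R v + t *\<^sub>R w)"
    by (rule second_difference_mean_value[OF f h, of x v w]) (use inS in auto)
  obtain s' t' where st': "0 < s'" "s' < h" "0 < t'" "t' < h"
    "f (x + h *\<^sub>R w + h *\<^sub>R v) - f (x + h *\<^sub>R w) - f (x + h *\<^sub>R v) + f x
      = h\<^sup>2 * ?B (x + s' *\<^sub>R w + t' *\<^sub>R v)"
    by (rule second_difference_mean_value[OF f h, of x w v]) (use inS in auto)
  have "x + h *\<^sub>R w + h *\<^sub>R v = x + h *\<^sub>R v + h *\<^sub>R w" by simp
  then have "h\<^sup>2 * ?A (x + s *\<^sub>R v + t *\<^sub>R w) = h\<^sup>2 * ?B (x + s' *\<^sub>R w + t' *\<^sub>R v)"
    unfolding st(5)[symmetric] st'(5)[symmetric] by (simp only: algebra_simps)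
  then have eq: "?A (x + s *\<^sub>R v + t *\<^sub>R w) = ?B (x + s' *\<^sub>R w + t' *\<^sub>R v)"
    using h by simp
  have "dist (x + s *\<^sub>R v + t *\<^sub>R w) x < d1" "dist (x + s' *\<^sub>R w + t' *\<^sub>R v) x < d2"
    using near[of s t v w] near[of s' t' w v] st st' by (simp_all add: m_def)
  then have "dist (?A (x + s *\<^sub>R v + t *\<^sub>R w)) (?A x) < e" "dist (?B (x + s' *\<^sub>R w + t' *\<^sub>R v)) (?B x) < e"
    using d by blast+
  then show False
    unfolding eq e_def dist_real_def by (simp add: abs_if split: if_splits)
qed

section \<open>Germs of smooth functions\<close>

text \<open>
  Smoothness near \<open>0\<close> is built into the relation. It is therefore only a partial equivalence, whose
  classes are the germs at \<open>0\<close> of smooth functions. They form a ring on which differentiation is total,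
  so that identities can be computed without side conditions.
\<close>

definition germ_eq :: "('e::euclidean_space \<Rightarrow> real) \<Rightarrow> ('e \<Rightarrow> real) \<Rightarrow> bool" where
  "germ_eq f g \<longleftrightarrow> (\<exists>S. open S \<and> 0 \<in> S \<and> smooth_on S f \<and> smooth_on S g \<and> (\<forall>x\<in>S. f x = g x))"

lemma part_equivp_germ_eq: "part_equivp germ_eq"
proof (rule part_equivpI)
  show "\<exists>f. germ_eq f f"
    unfolding germ_eq_def by (rule exI[of _ "\<lambda>_. 0"]) (auto intro!: exI[of _ UNIV] smooth_on_const)
  show "symp germ_eq"
    by (rule sympI) (fastforce simp: germ_eq_def)
  show "transp germ_eq"
  proof (rule transpI)
    fix f g h assume "germ_eq f g" "germ_eq g h"
    then obtain S T where "open S" "0 \<in> S" "smooth_on S f" "smooth_on S g" "\<forall>x\<in>S. f x = g x"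
      "open T" "0 \<in> T" "smooth_on T g" "smooth_on T h" "\<forall>x\<in>T. g x = h x"
      unfolding germ_eq_def by blast
    then show "germ_eq f h"
      unfolding germ_eq_def
      by (intro exI[of _ "S \<inter> T"]) (auto intro: smooth_on_subset)
  qed
qed

quotient_type (overloaded) 'e germ = "'e::euclidean_space \<Rightarrow> real" / partial: germ_eq
  by (rule part_equivp_germ_eq)

lemma germ_eqI:
  "open S \<Longrightarrow> 0 \<in> S \<Longrightarrow> smooth_on S f \<Longrightarrow> (\<And>x. x \<in> S \<Longrightarrow> f x = g x) \<Longrightarrow> germ_eq f g"
  unfolding germ_eq_def using smooth_on_cong by blast

lemma germ_eqE2:
  assumes "germ_eq f g" "germ_eq h k"
  obtains S where "open S" "0 \<in> S" "smooth_on S f" "smooth_on S g" "\<And>x. x \<in> S \<Longrightarrow> f x = g x"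
    "smooth_on S h" "smooth_on S k" "\<And>x. x \<in> S \<Longrightarrow> h x = k x"
proof -
  obtain S T where "open S" "0 \<in> S" "smooth_on S f" "smooth_on S g" "\<forall>x\<in>S. f x = g x"
    "open T" "0 \<in> T" "smooth_on T h" "smooth_on T k" "\<forall>x\<in>T. h x = k x"
    using assms unfolding germ_eq_def by blast
  then show thesis by (intro that[of "S \<inter> T"]) (auto intro: smooth_on_subset)
qed

lemma germ_eqE:
  assumes "germ_eq f g"
  obtains S where "open S" "0 \<in> S" "smooth_on S f" "smooth_on S g" "\<And>x. x \<in> S \<Longrightarrow> f x = g x"
  using assms unfolding germ_eq_def by blast

lemma germ_smooth1: "germ_eq f f \<Longrightarrow> \<exists>S. open S \<and> 0 \<in> S \<and> smooth_on S f"
  unfolding germ_eq_def by blast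

lemma germ_smooth2:
  assumes "germ_eq f f" "germ_eq g g"
  shows "\<exists>S. open S \<and> 0 \<in> S \<and> smooth_on S f \<and> smooth_on S g"
  using assms by (rule germ_eqE2) blast

lemma germ_smooth3:
  assumes "germ_eq f f" "germ_eq g g" "germ_eq h h"
  shows "\<exists>S. open S \<and> 0 \<in> S \<and> smooth_on S f \<and> smooth_on S g \<and> smooth_on S h"
proof -
  obtain S T where "open S" "0 \<in> S" "smooth_on S f" "smooth_on S g" "open T" "0 \<in> T" "smooth_on T h"
    using germ_smooth1[OF assms(3)] germ_smooth2[OF assms(1,2)] by blast
  then show ?thesis by (intro exI[of _ "S \<inter> T"]) (auto intro: smooth_on_subset)
qed

instantiation germ :: (euclidean_space) comm_ring_1
begin

lift_definition zero_germ :: "'a germ" is "\<lambda>_. 0"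
  by (rule germ_eqI[of UNIV]) (auto intro: smooth_on_const)

lift_definition one_germ :: "'a germ" is "\<lambda>_. 1"
  by (rule germ_eqI[of UNIV]) (auto intro: smooth_on_const)

lift_definition plus_germ :: "'a germ \<Rightarrow> 'a germ \<Rightarrow> 'a germ" is "\<lambda>f g x. f x + g x"
  by (erule germ_eqE2, assumption, rule germ_eqI) (auto intro: smooth_on_add)

lift_definition times_germ :: "'a germ \<Rightarrow> 'a germ \<Rightarrow> 'a germ" is "\<lambda>f g x. f x * g x"
  by (erule germ_eqE2, assumption, rule germ_eqI) (auto intro: smooth_on_mult)

lift_definition minus_germ :: "'a germ \<Rightarrow> 'a germ \<Rightarrow> 'a germ" is "\<lambda>f g x. f x - g x"
  by (erule germ_eqE2, assumption, rule germ_eqI) (auto intro: smooth_on_diff)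

lift_definition uminus_germ :: "'a germ \<Rightarrow> 'a germ" is "\<lambda>f x. - f x"
  by (erule germ_eqE, rule germ_eqI) (auto intro: smooth_on_uminus)

instance
proof
  fix a b c :: "'a germ"
  note sm = smooth_on_add smooth_on_mult smooth_on_const smooth_on_diff smooth_on_uminus
  show "a + b + c = a + (b + c)" "a * b * c = a * (b * c)" "(a + b) * c = a * c + b * c"
    by (transfer, drule (2) germ_smooth3, elim exE conjE, rule germ_eqI, assumption, assumption,
        (intro sm; assumption), simp add: algebra_simps)+
  show "a + b = b + a" "a * b = b * a" "a - b = a + - b"
    by (transfer, drule (1) germ_smooth2, elim exE conjE, rule germ_eqI, assumption, assumption,
        (intro sm; assumption), simp add: algebra_simps)+
  show "0 + a = a" "- a + a = 0" "1 * a = a"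
    by (transfer, drule germ_smooth1, elim exE conjE, rule germ_eqI, assumption, assumption,
        (intro sm; assumption), simp add: algebra_simps)+
  show "(0::'a germ) \<noteq> 1"
    by transfer (auto simp: germ_eq_def)
qed

end

instantiation germ :: (euclidean_space) real_algebra_1
begin

lift_definition scaleR_germ :: "real \<Rightarrow> 'a germ \<Rightarrow> 'a germ" is "\<lambda>r f x. r * f x"
  by (erule germ_eqE, rule germ_eqI) (auto intro: smooth_on_mult smooth_on_const)

instance
proof
  fix a b :: "'a germ" and r s :: real
  note sm = smooth_on_add smooth_on_mult smooth_on_const smooth_on_diff smooth_on_uminus
  show "r *\<^sub>R (a + b) = r *\<^sub>R a + r *\<^sub>R b" "r *\<^sub>R a * b = r *\<^sub>R (a * b)" "a * r *\<^sub>R b = r *\<^sub>R (a * b)"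
    by (transfer, drule (1) germ_smooth2, elim exE conjE, rule germ_eqI, assumption, assumption,
        (intro sm; assumption), simp add: algebra_simps)+
  show "r *\<^sub>R s *\<^sub>R a = (r * s) *\<^sub>R a" "1 *\<^sub>R a = a" "(r + s) *\<^sub>R a = r *\<^sub>R a + s *\<^sub>R a"
    by (transfer, drule germ_smooth1, elim exE conjE, rule germ_eqI, assumption, assumption,
        (intro sm; assumption), simp add: algebra_simps)+
qed

end

lift_definition germ_deriv :: "'e::euclidean_space \<Rightarrow> 'e germ \<Rightarrow> 'e germ" is dir_deriv
  by (erule germ_eqE, rule germ_eqI) (auto intro: smooth_on_dir_deriv dir_deriv_cong)

lift_definition germ_value :: "'e::euclidean_space germ \<Rightarrow> real" is "\<lambda>f. f 0"
  by (auto elim: germ_eqE)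

lemma derivation_germ_deriv: "derivation (germ_deriv v)"
  unfolding derivation_def
proof (intro conjI allI)
  fix x y :: "'a germ" and r :: real
  note sm = smooth_on_add smooth_on_mult smooth_on_const smooth_on_dir_deriv
  show "germ_deriv v (x + y) = germ_deriv v x + germ_deriv v y"
    by (transfer, drule (1) germ_smooth2, elim exE conjE, rule germ_eqI, assumption, assumption,
        (intro sm; assumption), rule dir_deriv_rules; assumption)
  show "germ_deriv v (x * y) = germ_deriv v x * y + x * germ_deriv v y"
    by (transfer, drule (1) germ_smooth2, elim exE conjE, rule germ_eqI, assumption, assumption,
        (intro sm; assumption), rule dir_deriv_rules; assumption)
  show "germ_deriv v (r *\<^sub>R x) = r *\<^sub>R germ_deriv v x"
    by (transfer, drule germ_smooth1, elim exE conjE, rule germ_eqI, assumption, assumption,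
        (intro sm; assumption), rule dir_deriv_rules; assumption)
qed

lemma germ_deriv_commute: "germ_deriv v (germ_deriv w x) = germ_deriv w (germ_deriv v x)"
  by (transfer, drule germ_smooth1, elim exE conjE, rule germ_eqI, assumption, assumption,
      (intro smooth_on_dir_deriv; assumption), rule dir_deriv_commute; assumption)

text \<open>
  Germs at other points are translated to \<open>0\<close>, so that a single ring serves all points.
\<close>

definition germ :: "'e::euclidean_space \<Rightarrow> ('e \<Rightarrow> real) \<Rightarrow> 'e germ" where
  "germ z f = abs_germ (\<lambda>y. f (z + y))"

locale open_nbhd =
  fixes S :: "'e::euclidean_space set" and z :: 'e
  assumes open_S: "open S" and z_in: "z \<in> S"
begin

lemma open_shift: "open ((\<lambda>y. z + y) -` S)"
  by (intro open_vimage open_S) (intro continuous_intros)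

lemma smooth_shift: "smooth_on S f \<Longrightarrow> smooth_on ((\<lambda>y. z + y) -` S) (\<lambda>y. f (z + y))"
  by (rule smooth_on_compose[of S]) (auto intro!: smooth_on_add smooth_on_const smooth_on_id)

lemma germ_eq_shift: "smooth_on S f \<Longrightarrow> germ_eq (\<lambda>y. f (z + y)) (\<lambda>y. f (z + y))"
  by (rule germ_eqI[OF open_shift]) (use z_in in \<open>auto intro: smooth_shift\<close>)

lemma germ_cong:
  assumes "smooth_on S f" "\<And>x. x \<in> S \<Longrightarrow> f x = g x"
  shows "germ z f = germ z g"
proof -
  have "germ_eq (\<lambda>y. f (z + y)) (\<lambda>y. g (z + y))"
    by (rule germ_eqI[OF open_shift]) (use z_in assms in \<open>auto intro: smooth_shift\<close>)
  then show ?thesis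
    unfolding germ_def by (rule Quotient3_rel_abs[OF Quotient3_germ])
qed

lemma germ_add: "smooth_on S f \<Longrightarrow> smooth_on S g \<Longrightarrow> germ z (\<lambda>x. f x + g x) = germ z f + germ z g"
  unfolding germ_def by (simp add: plus_germ.abs_eq germ_eq_shift)

lemma germ_diff: "smooth_on S f \<Longrightarrow> smooth_on S g \<Longrightarrow> germ z (\<lambda>x. f x - g x) = germ z f - germ z g"
  unfolding germ_def by (simp add: minus_germ.abs_eq germ_eq_shift)

lemma germ_mult: "smooth_on S f \<Longrightarrow> smooth_on S g \<Longrightarrow> germ z (\<lambda>x. f x * g x) = germ z f * germ z g"
  unfolding germ_def by (simp add: times_germ.abs_eq germ_eq_shift)

lemma germ_scale: "smooth_on S f \<Longrightarrow> germ z (\<lambda>x. c * f x) = c *\<^sub>R germ z f"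
  unfolding germ_def by (simp add: scaleR_germ.abs_eq germ_eq_shift)

lemma germ_zero: "germ z (\<lambda>x. 0) = 0"
  unfolding germ_def by (simp add: zero_germ_def)

lemma germ_one: "germ z (\<lambda>x. 1) = 1"
  unfolding germ_def by (simp add: one_germ_def)

lemma germ_sum: "(\<And>a. a \<in> A \<Longrightarrow> smooth_on S (f a)) \<Longrightarrow> germ z (\<lambda>x. \<Sum>a\<in>A. f a x) = (\<Sum>a\<in>A. germ z (f a))"
  by (induction A rule: infinite_finite_induct) (auto simp: germ_zero germ_add smooth_on_sum)

lemma germ_dir_deriv: "smooth_on S f \<Longrightarrow> germ z (dir_deriv v f) = germ_deriv v (germ z f)"
  unfolding germ_def by (simp add: germ_deriv.abs_eq germ_eq_shift dir_deriv_translate[abs_def])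

lemma germ_value: "smooth_on S f \<Longrightarrow> germ_value (germ z f) = f z"
  unfolding germ_def by (simp add: germ_value.abs_eq germ_eq_shift)

definition gmat :: "('e \<Rightarrow> real ^ 'n ^ 'm) \<Rightarrow> 'e germ ^ 'n ^ 'm" where
  "gmat M = (\<chi> i j. germ z (\<lambda>p. M p $ i $ j))"

lemma gmat_nth [simp]: "gmat M $ i $ j = germ z (\<lambda>p. M p $ i $ j)"
  by (simp add: gmat_def)

lemma gmat_cong:
  assumes "\<And>i j. smooth_on S (\<lambda>p. M p $ i $ j)" "\<And>p. p \<in> S \<Longrightarrow> M p = N p"
  shows "gmat M = gmat N"
  unfolding vec_eq_iff gmat_nth using assms by (auto intro: germ_cong)

lemma gmat_mult:
  fixes M :: "'e \<Rightarrow> real ^ 'n ^ 'm" and N :: "'e \<Rightarrow> real ^ 'k ^ 'n"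
  assumes "\<And>i j. smooth_on S (\<lambda>p. M p $ i $ j)" "\<And>i j. smooth_on S (\<lambda>p. N p $ i $ j)"
  shows "gmat M ** gmat N = gmat (\<lambda>p. M p ** N p)"
  by (simp add: vec_eq_iff matrix_matrix_mult_def germ_sum germ_mult smooth_on_mult assms)

lemma gmat_one: "gmat (\<lambda>p. mat 1) = mat 1"
  by (simp add: vec_eq_iff mat_def germ_one germ_zero)

lemma gmat_transpose: "transpose (gmat M) = gmat (\<lambda>p. transpose (M p))"
  by (simp add: vec_eq_iff transpose_def)

lemma gmat_scaleR:
  assumes "\<And>i j. smooth_on S (\<lambda>p. M p $ i $ j)"
  shows "c *\<^sub>R gmat M = gmat (\<lambda>p. c *\<^sub>R M p)"
  by (simp add: vec_eq_iff germ_scale assms)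

lemma smooth_matrix_mult:
  fixes M :: "'e \<Rightarrow> real ^ 'n ^ 'm" and N :: "'e \<Rightarrow> real ^ 'k ^ 'n"
  assumes "\<And>i j. smooth_on S (\<lambda>p. M p $ i $ j)" "\<And>i j. smooth_on S (\<lambda>p. N p $ i $ j)"
  shows "smooth_on S (\<lambda>p. (M p ** N p) $ i $ j)"
  by (simp add: matrix_matrix_mult_def smooth_on_sum smooth_on_mult assms)

lemma gmat_inverse:
  fixes M :: "'e \<Rightarrow> real ^ 'n ^ 'n"
  assumes M: "\<And>i j. smooth_on S (\<lambda>p. M p $ i $ j)" and "\<And>p. p \<in> S \<Longrightarrow> det (M p) \<noteq> 0"
  shows "gmat M ** gmat (\<lambda>p. matrix_inv (M p)) = mat 1"
    "gmat (\<lambda>p. matrix_inv (M p)) ** gmat M = mat 1"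
proof -
  have inv: "invertible (M p)" if "p \<in> S" for p
    using assms(2)[OF that] by (simp add: invertible_det_nz)
  have sm: "smooth_on S (\<lambda>p. matrix_inv (M p) $ i $ j)" for i j
    by (rule smooth_on_matrix_inv[OF M assms(2)])
  show "gmat M ** gmat (\<lambda>p. matrix_inv (M p)) = mat 1"
    unfolding gmat_mult[OF M sm] gmat_one[symmetric]
    by (rule gmat_cong) (auto intro!: smooth_matrix_mult M sm simp: matrix_inv_mult inv)
  show "gmat (\<lambda>p. matrix_inv (M p)) ** gmat M = mat 1"
    unfolding gmat_mult[OF sm M] gmat_one[symmetric]
    by (rule gmat_cong) (auto intro!: smooth_matrix_mult M sm simp: matrix_inv_mult inv)
qed

end

lemma germ_value_algebra:
  "germ_value (x + y) = germ_value x + germ_value y"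
  "germ_value (x - y) = germ_value x - germ_value y"
  "germ_value (x * y) = germ_value x * germ_value y"
  "germ_value (r *\<^sub>R x) = r * germ_value x"
  "germ_value 0 = 0"
  by (transfer; simp)+

lemma germ_value_sum: "germ_value (sum f A) = (\<Sum>a\<in>A. germ_value (f a))"
  by (induction A rule: infinite_finite_induct) (auto simp: germ_value_algebra)

lemma germ_cases:
  obtains f S where "open S" "z \<in> S" "smooth_on S f" "x = germ z f"
proof -
  have x: "germ_eq (rep_germ x) (rep_germ x)" "abs_germ (rep_germ x) = x"
    using Quotient3_germ by (metis Quotient3_rep_reflp Quotient3_abs_rep)+
  then obtain S where S: "open S" "0 \<in> S" "smooth_on S (rep_germ x)"
    using germ_smooth1 by blast
  show thesis
  proof (rule that[of "(\<lambda>y. y - z) -` S" "\<lambda>y. rep_germ x (y - z)"])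
    show "open ((\<lambda>y. y - z) -` S)" by (intro open_vimage S) (intro continuous_intros)
    show "smooth_on ((\<lambda>y. y - z) -` S) (\<lambda>y. rep_germ x (y - z))"
      by (rule smooth_on_compose[OF S(3)]) (auto intro!: smooth_on_diff smooth_on_const smooth_on_id)
    show "x = germ z (\<lambda>y. rep_germ x (y - z))" by (simp add: germ_def x)
  qed (use S in auto)
qed

text \<open>
  Composition of a germ at \<open>\<psi> z\<close> with \<open>\<psi>\<close>, again translated to the origin on both sides.
\<close>

definition germ_pull :: "'e::euclidean_space \<Rightarrow> ('e \<Rightarrow> 'd::euclidean_space) \<Rightarrow> 'd germ \<Rightarrow> 'e germ" where
  "germ_pull z \<psi> x = germ z (\<lambda>p. rep_germ x (\<psi> p - \<psi> z))"

lemma germ_pull_germ: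
  assumes f: "smooth_on T f" "open T" "\<psi> z \<in> T" and \<psi>: "smooth_on S \<psi>" "open S" "z \<in> S"
  shows "germ_pull z \<psi> (germ (\<psi> z) f) = germ z (\<lambda>p. f (\<psi> p))"
proof -
  interpret T: open_nbhd T "\<psi> z" using f by unfold_locales
  have "germ_eq (rep_germ (germ (\<psi> z) f)) (\<lambda>y. f (\<psi> z + y))"
    unfolding germ_def using T.germ_eq_shift[OF f(1)] by (rule Quotient3_rep_abs[OF Quotient3_germ])
  then obtain U where U: "open U" "0 \<in> U" "smooth_on U (rep_germ (germ (\<psi> z) f))"
      "\<And>y. y \<in> U \<Longrightarrow> rep_germ (germ (\<psi> z) f) y = f (\<psi> z + y)"
    by (rule germ_eqE) blast
  define V where "V = S \<inter> (\<lambda>p. \<psi> p - \<psi> z) -` U"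
  have "open V"
    unfolding V_def
    by (rule continuous_open_preimage[OF _ \<psi>(2) U(1)])
      (intro continuous_intros smooth_on_imp_continuous_on[OF \<psi>(1)])
  then interpret V: open_nbhd V z
    using \<psi>(3) U(2) by unfold_locales (auto simp: V_def)
  show ?thesis
    unfolding germ_pull_def
  proof (rule V.germ_cong)
    show "smooth_on V (\<lambda>p. rep_germ (germ (\<psi> z) f) (\<psi> p - \<psi> z))"
      by (rule smooth_on_compose[OF U(3)])
        (auto simp: V_def intro!: smooth_on_diff smooth_on_const smooth_on_subset[OF \<psi>(1)])
    show "rep_germ (germ (\<psi> z) f) (\<psi> p - \<psi> z) = f (\<psi> p)" if "p \<in> V" for p
      using that U(4) by (simp add: V_def)
  qed
qed

lemma germ_pull_hom:
  assumes \<psi>: "smooth_on S \<psi>" "open S" "z \<in> S"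
  shows "germ_pull z \<psi> (x + y) = germ_pull z \<psi> x + germ_pull z \<psi> y"
    "germ_pull z \<psi> (x * y) = germ_pull z \<psi> x * germ_pull z \<psi> y"
    "germ_pull z \<psi> 1 = 1"
proof -
  obtain f A where f: "open A" "\<psi> z \<in> A" "smooth_on A f" "x = germ (\<psi> z) f" by (rule germ_cases)
  obtain g B where g: "open B" "\<psi> z \<in> B" "smooth_on B g" "y = germ (\<psi> z) g" by (rule germ_cases)
  define T where "T = A \<inter> B"
  have fg: "smooth_on T f" "smooth_on T g" using f g by (auto simp: T_def intro: smooth_on_subset)
  interpret T: open_nbhd T "\<psi> z" using f g by unfold_locales (auto simp: T_def)
  define V where "V = S \<inter> \<psi> -` T"
  have "open V"
    unfolding V_def by (rule continuous_open_preimage[OF smooth_on_imp_continuous_on[OF \<psi>(1)] \<psi>(2) T.open_S])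
  then interpret V: open_nbhd V z using \<psi>(3) T.z_in by unfold_locales (auto simp: V_def)
  have sm: "smooth_on V (\<lambda>p. h (\<psi> p))" if "smooth_on T h" for h :: "_ \<Rightarrow> real"
    by (rule smooth_on_compose[OF that]) (auto simp: V_def intro: smooth_on_subset[OF \<psi>(1)])
  note pull = germ_pull_germ[OF _ T.open_S T.z_in \<psi>]
  show "germ_pull z \<psi> (x + y) = germ_pull z \<psi> x + germ_pull z \<psi> y"
    unfolding f g T.germ_add[OF fg, symmetric] pull[OF smooth_on_add[OF fg]] pull[OF fg(1)] pull[OF fg(2)]
    by (rule V.germ_add) (intro sm fg)+
  show "germ_pull z \<psi> (x * y) = germ_pull z \<psi> x * germ_pull z \<psi> y"
    unfolding f g T.germ_mult[OF fg, symmetric] pull[OF smooth_on_mult[OF fg]] pull[OF fg(1)] pull[OF fg(2)]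
    by (rule V.germ_mult) (intro sm fg)+
  show "germ_pull z \<psi> 1 = 1"
    unfolding T.germ_one[symmetric] pull[OF smooth_on_const] by (rule V.germ_one)
qed

section \<open>Curvature of a family of metrics, in terms of germs\<close>

text \<open>
  A time-dependent metric in a chart is a function on space-time. Time-independent metrics are treated
  as constant families, so that the same germs serve both the evolution equation and naturality.
\<close>

type_synonym 'n spacetime = "real \<times> (real ^ 'n)"

definition xdir :: "'n::finite \<Rightarrow> 'n spacetime" where
  "xdir i = (0, axis i 1)"

definition tdir :: "'n::finite spacetime" where
  "tdir = (1, 0)"

lemma partial_deriv_slice:
  assumes "smooth_on W f" "open W" "p \<in> W"
  shows "partial_deriv i (\<lambda>y. f (fst p, y)) (snd p) = dir_deriv (xdir i) f p"
proof -
  have "((\<lambda>y. (fst p, y)) has_derivative (\<lambda>v. (0, v))) (at (snd p))"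
    by (auto intro!: derivative_eq_intros)
  from dir_deriv_compose[OF assms(1,2) _ this, of "axis i 1"] assms(3)
  show ?thesis by (simp add: partial_deriv_def dir_deriv_def xdir_def)
qed

lemma partial_deriv_slice':
  assumes "smooth_on W (\<lambda>p. F (fst p) (snd p))" "open W" "p \<in> W"
  shows "partial_deriv i (F (fst p)) (snd p) = dir_deriv (xdir i) (\<lambda>p. F (fst p) (snd p)) p"
  using partial_deriv_slice[OF assms, of i] by simp

definition scalar_curvature :: "(real ^ 'n::finite \<Rightarrow> real ^ 'n ^ 'n) \<Rightarrow> real ^ 'n \<Rightarrow> real" where
  "scalar_curvature G x = (\<Sum>j\<in>UNIV. \<Sum>k\<in>UNIV. matrix_inv (G x) $ j $ k * ricci G x $ j $ k)"

locale smooth_metric =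
  fixes W :: "'n::finite spacetime set" and g :: "real \<Rightarrow> real ^ 'n \<Rightarrow> real ^ 'n ^ 'n"
  assumes open_W: "open W"
    and smooth_g: "\<And>i j. smooth_on W (\<lambda>p. g (fst p) (snd p) $ i $ j)"
    and sym_g: "\<And>p. p \<in> W \<Longrightarrow> transpose (g (fst p) (snd p)) = g (fst p) (snd p)"
    and det_g: "\<And>p. p \<in> W \<Longrightarrow> det (g (fst p) (snd p)) \<noteq> 0"
begin

abbreviation "Gf i j \<equiv> \<lambda>p. g (fst p) (snd p) $ i $ j"
abbreviation "Hf i j \<equiv> \<lambda>p. matrix_inv (g (fst p) (snd p)) $ i $ j"
abbreviation "chr k i j \<equiv> \<lambda>p. christoffel (g (fst p)) k i j (snd p)"
abbreviation "rie l i j k \<equiv> \<lambda>p. riemann (g (fst p)) l i j k (snd p)"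
abbreviation "rc j k \<equiv> \<lambda>p. ricci (g (fst p)) (snd p) $ j $ k"
abbreviation "scf \<equiv> \<lambda>p. scalar_curvature (g (fst p)) (snd p)"

lemma smooth_H: "smooth_on W (Hf i j)"
  by (intro smooth_on_matrix_inv smooth_g det_g)

lemmas smooth_D = smooth_on_dir_deriv[OF _ open_W]

lemma chr_eq:
  assumes "p \<in> W"
  shows "chr k i j p = (1 / 2) * (\<Sum>l\<in>UNIV. Hf k l p *
     (dir_deriv (xdir i) (Gf j l) p + dir_deriv (xdir j) (Gf i l) p - dir_deriv (xdir l) (Gf i j) p))"
  using partial_deriv_slice[OF smooth_g open_W assms] by (simp add: christoffel_def)

lemma smooth_chr: "smooth_on W (chr k i j)"
  by (subst smooth_on_cong[OF chr_eq], assumption)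
     (intro smooth_on_mult smooth_on_const smooth_on_sum smooth_H smooth_on_add smooth_on_diff smooth_D smooth_g)

lemma rie_eq:
  assumes "p \<in> W"
  shows "rie l i j k p = dir_deriv (xdir i) (chr l j k) p - dir_deriv (xdir j) (chr l i k) p
     + ((\<Sum>m\<in>UNIV. chr l i m p * chr m j k p) - (\<Sum>m\<in>UNIV. chr l j m p * chr m i k p))"
  using partial_deriv_slice'[OF smooth_chr open_W assms] by (simp add: riemann_def sum_subtractf)

lemma smooth_rie: "smooth_on W (rie l i j k)"
  by (subst smooth_on_cong[OF rie_eq], assumption)
     (intro smooth_on_mult smooth_on_sum smooth_on_add smooth_on_diff smooth_D smooth_chr)

lemma smooth_rc: "smooth_on W (rc j k)"
  unfolding ricci_def by (simp, intro smooth_on_sum smooth_rie)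

lemma smooth_scf: "smooth_on W scf"
  unfolding scalar_curvature_def by (intro smooth_on_sum smooth_on_mult smooth_rc smooth_H)

lemmas smooth_intros = smooth_g smooth_H smooth_chr smooth_rie smooth_rc smooth_scf smooth_D
  smooth_on_sum smooth_on_mult smooth_on_add smooth_on_diff smooth_on_const

end

text \<open>
  The germs at \<open>z\<close> of the metric and of its Christoffel symbols satisfy the axioms of the algebraic
  calculus, and the algebraic curvature consists of the germs of the coordinate expressions.
\<close>

locale smooth_metric_at = smooth_metric W g
  for W :: "'n::finite spacetime set" and g :: "real \<Rightarrow> real ^ 'n \<Rightarrow> real ^ 'n ^ 'n" +
  fixes z :: "'n spacetime"
  assumes z_in: "z \<in> W"
begin

sublocale open_nbhd W z
  by unfold_locales (auto intro: open_W z_in)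

definition "gG = gmat (\<lambda>p. g (fst p) (snd p))"
definition "gH = gmat (\<lambda>p. matrix_inv (g (fst p) (snd p)))"
definition "gom k = (\<chi> l j. germ z (chr l k j))"

lemma germ_components [simp]:
  "gG $ i $ j = germ z (Gf i j)" "gH $ i $ j = germ z (Hf i j)" "gom k $ l $ j = germ z (chr l k j)"
  by (simp_all add: gG_def gH_def gom_def)

sublocale alg: metric_algebra "\<lambda>i. germ_deriv (xdir i)" gG gH
proof
  show "derivation (germ_deriv (xdir i))" for i :: 'n by (rule derivation_germ_deriv)
  show "germ_deriv (xdir i) (germ_deriv (xdir j) x) = germ_deriv (xdir j) (germ_deriv (xdir i) x)"
    for i j :: 'n and x by (rule germ_deriv_commute)
  show "transpose gG = gG"
    unfolding gG_def gmat_transpose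
    by (rule gmat_cong) (simp_all add: transpose_def smooth_g sym_g[unfolded transpose_def])
  show "gH ** gG = mat 1" "gG ** gH = mat 1"
    unfolding gG_def gH_def by (rule gmat_inverse[OF smooth_g det_g]; assumption)+
qed

sublocale alg: levi_civita "\<lambda>i. germ_deriv (xdir i)" gG gH gom
proof (rule alg.levi_civita_christoffel)
  fix k l j
  have "germ z (chr l k j) = germ z (\<lambda>p. (1 / 2) * (\<Sum>m\<in>UNIV. Hf l m p *
     (dir_deriv (xdir k) (Gf j m) p + dir_deriv (xdir j) (Gf k m) p - dir_deriv (xdir m) (Gf k j) p)))"
    by (rule germ_cong[OF smooth_chr chr_eq])
  also have "\<dots> = (1 / 2) *\<^sub>R germ z (\<lambda>p. \<Sum>m\<in>UNIV. Hf l m p *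
     (dir_deriv (xdir k) (Gf j m) p + dir_deriv (xdir j) (Gf k m) p - dir_deriv (xdir m) (Gf k j) p))"
    by (rule germ_scale) (intro smooth_intros)
  finally show "gom k $ l $ j = (1 / 2) *\<^sub>R (\<Sum>m\<in>UNIV. gH $ l $ m *
     (germ_deriv (xdir k) (gG $ j $ m) + germ_deriv (xdir j) (gG $ k $ m) - germ_deriv (xdir m) (gG $ k $ j)))"
    by (simp add: germ_sum germ_mult germ_add germ_diff smooth_intros germ_dir_deriv)
qed

lemma alg_curv: "alg.curv i j $ l $ k = germ z (rie l i j k)"
proof -
  have "germ z (rie l i j k) = germ z (\<lambda>p. dir_deriv (xdir i) (chr l j k) p - dir_deriv (xdir j) (chr l i k) p
     + ((\<Sum>m\<in>UNIV. chr l i m p * chr m j k p) - (\<Sum>m\<in>UNIV. chr l j m p * chr m i k p)))"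
    by (rule germ_cong[OF smooth_rie rie_eq])
  then show ?thesis
    by (simp add: alg.curv_def matrix_matrix_mult_def germ_sum germ_mult germ_add germ_diff smooth_intros germ_dir_deriv)
qed

lemma alg_ric: "alg.ric $ j $ k = germ z (rc j k)"
  by (simp add: alg.ric_def alg_curv ricci_def germ_sum smooth_rie)

lemma alg_scal: "alg.scal = germ z scf"
  by (simp add: alg.scal_def alg_ric scalar_curvature_def germ_sum germ_mult smooth_intros)

end

section \<open>Evolution and naturality of the scalar curvature\<close>

theorem scalar_curvature_evolution:
  fixes W :: "'n::finite spacetime set"
  assumes "smooth_metric W g" and z: "z \<in> W"
    and flow: "\<And>p. p \<in> W \<Longrightarrow>
      ((\<lambda>s. g s (snd p)) has_vector_derivative - 2 *\<^sub>R ricci (g (fst p)) (snd p)) (at (fst p))"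
  defines "R \<equiv> \<lambda>p. scalar_curvature (g (fst p)) (snd p)"
  defines "Ric \<equiv> ricci (g (fst z)) (snd z)" and "H \<equiv> matrix_inv (g (fst z) (snd z))"
  shows "dir_deriv tdir R z = 2 * (\<Sum>j\<in>UNIV. \<Sum>k\<in>UNIV. (H ** Ric ** H) $ j $ k * Ric $ j $ k)
     + (\<Sum>j\<in>UNIV. \<Sum>k\<in>UNIV. H $ j $ k * (dir_deriv (xdir j) (dir_deriv (xdir k) R) z
          - (\<Sum>q\<in>UNIV. christoffel (g (fst z)) q j k (snd z) * dir_deriv (xdir q) R z)))"
proof -
  interpret smooth_metric_at W g z
    using assms by (simp add: smooth_metric_at_def smooth_metric_at_axioms_def)
  have T: "dir_deriv tdir (Gf i j) p = - 2 * rc i j p" if "p \<in> W" for i j p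
  proof -
    have "((\<lambda>s. g s (snd p) $ i $ j) has_real_derivative dir_deriv tdir (Gf i j) p) (at (fst p))"
      using has_real_derivative_line[OF smooth_g open_W, of "(0, snd p)" "fst p" tdir i j] that
      by (simp add: tdir_def)
    from DERIV_unique[OF this has_real_derivative_entry[OF flow[OF that], of i j]]
    show ?thesis by simp
  qed
  interpret fl: levi_civita_flow "\<lambda>i. germ_deriv (xdir i)" gG gH gom "germ_deriv tdir"
  proof
    show "derivation (germ_deriv (tdir :: 'n spacetime))" by (rule derivation_germ_deriv)
    show "germ_deriv tdir (germ_deriv (xdir i) x) = germ_deriv (xdir i) (germ_deriv tdir x)" for i :: 'n and x
      by (rule germ_deriv_commute)
    show "entrywise (germ_deriv tdir) gG = - 2 *\<^sub>R alg.ric"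
    proof -
      have "germ_deriv tdir (germ z (Gf i j)) = - 2 *\<^sub>R germ z (rc i j)" for i j
        unfolding germ_dir_deriv[OF smooth_g, symmetric] germ_scale[OF smooth_rc, symmetric]
        by (rule germ_cong[OF smooth_D[OF smooth_g] T])
      then show ?thesis by (simp add: vec_eq_iff alg_ric)
    qed
  qed
  have "germ_value (germ_deriv tdir alg.scal) = dir_deriv tdir R z"
    by (simp add: alg_scal germ_value smooth_intros R_def flip: germ_dir_deriv)
  moreover have "germ_value (germ_deriv (xdir j) (germ_deriv (xdir k) alg.scal)) = dir_deriv (xdir j) (dir_deriv (xdir k) R) z" for j k
    by (simp add: alg_scal germ_value smooth_intros R_def flip: germ_dir_deriv)
  moreover have "germ_value (germ_deriv (xdir k) alg.scal) = dir_deriv (xdir k) R z" for k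
    by (simp add: alg_scal germ_value smooth_intros R_def flip: germ_dir_deriv)
  ultimately show ?thesis
    using arg_cong[OF fl.T_scal, of germ_value]
    by (simp add: germ_value_algebra germ_value_sum matrix_matrix_mult_def alg_ric germ_value smooth_intros
        H_def Ric_def)
qed

text \<open>
  The pulled-back metric, its inverse and the transformed Christoffel symbols satisfy the axioms of the
  Levi-Civita connection; by uniqueness they are those of \<open>g2\<close>. The factor \<open>c\<close> does not change the
  connection, and divides the scalar curvature.
\<close>

theorem scalar_curvature_pullback:
  fixes \<phi> :: "real ^ 'n::finite \<Rightarrow> real ^ 'n" and g1 g2 :: "real ^ 'n \<Rightarrow> real ^ 'n ^ 'n"
  assumes U: "open U" "x \<in> U" "smooth_on U \<phi>" and V: "open V" "\<phi> ` U \<subseteq> V"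
    and g1: "\<And>i j. smooth_on V (\<lambda>y. g1 y $ i $ j)" "\<And>y. y \<in> V \<Longrightarrow> transpose (g1 y) = g1 y"
      "\<And>y. y \<in> V \<Longrightarrow> det (g1 y) \<noteq> 0"
    and J: "\<And>y. J y = matrix (frechet_derivative \<phi> (at y))" "\<And>y. y \<in> U \<Longrightarrow> det (J y) \<noteq> 0"
    and c: "c \<noteq> 0"
    and g2: "\<And>y. y \<in> U \<Longrightarrow> g2 y = c *\<^sub>R (transpose (J y) ** g1 (\<phi> y) ** J y)"
  shows "scalar_curvature g2 x = (1 / c) * scalar_curvature g1 (\<phi> x)"
proof -
  define W :: "'n spacetime set" where "W = UNIV \<times> U"
  define \<psi> :: "'n spacetime \<Rightarrow> 'n spacetime" where "\<psi> p = (fst p, \<phi> (snd p))" for p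
  have snd: "smooth_on S (\<lambda>p::'n spacetime. snd p)" and fst: "smooth_on S (\<lambda>p::'n spacetime. fst p)" for S
    by (intro smooth_on_bounded_linear[OF _ smooth_on_id] bounded_linear_snd bounded_linear_fst)+
  have lift: "smooth_on (UNIV \<times> A) (\<lambda>p::'n spacetime. f (snd p))" if "smooth_on A f" for A f
    by (rule smooth_on_compose[OF that snd]) auto
  have openW: "open W" and zW: "(0, x) \<in> W" using U by (auto simp: W_def open_Times)
  have \<phi>': "(\<phi> has_derivative frechet_derivative \<phi> (at y)) (at y)" if "y \<in> U" for y
    by (rule smooth_on_frechet_derivative[OF U(3,1) that])
  have J_nth: "J y $ a $ j = dir_deriv (axis j 1) (\<lambda>y. \<phi> y $ a) y" if "y \<in> U" for y a j
  proof -
    have "dir_deriv (axis j 1) (\<lambda>y. \<phi> y $ a) y = frechet_derivative \<phi> (at y) (axis j 1) $ a"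
      by (rule dir_deriv_eqI) (rule bounded_linear.has_derivative[OF bounded_linear_vec_nth \<phi>'[OF that]])
    then show ?thesis by (simp add: J matrix_def)
  qed
  have J_spacetime: "J (snd p) $ a $ j = dir_deriv (xdir j) (\<lambda>p. \<phi> (snd p) $ a) p" if "p \<in> W" for p a j
  proof -
    have "partial_deriv j (\<lambda>y. \<phi> y $ a) (snd p) = dir_deriv (xdir j) (\<lambda>p. \<phi> (snd p) $ a) p"
      using partial_deriv_slice[OF _ openW that, of "\<lambda>p. \<phi> (snd p) $ a" j] lift[OF smooth_on_vec_nth[OF U(3)]]
      by (simp add: W_def)
    then show ?thesis using that J_nth[of "snd p"] by (auto simp: W_def partial_deriv_def dir_deriv_def)
  qed
  have smJ: "smooth_on W (\<lambda>p. J (snd p) $ a $ j)" for a j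
  proof -
    have "smooth_on U (\<lambda>y. J y $ a $ j)"
      using smooth_on_dir_deriv[OF smooth_on_vec_nth[OF U(3)] U(1)]
      by (subst smooth_on_cong[OF J_nth])
    then show ?thesis unfolding W_def by (rule lift)
  qed
  have detJ: "det (J (snd p)) \<noteq> 0" if "p \<in> W" for p using that J(2) by (auto simp: W_def)
  have smap: "smooth_on W (\<lambda>p. \<phi> (snd p))"
    unfolding W_def by (rule smooth_on_compose[OF U(3) snd]) auto
  have sm\<psi>: "smooth_on W \<psi>"
    unfolding \<psi>_def[abs_def] by (intro smooth_on_Pair fst smap)
  have smg1: "smooth_on W (\<lambda>p. g1 (\<phi> (snd p)) $ i $ j)" for i j
    unfolding W_def by (intro lift) (rule smooth_on_compose[OF g1(1) U(3) V(2)])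
  have in_V: "\<phi> (snd p) \<in> V" if "p \<in> W" for p using that V by (auto simp: W_def)
  interpret W: open_nbhd W "(0, x)" using openW zW by unfold_locales
  have smTJ: "smooth_on W (\<lambda>p. transpose (J (snd p)) $ i $ j)" for i j
    using smJ by (simp add: transpose_def)
  have smTJG: "smooth_on W (\<lambda>p. (transpose (J (snd p)) ** g1 (\<phi> (snd p))) $ i $ j)" for i j
    by (rule W.smooth_matrix_mult[OF smTJ smg1])
  have smP: "smooth_on W (\<lambda>p. (transpose (J (snd p)) ** g1 (\<phi> (snd p)) ** J (snd p)) $ i $ j)" for i j
    by (rule W.smooth_matrix_mult[OF smTJG smJ])
  have g2W: "g2 (snd p) = c *\<^sub>R (transpose (J (snd p)) ** g1 (\<phi> (snd p)) ** J (snd p))" if "p \<in> W" for p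
    using that g2 by (auto simp: W_def)
  interpret m1: smooth_metric_at "UNIV \<times> V" "\<lambda>_. g1" "\<psi> (0, x)"
  proof
    show "open (UNIV \<times> V :: 'n spacetime set)" using V by (simp add: open_Times)
    show "\<psi> (0, x) \<in> UNIV \<times> V" using U V by (auto simp: \<psi>_def)
  qed (use g1 in \<open>auto intro: lift\<close>)
  interpret m2: smooth_metric_at W "\<lambda>_. g2" "(0, x)"
  proof
    show "smooth_on W (\<lambda>p. g2 (snd p) $ i $ j)" for i j
    proof (subst smooth_on_cong)
      show "g2 (snd p) $ i $ j = c * (transpose (J (snd p)) ** g1 (\<phi> (snd p)) ** J (snd p)) $ i $ j" if "p \<in> W" for p
        by (simp add: g2W[OF that])
      show "smooth_on W (\<lambda>p. c * (transpose (J (snd p)) ** g1 (\<phi> (snd p)) ** J (snd p)) $ i $ j)"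
        by (intro smooth_on_mult smooth_on_const smP)
    qed
    show "transpose (g2 (snd p)) = g2 (snd p)" if "p \<in> W" for p
      by (simp add: g2W[OF that] transpose_scalar matrix_transpose_mul g1(2)[OF in_V[OF that]] matrix_mul_assoc)
    show "det (g2 (snd p)) \<noteq> 0" if "p \<in> W" for p
      using c g1(3)[OF in_V[OF that]] detJ[OF that]
      by (simp add: g2W[OF that] det_mul det_transpose det_scaleR)
  qed (rule openW zW)+
  let ?P = "germ_pull (0::real, x) \<psi>"
  let ?J = "W.gmat (\<lambda>p. J (snd p))" and ?K = "W.gmat (\<lambda>p. matrix_inv (J (snd p)))"
  have zV: "\<psi> (0, x) \<in> UNIV \<times> V" by (rule m1.z_in)
  interpret pb: levi_civita_pullback "\<lambda>i. germ_deriv (xdir i)" m1.gG m1.gH m1.gom ?P "\<lambda>i. germ_deriv (xdir i)" ?J ?K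
  proof
    show "?P (a + b) = ?P a + ?P b" "?P (a * b) = ?P a * ?P b" "?P 1 = 1" for a b
      by (rule germ_pull_hom[OF sm\<psi> openW zW])+
    show "derivation (germ_deriv (xdir i))" for i :: 'n by (rule derivation_germ_deriv)
    show "germ_deriv (xdir i) (germ_deriv (xdir j) a) = germ_deriv (xdir j) (germ_deriv (xdir i) a)"
      for i j :: 'n and a by (rule germ_deriv_commute)
    show "?K ** ?J = mat 1" "?J ** ?K = mat 1"
      by (rule W.gmat_inverse[OF smJ detJ]; assumption)+
    show "germ_deriv (xdir i) (?J $ a $ j) = germ_deriv (xdir j) (?J $ a $ i)" for i j a
    proof -
      have "?J $ a $ j = germ_deriv (xdir j) (germ (0::real, x) (\<lambda>p. \<phi> (snd p) $ a))" for j
        unfolding W.gmat_nth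
        by (rule trans[OF W.germ_cong[OF smJ J_spacetime] W.germ_dir_deriv[OF smooth_on_vec_nth[OF smap]]])
      then show ?thesis by (simp add: germ_deriv_commute)
    qed
    show "germ_deriv (xdir i) (?P a) = (\<Sum>b\<in>UNIV. ?J $ b $ i * ?P (germ_deriv (xdir b) a))" for i a
    proof -
      obtain f A where f: "open A" "\<psi> (0, x) \<in> A" "smooth_on A f" "a = germ (\<psi> (0, x)) f" by (rule germ_cases)
      interpret A: open_nbhd A "\<psi> (0, x)" using f by unfold_locales
      define B where "B = W \<inter> \<psi> -` A"
      have "open B"
        unfolding B_def by (rule continuous_open_preimage[OF smooth_on_imp_continuous_on[OF sm\<psi>] openW f(1)])
      then interpret B: open_nbhd B "(0, x)" using zW f(2) by unfold_locales (auto simp: B_def)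
      have sm: "smooth_on B (\<lambda>p. h (\<psi> p))" if "smooth_on A h" for h :: "_ \<Rightarrow> real"
        by (rule smooth_on_compose[OF that]) (auto simp: B_def intro: smooth_on_subset[OF sm\<psi>])
      have smJB: "smooth_on B (\<lambda>p. J (snd p) $ b $ i)" for b i
        by (rule smooth_on_subset[OF smJ]) (simp add: B_def)
      note smD = smooth_on_dir_deriv[OF f(3,1)]
      have deriv: "dir_deriv (xdir i) (\<lambda>p. f (\<psi> p)) p = (\<Sum>b\<in>UNIV. J (snd p) $ b $ i * dir_deriv (xdir b) f (\<psi> p))"
        if "p \<in> B" for p
      proof -
        have pU: "snd p \<in> U" and pA: "\<psi> p \<in> A" using that by (auto simp: B_def W_def)
        have "(\<psi> has_derivative (\<lambda>v. (fst v, frechet_derivative \<phi> (at (snd p)) (snd v)))) (at p)"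
          unfolding \<psi>_def
          by (intro has_derivative_Pair has_derivative_fst has_derivative_ident
              has_derivative_compose[OF has_derivative_snd[OF has_derivative_ident] \<phi>'[OF pU]])
        from dir_deriv_compose[OF f(3,1) pA this]
        have "dir_deriv (xdir i) (\<lambda>p. f (\<psi> p)) p = dir_deriv (0, frechet_derivative \<phi> (at (snd p)) (axis i 1)) f (\<psi> p)"
          by (simp add: xdir_def)
        also have "(0, frechet_derivative \<phi> (at (snd p)) (axis i 1)) = (\<Sum>b\<in>UNIV. J (snd p) $ b $ i *\<^sub>R xdir b :: 'n spacetime)"
        proof -
          have "frechet_derivative \<phi> (at (snd p)) (axis i 1) = (\<Sum>b\<in>UNIV. J (snd p) $ b $ i *\<^sub>R axis b 1)"
            by (simp add: J matrix_def basis_expansion vec_eq_iff axis_def if_distrib cong: if_cong)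
          moreover have "(\<Sum>b\<in>UNIV. J (snd p) $ b $ i *\<^sub>R xdir b :: 'n spacetime) = (0, \<Sum>b\<in>UNIV. J (snd p) $ b $ i *\<^sub>R axis b 1)"
            by (simp add: xdir_def prod_eq_iff fst_sum snd_sum)
          ultimately show ?thesis by simp
        qed
        finally show ?thesis
          by (simp add: linear_sum[OF dir_deriv_linear[OF f(3,1) pA]] linear_scale[OF dir_deriv_linear[OF f(3,1) pA]])
      qed
      have "germ_deriv (xdir i) (?P a) = germ (0::real, x) (dir_deriv (xdir i) (\<lambda>p. f (\<psi> p)))"
        unfolding f(4) germ_pull_germ[OF f(3,1,2) sm\<psi> openW zW] by (rule B.germ_dir_deriv[OF sm[OF f(3)], symmetric])
      also have "\<dots> = germ (0::real, x) (\<lambda>p. \<Sum>b\<in>UNIV. J (snd p) $ b $ i * dir_deriv (xdir b) f (\<psi> p))"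
        by (rule B.germ_cong[OF smooth_on_dir_deriv[OF sm[OF f(3)] B.open_S] deriv])
      also have "\<dots> = (\<Sum>b\<in>UNIV. germ (0::real, x) (\<lambda>p. J (snd p) $ b $ i) * germ (0::real, x) (\<lambda>p. dir_deriv (xdir b) f (\<psi> p)))"
        by (simp add: B.germ_sum B.germ_mult smJB sm[OF smD] smooth_on_mult)
      also have "\<dots> = (\<Sum>b\<in>UNIV. ?J $ b $ i * ?P (germ_deriv (xdir b) a))"
        unfolding f(4) A.germ_dir_deriv[OF f(3), symmetric] germ_pull_germ[OF smD f(1,2) sm\<psi> openW zW] by simp
      finally show ?thesis .
    qed
  qed
  have PG: "entrywise ?P m1.gG = W.gmat (\<lambda>p. g1 (\<phi> (snd p)))"
    unfolding vec_eq_iff entrywise_nth m1.germ_components W.gmat_nth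
      germ_pull_germ[OF m1.smooth_g m1.open_W zV sm\<psi> openW zW] by (simp add: \<psi>_def)
  have G: "c *\<^sub>R pb.G' = m2.gG"
    unfolding pb.G'_def PG W.gmat_transpose W.gmat_mult[OF smTJ smg1] W.gmat_mult[OF smTJG smJ]
      W.gmat_scaleR[OF smP] m2.gG_def
    by (rule W.gmat_cong) (simp_all add: g2W smooth_on_mult smooth_on_const smP)
  have lc: "levi_civita (\<lambda>i. germ_deriv (xdir i)) m2.gG ((1 / c) *\<^sub>R pb.H') pb.om'"
    using pb.target.levi_civita_scale[OF c] unfolding G .
  interpret lc: levi_civita "\<lambda>i. germ_deriv (xdir i)" m2.gG "(1 / c) *\<^sub>R pb.H'" pb.om' by (rule lc)
  have H: "(1 / c) *\<^sub>R pb.H' = m2.gH"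
  proof -
    have "(1 / c) *\<^sub>R pb.H' = ((1 / c) *\<^sub>R pb.H') ** (m2.gG ** m2.gH)"
      by (simp only: m2.alg.GH matrix_mul_rid)
    then show ?thesis by (simp only: matrix_mul_assoc lc.HG matrix_mul_lid)
  qed
  have om: "pb.om' = m2.gom"
    by (rule levi_civita_unique[OF lc[unfolded H] m2.alg.levi_civita_axioms])
  have "m2.alg.scal = (1 / c) *\<^sub>R pb.target.scal"
    using pb.target.scal_scale[OF c] unfolding H om .
  also have "pb.target.scal = ?P m1.alg.scal" by (rule pb.scal_target)
  also have "\<dots> = germ (0::real, x) (\<lambda>p. scalar_curvature g1 (\<phi> (snd p)))"
    unfolding m1.alg_scal germ_pull_germ[OF m1.smooth_scf m1.open_W zV sm\<psi> openW zW] by (simp add: \<psi>_def)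
  finally have "germ_value m2.alg.scal = germ_value ((1 / c) *\<^sub>R germ (0::real, x) (\<lambda>p. scalar_curvature g1 (\<phi> (snd p))))"
    by (rule arg_cong)
  moreover have "smooth_on W (\<lambda>p. scalar_curvature g1 (\<phi> (snd p)))"
  proof -
    have "smooth_on W (\<lambda>p. scalar_curvature g1 (snd (\<psi> p)))"
      by (rule smooth_on_compose[OF m1.smooth_scf sm\<psi>], rule image_subsetI) (simp add: \<psi>_def in_V)
    then show ?thesis by (simp add: \<psi>_def)
  qed
  ultimately show ?thesis
    by (simp add: germ_value_algebra m2.alg_scal m2.smooth_scf W.germ_value)
qed

section \<open>Positive definite matrices\<close>

definition pos_def :: "real ^ 'n ^ 'n \<Rightarrow> bool" where
  "pos_def G \<longleftrightarrow> transpose G = G \<and> (\<forall>v. v \<noteq> 0 \<longrightarrow> v \<bullet> (G *v v) > 0)"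

lemma pos_def_sym: "pos_def G \<Longrightarrow> transpose G = G"
  by (simp add: pos_def_def)

lemma pos_def_inner_commute: "pos_def G \<Longrightarrow> v \<bullet> (G *v w) = w \<bullet> (G *v v)"
  by (metis dot_lmul_matrix inner_commute pos_def_sym transpose_matrix_vector)

text \<open>
  The Gram--Schmidt process for the inner product defined by \<open>G\<close>. Consequently \<open>G\<^sup>-\<^sup>1 = P P\<^sup>T\<close>, which
  turns traces with the inverse metric into sums over the columns of \<open>P\<close>.
\<close>

lemma pos_def_orthonormal:
  fixes G :: "real ^ 'n ^ 'n"
  assumes G: "pos_def G"
  obtains P :: "real ^ 'n ^ 'n" where "transpose P ** G ** P = mat 1"
proof -
  have "\<exists>p::'n \<Rightarrow> real ^ 'n. \<forall>i\<in>S. \<forall>j\<in>S. p i \<bullet> (G *v p j) = (if i = j then 1 else 0)" for S :: "'n set"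
  proof (induction S rule: finite_induct[OF finite])
    case 1
    then show ?case by simp
  next
    case (2 k S)
    then obtain p where p: "\<And>i j. i \<in> S \<Longrightarrow> j \<in> S \<Longrightarrow> p i \<bullet> (G *v p j) = (if i = j then 1 else 0)"
      by blast
    have "dim ((\<lambda>i. G *v p i) ` S) \<le> card ((\<lambda>i. G *v p i) ` S)"
      by (rule dim_le_card') (simp add: finite)
    also have "\<dots> \<le> card S" by (rule card_image_le) simp
    also have "\<dots> < CARD('n)"
      using 2(2) by (metis UNIV_I finite psubsetI psubset_card_mono subset_UNIV)
    finally have "dim ((\<lambda>i. G *v p i) ` S) < DIM(real ^ 'n)" by simp
    then obtain q where q: "q \<noteq> 0" "\<And>y. y \<in> span ((\<lambda>i. G *v p i) ` S) \<Longrightarrow> orthogonal q y"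
      by (rule orthogonal_to_subspace_exists) blast
    have ortho: "q \<bullet> (G *v p i) = 0" if "i \<in> S" for i
      using q(2)[OF span_base] that by (auto simp: orthogonal_def)
    have pos: "q \<bullet> (G *v q) > 0" using G q(1) by (simp add: pos_def_def)
    define r where "r = (1 / sqrt (q \<bullet> (G *v q))) *\<^sub>R q"
    have rr: "r \<bullet> (G *v r) = 1"
      using pos by (simp add: r_def scaleR_matrix_vector_assoc[symmetric] matrix_vector_mult_scaleR)
    have rp: "r \<bullet> (G *v p i) = 0" "p i \<bullet> (G *v r) = 0" if "i \<in> S" for i
      using ortho[OF that] pos_def_inner_commute[OF G, of "p i" r] by (simp_all add: r_def)
    have "(p(k := r)) i \<bullet> (G *v (p(k := r)) j) = (if i = j then 1 else 0)"
      if "i \<in> insert k S" "j \<in> insert k S" for i j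
      using that p rr rp 2(2) by auto
    then show ?case by blast
  qed
  then obtain p :: "'n \<Rightarrow> real ^ 'n" where p: "\<And>i j. p i \<bullet> (G *v p j) = (if i = j then 1 else 0)"
    by (metis UNIV_I)
  define P where "P = (\<chi> a i. p i $ a)"
  have "(transpose P ** (G ** P)) $ i $ j = p i \<bullet> (G *v p j)" for i j
    by (simp add: P_def matrix_matrix_mult_def transpose_def inner_vec_def matrix_vector_mult_def)
  then have "transpose P ** (G ** P) = mat 1"
    by (simp add: vec_eq_iff p mat_def)
  then show thesis using that by (simp add: matrix_mul_assoc)
qed

lemma pos_def_inverse_factor:
  fixes G :: "real ^ 'n ^ 'n"
  assumes G: "pos_def G"
  obtains P :: "real ^ 'n ^ 'n" where "matrix_inv G = P ** transpose P" "transpose P ** G ** P = mat 1" "G ** P ** transpose P = mat 1"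
proof -
  obtain P :: "real ^ 'n ^ 'n" where P: "transpose P ** G ** P = mat 1" using pos_def_orthonormal[OF G] .
  then have "(G ** P) ** transpose P = mat 1"
    using matrix_left_right_inverse[of "transpose P" "G ** P"] by (simp add: matrix_mul_assoc)
  then have 1: "G ** (P ** transpose P) = mat 1" by (simp add: matrix_mul_assoc)
  then have 2: "(P ** transpose P) ** G = mat 1" by (simp add: matrix_left_right_inverse)
  show thesis
    by (rule that[of P]) (use P 1 matrix_inv_eqI[OF 1 2] in \<open>simp_all add: matrix_mul_assoc\<close>)
qed

lemma pos_def_det: "pos_def G \<Longrightarrow> det G > 0" for G :: "real ^ 'n ^ 'n"
proof -
  assume G: "pos_def G"
  obtain P :: "real ^ 'n ^ 'n" where P: "transpose P ** G ** P = mat 1" using pos_def_orthonormal[OF G] .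
  have "det (transpose P ** G ** P) = 1" by (simp add: P)
  then have *: "(det P)\<^sup>2 * det G = 1" by (simp add: det_mul power2_eq_square mult_ac)
  then have "(det P)\<^sup>2 > 0" by (metis mult_zero_left zero_less_power2 zero_neq_one zero_power2)
  then show ?thesis using * by (metis zero_less_mult_pos zero_less_one)
qed

lemma trace_factor:
  fixes A P :: "real ^ 'n ^ 'n"
  shows "(\<Sum>j\<in>UNIV. \<Sum>k\<in>UNIV. (P ** transpose P) $ j $ k * A $ j $ k)
    = (\<Sum>l\<in>UNIV. column l P \<bullet> (A *v column l P))"
proof -
  have "(\<Sum>j\<in>UNIV. \<Sum>k\<in>UNIV. (P ** transpose P) $ j $ k * A $ j $ k)
      = (\<Sum>j\<in>UNIV. \<Sum>k\<in>UNIV. \<Sum>l\<in>UNIV. P $ j $ l * (A $ j $ k * P $ k $ l))"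
    by (simp add: matrix_matrix_mult_def transpose_def sum_distrib_right sum_distrib_left mult_ac)
  also have "\<dots> = (\<Sum>j\<in>UNIV. \<Sum>l\<in>UNIV. \<Sum>k\<in>UNIV. P $ j $ l * (A $ j $ k * P $ k $ l))"
    by (rule sum.cong[OF refl], rule sum.swap)
  also have "\<dots> = (\<Sum>l\<in>UNIV. \<Sum>j\<in>UNIV. \<Sum>k\<in>UNIV. P $ j $ l * (A $ j $ k * P $ k $ l))"
    by (rule sum.swap)
  finally show ?thesis
    by (simp add: inner_vec_def matrix_vector_mult_def column_def sum_distrib_left)
qed

lemma trace_pos_def_nonneg:
  fixes A G :: "real ^ 'n ^ 'n"
  assumes "pos_def G" "\<And>v. v \<bullet> (A *v v) \<ge> 0"
  shows "(\<Sum>j\<in>UNIV. \<Sum>k\<in>UNIV. matrix_inv G $ j $ k * A $ j $ k) \<ge> 0"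
proof -
  obtain P :: "real ^ 'n ^ 'n" where "matrix_inv G = P ** transpose P" using pos_def_inverse_factor[OF assms(1)] by metis
  then show ?thesis by (simp add: trace_factor assms(2) sum_nonneg)
qed

text \<open>
  In a \<open>G\<close>-orthonormal frame \<open>N - r\<^sup>2 / n\<close> is the sum of the squares of the entries of the trace-free
  part of \<open>S\<close>.
\<close>

lemma norm_sq_minus_trace:
  fixes G S :: "real ^ 'n ^ 'n"
  assumes G: "pos_def G" and S: "transpose S = S"
  defines "H \<equiv> matrix_inv G"
  defines "r \<equiv> (\<Sum>j\<in>UNIV. \<Sum>k\<in>UNIV. H $ j $ k * S $ j $ k)"
  defines "N \<equiv> (\<Sum>j\<in>UNIV. \<Sum>k\<in>UNIV. (H ** S ** H) $ j $ k * S $ j $ k)"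
  shows "r\<^sup>2 / CARD('n) \<le> N"
    and "N = r\<^sup>2 / CARD('n) \<Longrightarrow> S = (r / CARD('n)) *\<^sub>R G"
proof -
  obtain P :: "real ^ 'n ^ 'n" where P: "H = P ** transpose P" "transpose P ** G ** P = mat 1" "G ** P ** transpose P = mat 1"
    unfolding H_def using pos_def_inverse_factor[OF G] by metis
  define B where "B = transpose P ** S ** P"
  have S_swap: "S $ j $ k = S $ k $ j" for j k
    using arg_cong[OF S, of "\<lambda>M. M $ k $ j"] by (simp add: transpose_def)
  have pair: "(\<Sum>j\<in>UNIV. \<Sum>k\<in>UNIV. M $ j $ k * S $ j $ k) = trace (M ** S)" for M
    by (simp add: trace_def matrix_matrix_mult_def S_swap)
  have "trace (H ** S) = trace (P ** (transpose P ** S))" by (simp add: P matrix_mul_assoc)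
  also have "\<dots> = trace B" unfolding B_def by (rule trace_mul_sym)
  finally have r: "r = trace B" by (simp add: r_def pair)
  have "trace (H ** S ** H ** S) = trace (P ** (transpose P ** S ** P ** transpose P ** S))"
    by (simp add: P matrix_mul_assoc)
  also have "\<dots> = trace (B ** B)" unfolding trace_mul_sym[of P] by (simp add: B_def matrix_mul_assoc)
  finally have N: "N = trace (B ** B)" by (simp add: N_def pair)
  have B_sym: "transpose B = B"
    by (simp add: B_def matrix_transpose_mul S matrix_mul_assoc)
  have "B $ j $ k = B $ k $ j" for j k
    using arg_cong[OF B_sym, of "\<lambda>M. M $ k $ j"] by (simp add: transpose_def)
  then have N2: "N = (\<Sum>a\<in>UNIV. \<Sum>b\<in>UNIV. (B $ a $ b)\<^sup>2)"
    by (simp add: N trace_def matrix_matrix_mult_def power2_eq_square)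
  let ?n = "real CARD('n)"
  have n: "?n > 0" by simp
  let ?E = "\<Sum>a\<in>UNIV. \<Sum>b\<in>UNIV. (B $ a $ b - (if a = b then r / ?n else 0))\<^sup>2"
  have E: "?E = N - r\<^sup>2 / ?n"
  proof -
    have "(B $ a $ b - (if a = b then r / ?n else 0))\<^sup>2
        = (B $ a $ b)\<^sup>2 + (if a = b then (r / ?n)\<^sup>2 - 2 * (r / ?n) * B $ a $ a else 0)" for a b
      by (simp add: power2_diff)
    then have "?E = N + (?n * (r / ?n)\<^sup>2 - 2 * (r / ?n) * (\<Sum>a\<in>UNIV. B $ a $ a))"
      by (simp add: sum.distrib N2 sum_subtractf sum_distrib_left)
    also have "(\<Sum>a\<in>UNIV. B $ a $ a) = r" by (simp add: r trace_def)
    finally show ?thesis using n by (simp add: power2_eq_square field_simps)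
  qed
  have "?E \<ge> 0" by (intro sum_nonneg) simp
  then show "r\<^sup>2 / ?n \<le> N" using E by simp
  assume "N = r\<^sup>2 / ?n"
  then have "?E = 0" using E by simp
  then have "(\<Sum>b\<in>UNIV. (B $ a $ b - (if a = b then r / ?n else 0))\<^sup>2) = 0" for a
    by (subst (asm) sum_nonneg_eq_0_iff) (auto intro: sum_nonneg)
  then have "(B $ a $ b - (if a = b then r / ?n else 0))\<^sup>2 = 0" for a b
    by (subst (asm) sum_nonneg_eq_0_iff) auto
  then have "B = (r / ?n) *\<^sub>R mat 1" by (auto simp: vec_eq_iff mat_def)
  then have "G ** P ** B ** (transpose P ** G) = (r / ?n) *\<^sub>R (G ** P ** transpose P ** G)"
    by (simp add: matrix_mul_scaleR matrix_mul_assoc)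
  moreover have "G ** P ** B ** (transpose P ** G) = (G ** P ** transpose P) ** S ** (P ** (transpose P ** G))"
    by (simp add: B_def matrix_mul_assoc)
  moreover have "P ** (transpose P ** G) = mat 1"
    using P(3) matrix_left_right_inverse[of G "P ** transpose P"] by (simp add: matrix_mul_assoc)
  ultimately show "S = (r / ?n) *\<^sub>R G" by (simp add: P(3))
qed

section \<open>The derivative of a determinant\<close>

lemma permutes_two_moved:
  assumes "p permutes UNIV" "p \<noteq> id"
  shows "\<exists>j. j \<noteq> i \<and> p j \<noteq> j"
proof (rule ccontr)
  assume "\<not> ?thesis"
  then have *: "p j = j" if "j \<noteq> i" for j using that by blast
  have "p i = i"
  proof (rule ccontr)
    assume "p i \<noteq> i"
    then have "p (p i) = p i" using * by blast
    then show False using assms(1) \<open>p i \<noteq> i\<close> by (metis permutes_inv_o(2) comp_apply id_apply)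
  qed
  then have "p j = j" for j using * by (cases "j = i") auto
  then show False using assms(2) by (auto simp: fun_eq_iff)
qed

text \<open>
  In the derivative of the Leibniz formula every summand keeps all but one of its factors. At the
  identity matrix these vanish unless the permutation is the identity, because a permutation other than
  the identity moves at least two points.
\<close>

lemma has_real_derivative_det_at_one:
  fixes N :: "real \<Rightarrow> real ^ 'n ^ 'n"
  assumes N: "\<And>i j. ((\<lambda>s. N s $ i $ j) has_real_derivative C $ i $ j) (at t within S)" and t: "N t = mat 1"
  shows "((\<lambda>s. det (N s)) has_real_derivative trace C) (at t within S)"
proof -
  let ?d = "\<lambda>p. \<Sum>i\<in>UNIV. C $ i $ p i * (\<Prod>j\<in>UNIV - {i}. N t $ j $ p j)"
  have prod: "((\<lambda>s. \<Prod>i\<in>UNIV. N s $ i $ p i) has_real_derivative ?d p) (at t within S)" for p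
  proof -
    have "((\<lambda>s. \<Prod>i\<in>UNIV. N s $ i $ p i) has_derivative
        (\<lambda>y. \<Sum>i\<in>UNIV. (C $ i $ p i * y) * (\<Prod>j\<in>UNIV - {i}. N t $ j $ p j))) (at t within S)"
      using N[unfolded has_field_derivative_def] by (rule has_derivative_prod)
    moreover have "(\<lambda>y. \<Sum>i\<in>UNIV. (C $ i $ p i * y) * (\<Prod>j\<in>UNIV - {i}. N t $ j $ p j)) = (*) (?d p)"
      by (rule ext) (simp add: sum_distrib_left mult_ac)
    ultimately show ?thesis
      by (simp add: has_field_derivative_def)
  qed
  have "((\<lambda>s. det (N s)) has_real_derivative (\<Sum>p | p permutes UNIV. of_int (sign p) * ?d p)) (at t within S)"
    unfolding det_def by (intro DERIV_sum DERIV_cmult prod)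
  moreover have "(\<Sum>p | p permutes (UNIV::'n set). of_int (sign p) * ?d p) = trace C"
  proof -
    have "?d p = (if p = id then trace C else 0)" if "p permutes UNIV" for p
    proof (cases "p = id")
      case True
      then show ?thesis by (simp add: t mat_def trace_def)
    next
      case False
      note p = that
      have "(\<Prod>j\<in>UNIV - {i}. N t $ j $ p j) = 0" for i
      proof -
        obtain j where "j \<noteq> i" "p j \<noteq> j" using permutes_two_moved[OF p False] by blast
        then show ?thesis by (intro prod_zero) (auto intro!: bexI[of _ j] simp: t mat_def)
      qed
      then show ?thesis using False by (simp only: mult_zero_right sum.neutral_const if_False)
    qed
    then have "(\<Sum>p | p permutes (UNIV::'n set). of_int (sign p) * ?d p)
        = (\<Sum>p | p permutes (UNIV::'n set). if p = id then trace C else 0)"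
      by (intro sum.cong) (auto simp: sign_id)
    then show ?thesis by (simp add: permutes_id finite_permutations)
  qed
  ultimately show ?thesis by simp
qed

lemma has_real_derivative_det:
  fixes M :: "real \<Rightarrow> real ^ 'n ^ 'n"
  assumes M: "(M has_vector_derivative M') (at t within S)" and det: "det (M t) \<noteq> 0"
  shows "((\<lambda>s. det (M s)) has_real_derivative det (M t) * trace (matrix_inv (M t) ** M')) (at t within S)"
proof -
  let ?H = "matrix_inv (M t)"
  have inv: "invertible (M t)" using det by (simp add: invertible_det_nz)
  note comp = has_real_derivative_entry[OF M]
  have "((\<lambda>s. det (?H ** M s)) has_real_derivative trace (?H ** M')) (at t within S)"
  proof (rule has_real_derivative_det_at_one)
    show "((\<lambda>s. (?H ** M s) $ i $ j) has_real_derivative (?H ** M') $ i $ j) (at t within S)" for i j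
      unfolding matrix_matrix_mult_def by (simp, intro DERIV_sum DERIV_cmult comp)
  qed (simp add: matrix_inv_mult inv)
  from DERIV_cmult[OF this, of "det (M t)"]
  have "((\<lambda>s. det (M t) * (det ?H * det (M s))) has_real_derivative det (M t) * trace (?H ** M')) (at t within S)"
    by (simp add: det_mul)
  moreover have "det (M t) * (det ?H * x) = x" for x
  proof -
    have "det (M t ** ?H) = 1" by (simp add: matrix_inv_mult inv)
    then show ?thesis by (simp add: det_mul flip: mult.assoc)
  qed
  ultimately show ?thesis by simp
qed

section \<open>The second derivative test\<close>

lemma second_derivative_at_min:
  fixes f :: "'e::euclidean_space \<Rightarrow> real"
  assumes f: "smooth_on S f" "open S" "x \<in> S" and min: "\<And>s. x + s *\<^sub>R v \<in> S \<Longrightarrow> f x \<le> f (x + s *\<^sub>R v)"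
  shows "dir_deriv v f x = 0" "dir_deriv v (dir_deriv v f) x \<ge> 0"
proof -
  note der = has_real_derivative_line[OF _ f(2), where y = x and u = v]
  have "open ((\<lambda>s. x + s *\<^sub>R v) -` S)"
    by (intro open_vimage f) (intro continuous_intros)
  moreover have "0 \<in> (\<lambda>s. x + s *\<^sub>R v) -` S" using f(3) by simp
  ultimately obtain d where d: "d > 0" "ball 0 d \<subseteq> (\<lambda>s. x + s *\<^sub>R v) -` S"
    by (rule openE)
  have inS: "x + s *\<^sub>R v \<in> S" if "\<bar>s\<bar> < d" for s
    using d(2) that by (auto simp: subset_iff)
  show zero: "dir_deriv v f x = 0"
    using DERIV_local_min[OF der[OF f(1), of 0] d(1)] min inS f(3) by auto
  show "dir_deriv v (dir_deriv v f) x \<ge> 0"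
  proof (rule ccontr)
    assume "\<not> ?thesis"
    then have "\<exists>e>0. \<forall>h>0. h < e \<longrightarrow> dir_deriv v f (x + (0 + h) *\<^sub>R v) < dir_deriv v f (x + 0 *\<^sub>R v)"
      using der[OF smooth_on_dir_deriv[OF f(1,2)], of 0 v] f(3) by (intro DERIV_neg_dec_right) auto
    then obtain e where e: "e > 0" "\<And>h. 0 < h \<Longrightarrow> h < e \<Longrightarrow> dir_deriv v f (x + h *\<^sub>R v) < 0"
      using zero by auto
    define s where "s = min d e / 2"
    have s: "0 < s" "s < d" "s < e" using d e by (auto simp: s_def)
    have "\<exists>u. u > 0 \<and> u < s \<and> f (x + s *\<^sub>R v) - f (x + 0 *\<^sub>R v) = (s - 0) * dir_deriv v f (x + u *\<^sub>R v)"
      using s by (intro MVT2 der f inS) auto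
    then obtain u where u: "0 < u" "u < s" "f (x + s *\<^sub>R v) - f x = s * dir_deriv v f (x + u *\<^sub>R v)"
      by auto
    then have "f (x + s *\<^sub>R v) < f x"
      using mult_pos_neg[OF s(1) e(2)[of u]] s by simp
    then show False using min[of s] inS[of s] s by simp
  qed
qed

section \<open>Compact manifolds as finite unions of coordinate balls\<close>

text \<open>
  The topological properties of an atlas on a compact space. The coordinate maps are separated from the
  charts so that they can later be composed with a linear isomorphism.
\<close>

locale compact_atlas =
  fixes X :: "'m topology" and C :: "'c set" and dm :: "'c \<Rightarrow> 'm set"
    and co :: "'c \<Rightarrow> 'm \<Rightarrow> 'e::euclidean_space"
  assumes compact: "compact_space X"
    and dm_open: "\<And>c. c \<in> C \<Longrightarrow> openin X (dm c)"
    and dm_cover: "topspace X = (\<Union>c\<in>C. dm c)"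
    and co_inj: "\<And>c. c \<in> C \<Longrightarrow> inj_on (co c) (dm c)"
    and co_open: "\<And>c U. c \<in> C \<Longrightarrow> openin X U \<Longrightarrow> U \<subseteq> dm c \<Longrightarrow> open (co c ` U)"
    and co_cont: "\<And>c V. c \<in> C \<Longrightarrow> open V \<Longrightarrow> openin X {p \<in> dm c. co c p \<in> V}"
begin

text \<open>
  A prescribed point may be taken as the centre of the ball with index \<open>0\<close>.
\<close>

lemma finite_ball_cover:
  assumes p0: "c0 \<in> C" "p0 \<in> dm c0"
  obtains N :: nat and c :: "nat \<Rightarrow> 'c" and x :: "nat \<Rightarrow> 'e" and r :: "nat \<Rightarrow> real"
  where "c 0 = c0" "x 0 = co c0 p0" "\<And>i. c i \<in> C" "\<And>i. r i > 0"
    "\<And>i. cball (x i) (r i) \<subseteq> co (c i) ` dm (c i)"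
    "topspace X = (\<Union>i\<le>N. {p \<in> dm (c i). co (c i) p \<in> ball (x i) (r i)})"
proof -
  define Q where "Q p c r \<longleftrightarrow> c \<in> C \<and> p \<in> dm c \<and> r > 0 \<and> cball (co c p) r \<subseteq> co c ` dm c \<and> (p = p0 \<longrightarrow> c = c0)"
    for p c and r :: real
  have "\<exists>c r. Q p c r" if p: "p \<in> topspace X" for p
  proof -
    obtain c where c: "c \<in> C" "p \<in> dm c" "p = p0 \<longrightarrow> c = c0"
      using p p0 dm_cover by blast
    have "open (co c ` dm c)" using c by (intro co_open dm_open) auto
    then obtain r where "r > 0" "cball (co c p) r \<subseteq> co c ` dm c"
      using c(2) unfolding open_contains_cball by blast
    then show ?thesis using c unfolding Q_def by blast
  qed
  then obtain cf rf where "\<And>p. p \<in> topspace X \<Longrightarrow> Q p (cf p) (rf p)"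
    by metis
  then have cr: "\<And>p. p \<in> topspace X \<Longrightarrow> cf p \<in> C" "\<And>p. p \<in> topspace X \<Longrightarrow> p \<in> dm (cf p)"
    "\<And>p. p \<in> topspace X \<Longrightarrow> rf p > 0"
    "\<And>p. p \<in> topspace X \<Longrightarrow> cball (co (cf p) p) (rf p) \<subseteq> co (cf p) ` dm (cf p)"
    "p0 \<in> topspace X \<Longrightarrow> cf p0 = c0"
    unfolding Q_def by blast+
  define U where "U p = {q \<in> dm (cf p). co (cf p) q \<in> ball (co (cf p) p) (rf p)}" for p
  have p0': "p0 \<in> topspace X" using p0 dm_cover by blast
  have U: "openin X (U p)" "p \<in> U p" if "p \<in> topspace X" for p
    using that cr co_cont[OF cr(1)[OF that] open_ball] by (auto simp: U_def)
  obtain \<F> where \<F>: "finite \<F>" "\<F> \<subseteq> U ` topspace X" "topspace X \<subseteq> \<Union>\<F>"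
    using compactinD[of X "topspace X" "U ` topspace X"] compact U unfolding compact_space_def by blast
  obtain F where "F \<subseteq> topspace X" "finite F" "\<F> = U ` F"
    using finite_subset_image[OF \<F>(1,2)] by blast
  then have F: "finite F" "F \<subseteq> topspace X" "topspace X \<subseteq> \<Union>(U ` F)"
    using \<F>(3) by (simp_all only:)
  obtain ps where ps: "set ps = F" using F(1) finite_list by blast
  define q where "q i = (if i = 0 \<or> i > length ps then p0 else ps ! (i - 1))" for i
  have q: "q i \<in> topspace X" for i
    using p0' nth_mem[of "i - 1" ps] F(2) ps
    by (cases "i = 0 \<or> i > length ps") (auto simp: q_def)
  show thesis
  proof (rule that[of "\<lambda>i. cf (q i)" "\<lambda>i. co (cf (q i)) (q i)" "\<lambda>i. rf (q i)" "length ps"])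
    show "cf (q 0) = c0" "co (cf (q 0)) (q 0) = co c0 p0" using cr(5)[OF p0'] by (simp_all add: q_def)
    have "topspace X = (\<Union>i\<le>length ps. U (q i))"
    proof
      show "topspace X \<subseteq> (\<Union>i\<le>length ps. U (q i))"
      proof
        fix p assume "p \<in> topspace X"
        then obtain k where "k < length ps" "p \<in> U (ps ! k)"
          using F(3) ps by (metis UN_E in_mono in_set_conv_nth)
        then have "Suc k \<le> length ps" "p \<in> U (q (Suc k))" by (simp_all add: q_def)
        then show "p \<in> (\<Union>i\<le>length ps. U (q i))" by blast
      qed
      show "(\<Union>i\<le>length ps. U (q i)) \<subseteq> topspace X"
        using U(1)[OF q] by (auto dest: openin_subset)
    qed
    then show "topspace X = (\<Union>i\<le>length ps. {p \<in> dm (cf (q i)). co (cf (q i)) p \<in> ball (co (cf (q i)) (q i)) (rf (q i))})"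
      by (simp only: U_def)
  qed (use cr q in auto)
qed

lemma attains_min:
  fixes F :: "real \<Rightarrow> 'm \<Rightarrow> real"
  assumes cont: "\<And>c. c \<in> C \<Longrightarrow> continuous_on ({a..b} \<times> co c ` dm c) (\<lambda>(t, x). F t (inv_into (dm c) (co c) x))"
    and ne: "topspace X \<noteq> {}" and ab: "a \<le> b"
  shows "\<exists>t\<in>{a..b}. \<exists>p\<in>topspace X. \<forall>s\<in>{a..b}. \<forall>q\<in>topspace X. F t p \<le> F s q"
proof -
  obtain c0 p0 where p0: "c0 \<in> C" "p0 \<in> dm c0" using ne dm_cover by blast
  obtain N c x r where c: "\<And>i::nat. c i \<in> C" "\<And>i. r i > 0"
    "\<And>i. cball (x i) (r i) \<subseteq> co (c i) ` dm (c i)"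
    "topspace X = (\<Union>i\<le>N. {p \<in> dm (c i). co (c i) p \<in> ball (x i) (r i)})"
    by (rule finite_ball_cover[OF p0]) blast
  have "\<exists>t p. t \<in> {a..b} \<and> p \<in> topspace X \<and>
      (\<forall>s\<in>{a..b}. \<forall>q\<in>dm (c i). co (c i) q \<in> ball (x i) (r i) \<longrightarrow> F t p \<le> F s q)" for i
  proof -
    let ?K = "{a..b} \<times> cball (x i) (r i)" and ?f = "\<lambda>(t, x). F t (inv_into (dm (c i)) (co (c i)) x)"
    have "continuous_on ?K ?f"
      using c(3) by (intro continuous_on_subset[OF cont[OF c(1)]]) auto
    moreover have "compact ?K" by (intro compact_Times compact_Icc compact_cball)
    moreover have "?K \<noteq> {}" using ab c(2)[of i] by auto
    ultimately obtain m where m: "m \<in> ?K" "\<And>y. y \<in> ?K \<Longrightarrow> ?f m \<le> ?f y"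
      using continuous_attains_inf by metis
    obtain t u where tu: "m = (t, u)" by (cases m)
    obtain p where p: "p \<in> dm (c i)" "co (c i) p = u" using m(1) c(3) tu by (auto simp: subset_iff)
    have "F t p \<le> F s q" if "s \<in> {a..b}" "q \<in> dm (c i)" "co (c i) q \<in> ball (x i) (r i)" for s q
      using m(2)[of "(s, co (c i) q)"] that p tu co_inj[OF c(1)] by auto
    moreover have "t \<in> {a..b}" "p \<in> topspace X" using m(1) tu p(1) c(1) dm_cover by auto
    ultimately show ?thesis by blast
  qed
  then obtain t p where tp: "\<And>i. t i \<in> {a..b}" "\<And>i. p i \<in> topspace X"
    "\<And>i s q. s \<in> {a..b} \<Longrightarrow> q \<in> dm (c i) \<Longrightarrow> co (c i) q \<in> ball (x i) (r i) \<Longrightarrow> F (t i) (p i) \<le> F s q"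
    by metis
  obtain k where k: "k \<le> N" "\<And>i. i \<le> N \<Longrightarrow> F (t k) (p k) \<le> F (t i) (p i)"
    using ex_min_if_finite[of "(\<lambda>i. F (t i) (p i)) ` {..N}"] by (auto simp: not_less)
  show ?thesis
  proof (rule bexI[OF bexI[OF _ tp(2)[of k]] tp(1)[of k]], intro ballI)
    fix s q assume s: "s \<in> {a..b}" "q \<in> topspace X"
    then obtain i where i: "i \<le> N" "q \<in> dm (c i)" "co (c i) q \<in> ball (x i) (r i)" using c(4) by blast
    show "F (t k) (p k) \<le> F s q"
      using k(2)[OF i(1)] tp(3)[OF s(1) i(2,3)] by linarith
  qed
qed

end

section \<open>Diffeomorphisms that do not increase volume\<close>

lemma absolutely_integrable_on_compact_subset:
  fixes f :: "'e::euclidean_space \<Rightarrow> real"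
  assumes "compact K" "continuous_on K f" "S \<subseteq> K" "S \<in> sets lebesgue"
  shows "f absolutely_integrable_on S"
proof -
  have "bounded (f ` K)" using assms by (simp add: compact_continuous_image compact_imp_bounded)
  then obtain B where B: "\<And>x. x \<in> K \<Longrightarrow> norm (f x) \<le> B" unfolding bounded_iff by blast
  have "S \<in> lmeasurable"
    using assms bounded_subset[OF compact_imp_bounded[OF assms(1)]] bounded_set_imp_lmeasurable by blast
  then have "(\<lambda>_. B) integrable_on S" by (rule integrable_on_const)
  moreover have "f \<in> borel_measurable (lebesgue_on S)"
    using assms by (intro continuous_imp_measurable_on_sets_lebesgue continuous_on_subset[OF assms(2)])
  ultimately show ?thesis
    using assms B by (intro measurable_bounded_by_integrable_imp_absolutely_integrable[where g = "\<lambda>_. B"]) auto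
qed

text \<open>
  A real-valued integrand is regarded as a vector with one component.
\<close>

lemma integral_change_of_variables_real:
  fixes f :: "real ^ 'k::{finite,wellorder} \<Rightarrow> real" and g :: "real ^ 'k::_ \<Rightarrow> real ^ 'k::_"
  assumes S: "S \<in> sets lebesgue" and der: "\<And>x. x \<in> S \<Longrightarrow> (g has_derivative g' x) (at x within S)"
    and inj: "inj_on g S" and f: "(\<lambda>x. \<bar>det (matrix (g' x))\<bar> * f (g x)) absolutely_integrable_on S"
  shows "f absolutely_integrable_on g ` S"
    "integral (g ` S) f = integral S (\<lambda>x. \<bar>det (matrix (g' x))\<bar> * f (g x))"
proof -
  let ?f = "\<lambda>x. (\<chi> i. f x) :: real ^ 1"
  have f1: "(\<lambda>x. \<bar>det (matrix (g' x))\<bar> *\<^sub>R ?f (g x)) absolutely_integrable_on S"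
    using f by (simp add: absolutely_integrable_on_1_iff)
  then have "?f absolutely_integrable_on g ` S"
    by (simp only: absolutely_integrable_change_of_variables[OF S der inj])
  then show "f absolutely_integrable_on g ` S"
    by (simp add: absolutely_integrable_on_1_iff)
  have "integral (g ` S) ?f = integral S (\<lambda>x. \<bar>det (matrix (g' x))\<bar> *\<^sub>R ?f (g x))"
    using f1 by (intro integral_change_of_variables[OF S der inj]) auto
  then show "integral (g ` S) f = integral S (\<lambda>x. \<bar>det (matrix (g' x))\<bar> * f (g x))"
    unfolding integral_on_1_eq by (simp add: vec_eq_iff)
qed

text \<open>
  \<open>\<mu>\<close> is a density on the manifold and \<open>\<nu>\<close> its pullback under \<open>\<Phi>\<close>, both given by their coordinate
  expressions; \<open>\<phi>' c d p\<close> is the derivative of \<open>\<Phi>\<close> at \<open>p\<close> in the charts \<open>c\<close> and \<open>d\<close>.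
\<close>

locale wellordered_atlas = compact_atlas X C dm co
  for X :: "'m topology" and C :: "'c set" and dm and co :: "'c \<Rightarrow> 'm \<Rightarrow> real ^ 'k::{finite,wellorder}" +
  fixes \<Phi> :: "'m \<Rightarrow> 'm" and \<phi>' :: "'c \<Rightarrow> 'c \<Rightarrow> 'm \<Rightarrow> real ^ 'k::_ \<Rightarrow> real ^ 'k::_"
    and \<mu> \<nu> :: "'c \<Rightarrow> real ^ 'k::_ \<Rightarrow> real"
  assumes \<Phi>_bij: "bij_betw \<Phi> (topspace X) (topspace X)"
    and \<Phi>_cont: "\<And>U. openin X U \<Longrightarrow> openin X {p \<in> topspace X. \<Phi> p \<in> U}"
    and \<Phi>_deriv: "\<And>c d p. c \<in> C \<Longrightarrow> d \<in> C \<Longrightarrow> p \<in> dm c \<Longrightarrow> \<Phi> p \<in> dm d \<Longrightarrow>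
      ((\<lambda>x. co d (\<Phi> (inv_into (dm c) (co c) x))) has_derivative \<phi>' c d p) (at (co c p))"
    and \<mu>_cont: "\<And>c. c \<in> C \<Longrightarrow> continuous_on (co c ` dm c) (\<mu> c)"
    and \<nu>_cont: "\<And>c. c \<in> C \<Longrightarrow> continuous_on (co c ` dm c) (\<nu> c)"
    and \<nu>_eq: "\<And>c d p. c \<in> C \<Longrightarrow> d \<in> C \<Longrightarrow> p \<in> dm c \<Longrightarrow> \<Phi> p \<in> dm d \<Longrightarrow>
      \<nu> c (co c p) = \<bar>det (matrix (\<phi>' c d p))\<bar> * \<mu> d (co d (\<Phi> p))"
    and \<nu>_le: "\<And>c p. c \<in> C \<Longrightarrow> p \<in> dm c \<Longrightarrow> \<nu> c (co c p) \<le> \<mu> c (co c p)"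
begin

lemma lebesgue_image:
  assumes "c \<in> C" "openin X P" "openin X Q" "P \<subseteq> dm c"
  shows "co c ` (P - Q) \<in> sets lebesgue"
proof -
  have "co c ` (P - Q) = co c ` P - co c ` (P \<inter> Q)"
  proof -
    have "P - Q \<subseteq> dm c" "P \<inter> Q \<subseteq> dm c" using assms(4) by blast+
    then show ?thesis
      using inj_on_image_set_diff[OF co_inj[OF assms(1)], of P "P \<inter> Q"] by (simp add: Diff_Int)
  qed
  moreover have "open (co c ` P)" "open (co c ` (P \<inter> Q))"
    using assms by (auto intro!: co_open)
  ultimately show ?thesis by simp
qed

text \<open>
  The manifold is cut into finitely many disjoint measurable pieces \<open>B i\<close>, each inside one chart. Cutting
  them further into the parts \<open>E i j\<close> that \<open>\<Phi>\<close> maps into \<open>B j\<close> and changing variables on each part,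
  the \<open>\<nu>\<close>-volume of the whole manifold is seen to equal its \<open>\<mu>\<close>-volume, where both volumes are the sums over
  the pieces. As \<open>\<nu> \<le> \<mu>\<close>, the two densities agree almost everywhere, and by continuity at \<open>p0\<close>, since
  \<open>B 0\<close> is a full coordinate ball around this point.
\<close>

theorem density_preserved:
  assumes p0: "c0 \<in> C" "p0 \<in> dm c0"
  shows "\<nu> c0 (co c0 p0) = \<mu> c0 (co c0 p0)"
proof -
  obtain N c x r where c: "c 0 = c0" "x 0 = co c0 p0" "\<And>i::nat. c i \<in> C" "\<And>i. r i > 0"
    "\<And>i. cball (x i) (r i) \<subseteq> co (c i) ` dm (c i)"
    "topspace X = (\<Union>i\<le>N. {p \<in> dm (c i). co (c i) p \<in> ball (x i) (r i)})"
    by (rule finite_ball_cover[OF p0]) blast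
  define U where "U i = {p \<in> dm (c i). co (c i) p \<in> ball (x i) (r i)}" for i
  \<comment> \<open>the part of the manifold that is covered by the earlier balls\<close>
  define V where "V i = (\<Union>j<i. U j)" for i
  define B where "B i = U i - V i" for i
  define E where "E i j = {p \<in> B i. \<Phi> p \<in> B j}" for i j
  have openU: "openin X (U i)" for i unfolding U_def using c by (intro co_cont) auto
  have openV: "openin X (V i)" for i unfolding V_def using openU by (intro openin_Union) auto
  have Usub: "U i \<subseteq> dm (c i)" for i by (auto simp: U_def)
  have Bsub: "B i \<subseteq> dm (c i)" for i using Usub by (auto simp: B_def)
  have dmtop: "dm (c i) \<subseteq> topspace X" for i using dm_open[OF c(3)] by (rule openin_subset)
  have disj: "B i \<inter> B j = {}" if "i \<noteq> j" for i j
    using that by (cases i j rule: linorder_cases) (auto simp: B_def V_def)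
  have cover: "\<exists>i\<le>N. p \<in> B i" if "p \<in> topspace X" for p
  proof -
    have "\<exists>i. i \<le> N \<and> p \<in> U i" using that c(6) by (auto simp: U_def)
    then obtain i where i: "i \<le> N" "p \<in> U i" "\<And>j. j < i \<Longrightarrow> \<not> (j \<le> N \<and> p \<in> U j)"
      using exists_least_iff[of "\<lambda>i. i \<le> N \<and> p \<in> U i"] by blast
    then have "p \<notin> V i" by (auto simp: V_def)
    then show ?thesis using i by (auto simp: B_def)
  qed
  let ?co = "\<lambda>i. co (c i)"
  have B_leb: "?co i ` B i \<in> sets lebesgue" for i
    unfolding B_def by (rule lebesgue_image[OF c(3) openU openV Usub])
  have E_leb: "?co i ` E i j \<in> sets lebesgue" for i j
  proof -
    have "E i j = (U i \<inter> {p \<in> topspace X. \<Phi> p \<in> U j}) - (V i \<union> {p \<in> topspace X. \<Phi> p \<in> V j})"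
      using Usub dmtop by (fastforce simp: E_def B_def)
    then show ?thesis
      using Usub[of i] by (auto intro!: lebesgue_image[OF c(3)] \<Phi>_cont openU openV openin_Un openin_Int)
  qed
  have B_ball: "?co i ` B i \<subseteq> cball (x i) (r i)" for i by (auto simp: B_def U_def)
  have int: "f absolutely_integrable_on S"
    if "continuous_on (?co i ` dm (c i)) f" "S \<subseteq> ?co i ` B i" "S \<in> sets lebesgue"
    for f :: "real ^ 'k::_ \<Rightarrow> real" and S i
    by (rule absolutely_integrable_on_compact_subset[OF compact_cball[of "x i" "r i"]])
      (use that B_ball c(5)[of i] in \<open>auto intro: continuous_on_subset\<close>)
  have E_sub: "?co i ` E i j \<subseteq> ?co i ` B i" for i j by (auto simp: E_def)
  have B_E: "?co i ` B i = (\<Union>j\<le>N. ?co i ` E i j)" for i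
  proof -
    have "\<exists>j\<le>N. p \<in> E i j" if "p \<in> B i" for p
    proof -
      have "\<Phi> p \<in> topspace X" using that Bsub dmtop \<Phi>_bij by (meson bij_betwE subsetD)
      then show ?thesis using cover that by (auto simp: E_def)
    qed
    then have "B i = (\<Union>j\<le>N. E i j)" by (auto simp: E_def)
    then show ?thesis by (simp add: image_UN)
  qed
  have inj_disj: "?co i ` S \<inter> ?co i ` T = {}" if "S \<subseteq> B i" "T \<subseteq> B i" "S \<inter> T = {}" for i S T
    using inj_on_image_Int[OF co_inj[OF c(3)], of S i T] that Bsub[of i] by auto
  have source: "integral (?co i ` B i) (\<nu> (c i)) = (\<Sum>j\<le>N. integral (?co i ` E i j) (\<nu> (c i)))" for i
  proof -
    have "(\<nu> (c i) has_integral (\<Sum>j\<le>N. integral (?co i ` E i j) (\<nu> (c i)))) (\<Union>j\<le>N. ?co i ` E i j)"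
    proof (rule has_integral_UN)
      show "(\<nu> (c i) has_integral integral (?co i ` E i j) (\<nu> (c i))) (?co i ` E i j)" for j
        using int[OF \<nu>_cont[OF c(3)] E_sub E_leb] by (auto simp: absolutely_integrable_on_def)
      have "?co i ` E i j \<inter> ?co i ` E i k = {}" if "j \<noteq> k" for j k
        using disj[OF that] by (intro inj_disj) (auto simp: E_def)
      then show "pairwise (\<lambda>j k. negligible (?co i ` E i j \<inter> ?co i ` E i k)) {..N}"
        by (simp add: pairwise_def)
    qed simp
    then show ?thesis unfolding B_E by (rule integral_unique)
  qed
  have inv: "inv_into (dm (c i)) (?co i) (?co i p) = p" if "p \<in> B i" for i p
    using that Bsub co_inj[OF c(3)] by (auto intro: inv_into_f_f)
  have change: "\<mu> (c j) absolutely_integrable_on ?co j ` \<Phi> ` E i j"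
    "integral (?co j ` \<Phi> ` E i j) (\<mu> (c j)) = integral (?co i ` E i j) (\<nu> (c i))" for i j
  proof -
    let ?S = "?co i ` E i j" and ?i = "inv_into (dm (c i)) (?co i)"
    let ?g = "\<lambda>x. ?co j (\<Phi> (?i x))"
    have image: "?g ` ?S = ?co j ` \<Phi> ` E i j"
      unfolding image_image by (rule image_cong) (auto simp: E_def inv)
    have der: "(?g has_derivative \<phi>' (c i) (c j) (?i x)) (at x within ?S)" if xS: "x \<in> ?S" for x
    proof -
      obtain p where "x = ?co i p" "p \<in> B i" "\<Phi> p \<in> B j" using xS by (auto simp: E_def)
      then show ?thesis
        using \<Phi>_deriv[OF c(3) c(3), of p i j] Bsub by (auto simp: inv intro: has_derivative_at_withinI)
    qed
    have inj: "inj_on ?g ?S"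
    proof (rule inj_onI)
      fix x y assume "x \<in> ?S" "y \<in> ?S" and eq: "?g x = ?g y"
      then obtain p q where p: "x = ?co i p" "p \<in> B i" "\<Phi> p \<in> B j" and q: "y = ?co i q" "q \<in> B i" "\<Phi> q \<in> B j"
        by (auto simp: E_def)
      then have "?co j (\<Phi> p) = ?co j (\<Phi> q)" using eq by (simp add: inv)
      then have "\<Phi> p = \<Phi> q" using p q Bsub[of j] co_inj[OF c(3), of j] by (meson inj_onD subsetD)
      then have "p = q"
        using p q Bsub[of i] dmtop[of i] \<Phi>_bij unfolding bij_betw_def by (meson inj_onD subsetD)
      then show "x = y" using p q by simp
    qed
    have law: "\<nu> (c i) x = \<bar>det (matrix (\<phi>' (c i) (c j) (?i x)))\<bar> * \<mu> (c j) (?g x)" if xS: "x \<in> ?S" for x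
    proof -
      obtain p where "x = ?co i p" "p \<in> B i" "\<Phi> p \<in> B j" using xS by (auto simp: E_def)
      then show ?thesis using \<nu>_eq[OF c(3) c(3), of p i j] Bsub by (auto simp: inv)
    qed
    have "\<nu> (c i) absolutely_integrable_on ?S" by (rule int[OF \<nu>_cont[OF c(3)] E_sub E_leb])
    then have "(\<lambda>x. \<bar>det (matrix (\<phi>' (c i) (c j) (?i x)))\<bar> * \<mu> (c j) (?g x)) absolutely_integrable_on ?S"
      by (rule absolutely_integrable_spike[of _ _ "{}"]) (simp_all add: law)
    from integral_change_of_variables_real[OF E_leb der inj this]
    show "\<mu> (c j) absolutely_integrable_on ?co j ` \<Phi> ` E i j"
      "integral (?co j ` \<Phi> ` E i j) (\<mu> (c j)) = integral ?S (\<nu> (c i))"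
      unfolding image by (simp_all add: law cong: integral_cong)
  qed
  have target: "integral (?co j ` B j) (\<mu> (c j)) = (\<Sum>i\<le>N. integral (?co i ` E i j) (\<nu> (c i)))" for j
  proof -
    have "?co j ` B j = (\<Union>i\<le>N. ?co j ` \<Phi> ` E i j)"
    proof -
      have "\<exists>i\<le>N. q \<in> \<Phi> ` E i j" if "q \<in> B j" for q
      proof -
        have "q \<in> topspace X" using that Bsub dmtop by blast
        then obtain p where p: "p \<in> topspace X" "\<Phi> p = q" using \<Phi>_bij by (metis bij_betw_def imageE)
        obtain i where "i \<le> N" "p \<in> B i" using cover[OF p(1)] by blast
        then show ?thesis using p(2) that by (intro exI[of _ i]) (auto simp: E_def)
      qed
      then show ?thesis by (fastforce simp: E_def)
    qed
    moreover have "(\<mu> (c j) has_integral (\<Sum>i\<le>N. integral (?co i ` E i j) (\<nu> (c i)))) (\<Union>i\<le>N. ?co j ` \<Phi> ` E i j)"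
    proof (rule has_integral_UN)
      show "(\<mu> (c j) has_integral integral (?co i ` E i j) (\<nu> (c i))) (?co j ` \<Phi> ` E i j)" for i
      proof -
        have "\<mu> (c j) integrable_on ?co j ` \<Phi> ` E i j"
          using change(1) by (simp add: absolutely_integrable_on_def)
        then show ?thesis by (simp add: has_integral_iff change(2))
      qed
      have "?co j ` \<Phi> ` E i j \<inter> ?co j ` \<Phi> ` E k j = {}" if "i \<noteq> k" for i k
      proof (rule inj_disj)
        have "E i j \<subseteq> topspace X" "E k j \<subseteq> topspace X" "E i j \<inter> E k j = {}"
          using disj[OF that] Bsub[of i] Bsub[of k] dmtop[of i] dmtop[of k] unfolding E_def by blast+
        then show "\<Phi> ` E i j \<inter> \<Phi> ` E k j = {}"
          using \<Phi>_bij unfolding bij_betw_def by (metis image_empty inj_on_image_Int)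
      qed (auto simp: E_def)
      then show "pairwise (\<lambda>i k. negligible (?co j ` \<Phi> ` E i j \<inter> ?co j ` \<Phi> ` E k j)) {..N}"
        by (simp add: pairwise_def)
    qed simp
    ultimately show ?thesis by (simp add: integral_unique)
  qed
  let ?h = "\<lambda>i y. \<mu> (c i) y - \<nu> (c i) y"
  have h_cont: "continuous_on (?co i ` dm (c i)) (?h i)" for i
    by (intro continuous_intros \<mu>_cont \<nu>_cont c)
  have h_nonneg: "?h i y \<ge> 0" if "y \<in> ?co i ` dm (c i)" for i y
    using that \<nu>_le[OF c(3)] by auto
  have \<mu>\<nu>_int: "\<mu> (c i) integrable_on ?co i ` B i" "\<nu> (c i) integrable_on ?co i ` B i" for i
    using int[OF \<mu>_cont[OF c(3)] subset_refl B_leb] int[OF \<nu>_cont[OF c(3)] subset_refl B_leb]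
    by (auto simp: absolutely_integrable_on_def)
  have h_int: "?h i integrable_on ?co i ` B i" for i by (intro integrable_diff \<mu>\<nu>_int)
  have h_ge: "integral (?co i ` B i) (?h i) \<ge> 0" for i
    using Bsub h_nonneg by (intro integral_nonneg h_int) blast
  have "(\<Sum>j\<le>N. integral (?co j ` B j) (\<mu> (c j))) = (\<Sum>i\<le>N. integral (?co i ` B i) (\<nu> (c i)))"
    unfolding target source by (rule sum.swap)
  then have "(\<Sum>i\<le>N. integral (?co i ` B i) (?h i)) = 0"
    by (simp add: Henstock_Kurzweil_Integration.integral_diff \<mu>\<nu>_int sum_subtractf)
  then have h0: "integral (?co 0 ` B 0) (?h 0) = 0"
    by (subst (asm) sum_nonneg_eq_0_iff) (auto intro: h_ge)
  have B0: "?co 0 ` B 0 = ball (x 0) (r 0)"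
  proof
    show "?co 0 ` B 0 \<subseteq> ball (x 0) (r 0)" by (auto simp: B_def U_def)
    show "ball (x 0) (r 0) \<subseteq> ?co 0 ` B 0"
    proof
      fix y assume y: "y \<in> ball (x 0) (r 0)"
      then have "y \<in> ?co 0 ` dm (c 0)" using c(5)[of 0] ball_subset_cball[of "x 0" "r 0"] by blast
      then obtain p where "p \<in> dm (c 0)" "y = ?co 0 p" by blast
      then show "y \<in> ?co 0 ` B 0" using y by (auto simp: B_def V_def U_def)
    qed
  qed
  obtain a b where ab: "cbox a b \<subseteq> ball (x 0) (r 0)" "x 0 \<in> box a b"
    by (rule open_contains_cbox[OF open_ball, of "x 0" "x 0" "r 0"]) (use c(4)[of 0] in auto)
  have ab_dm: "cbox a b \<subseteq> ?co 0 ` dm (c 0)"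
    using ab(1) c(5)[of 0] ball_subset_cball[of "x 0" "r 0"] by blast
  have hab: "?h 0 integrable_on cbox a b"
    by (rule integrable_continuous) (rule continuous_on_subset[OF h_cont ab_dm])
  have "integral (cbox a b) (?h 0) \<le> integral (?co 0 ` B 0) (?h 0)"
  proof (rule integral_subset_le[OF _ hab h_int])
    show "cbox a b \<subseteq> ?co 0 ` B 0" using ab(1) B0 by simp
    show "\<forall>y\<in>?co 0 ` B 0. 0 \<le> ?h 0 y" using Bsub[of 0] h_nonneg[of _ 0] by blast
  qed
  moreover have "integral (cbox a b) (?h 0) \<ge> 0"
    using ab_dm h_nonneg by (intro integral_nonneg hab) blast
  ultimately have "(?h 0 has_integral 0) (cbox a b)"
    using hab h0 by (simp add: has_integral_iff)
  then have "?h 0 (x 0) = 0"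
    using ab(2) box_subset_cbox ab_dm h_nonneg
    by (intro has_integral_0_cbox_imp_0[OF continuous_on_subset[OF h_cont ab_dm]]) blast+
  then show ?thesis using c(1,2) by simp
qed

end

section \<open>Changing the index type of the coordinates\<close>

text \<open>
  The change of variables formula is stated for index types with a well-order. Any finite type has a
  copy of this kind, ordered by an arbitrary enumeration; renaming the coordinates is a linear
  isomorphism that does not change determinants.
\<close>

typedef 'a ranked = "UNIV :: 'a set" by auto

lemmas ranked_inverse [simp] = Rep_ranked_inverse Abs_ranked_inverse[OF UNIV_I]

instantiation ranked :: (finite) "{finite, wellorder}"
begin

definition "x \<le> y \<longleftrightarrow> to_nat (Rep_ranked x) \<le> to_nat (Rep_ranked y)"
definition "x < y \<longleftrightarrow> to_nat (Rep_ranked x) < to_nat (Rep_ranked y)"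

instance
proof
  show "finite (UNIV :: 'a ranked set)"
    using finite_imageI[of "UNIV :: 'a set" Abs_ranked] by (simp add: type_definition.univ[OF type_definition_ranked])
  fix x y z :: "'a ranked" and P
  show "(x < y) = (x \<le> y \<and> \<not> y \<le> x)" "x \<le> x" "x \<le> y \<or> y \<le> x"
    by (auto simp: less_eq_ranked_def less_ranked_def)
  show "x \<le> y \<Longrightarrow> y \<le> z \<Longrightarrow> x \<le> z" by (simp add: less_eq_ranked_def)
  show "x \<le> y \<Longrightarrow> y \<le> x \<Longrightarrow> x = y" by (simp add: less_eq_ranked_def Rep_ranked_inject)
  show "(\<And>x. (\<And>y. y < x \<Longrightarrow> P y) \<Longrightarrow> P x) \<Longrightarrow> P x"
    unfolding less_ranked_def by (rule measure_induct_rule[of "\<lambda>x. to_nat (Rep_ranked x)" P x]) blast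
qed

end

definition relabel :: "real ^ 'n \<Rightarrow> real ^ 'n ranked" where
  "relabel x = (\<chi> i. x $ Rep_ranked i)"

definition unrelabel :: "real ^ 'n ranked \<Rightarrow> real ^ 'n" where
  "unrelabel y = (\<chi> i. y $ Abs_ranked i)"

lemma relabel_inverse [simp]: "unrelabel (relabel x) = x" "relabel (unrelabel y) = y"
  by (simp_all add: relabel_def unrelabel_def vec_eq_iff)

lemma bounded_linear_relabel: "bounded_linear (relabel :: real ^ 'n::finite \<Rightarrow> _)"
  and bounded_linear_unrelabel: "bounded_linear (unrelabel :: _ \<Rightarrow> real ^ 'n::finite)"
  by (auto intro!: linear_conv_bounded_linear[THEN iffD1] linearI simp: relabel_def unrelabel_def vec_eq_iff)

lemma det_relabel: "det (\<chi> i j. A $ Rep_ranked i $ Rep_ranked j) = det A"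
  for A :: "real ^ 'n ^ 'n::finite"
  unfolding det_def
proof (rule sum.reindex_bij_witness[of _ "\<lambda>q. Abs_ranked \<circ> q \<circ> Rep_ranked" "\<lambda>p. Rep_ranked \<circ> p \<circ> Abs_ranked"])
  have bij: "bij (Rep_ranked :: 'n ranked \<Rightarrow> 'n)" "bij (Abs_ranked :: 'n \<Rightarrow> 'n ranked)"
    by (auto intro!: o_bij[of Abs_ranked] o_bij[of Rep_ranked] simp: fun_eq_iff)
  fix p assume "p \<in> {p :: 'n ranked \<Rightarrow> 'n ranked. p permutes UNIV}"
  then have p: "p permutes UNIV" by simp
  show "Abs_ranked \<circ> (Rep_ranked \<circ> p \<circ> Abs_ranked) \<circ> Rep_ranked = p" by (simp add: fun_eq_iff)
  show "Rep_ranked \<circ> p \<circ> Abs_ranked \<in> {p. p permutes UNIV}"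
    by (auto intro!: bij_imp_permutes bij_comp bij permutes_bij[OF p])
  have inv: "inv_into UNIV (Rep_ranked :: 'n ranked \<Rightarrow> 'n) = Abs_ranked"
    by (rule inv_unique_comp) (auto simp: fun_eq_iff)
  have "map_permutation UNIV Rep_ranked p = Rep_ranked \<circ> p \<circ> Abs_ranked"
    using bij by (simp add: map_permutation_def inv bij_is_surj restrict_id_def fun_eq_iff)
  then have sgn: "sign (Rep_ranked \<circ> p \<circ> Abs_ranked) = sign p"
    using sign_map_permutation[where A = UNIV and f = Rep_ranked and p = p] p bij by (simp add: bij_is_inj)
  have "(\<Prod>i\<in>UNIV. A $ i $ (Rep_ranked \<circ> p \<circ> Abs_ranked) i) = (\<Prod>i\<in>UNIV. A $ Rep_ranked i $ Rep_ranked (p i))"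
    by (rule prod.reindex_bij_witness[of _ Rep_ranked Abs_ranked]) auto
  then show "of_int (sign (Rep_ranked \<circ> p \<circ> Abs_ranked)) * (\<Prod>i\<in>UNIV. A $ i $ (Rep_ranked \<circ> p \<circ> Abs_ranked) i)
      = of_int (sign p) * (\<Prod>i\<in>UNIV. (\<chi> i j. A $ Rep_ranked i $ Rep_ranked j) $ i $ p i)"
    by (simp add: sgn)
next
  have bij: "bij (Rep_ranked :: 'n ranked \<Rightarrow> 'n)" "bij (Abs_ranked :: 'n \<Rightarrow> 'n ranked)"
    by (auto intro!: o_bij[of Abs_ranked] o_bij[of Rep_ranked] simp: fun_eq_iff)
  fix q assume "q \<in> {p :: 'n \<Rightarrow> 'n. p permutes UNIV}"
  then have q: "q permutes UNIV" by simp
  show "Rep_ranked \<circ> (Abs_ranked \<circ> q \<circ> Rep_ranked) \<circ> Abs_ranked = q" by (simp add: fun_eq_iff)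
  show "Abs_ranked \<circ> q \<circ> Rep_ranked \<in> {p. p permutes UNIV}"
    by (auto intro!: bij_imp_permutes bij_comp bij permutes_bij[OF q])
qed

theorem volume_density_preserved:
  fixes co' :: "'c \<Rightarrow> 'm \<Rightarrow> real ^ 'n::finite" and \<Phi> :: "'m \<Rightarrow> 'm"
    and \<phi>' :: "'c \<Rightarrow> 'c \<Rightarrow> 'm \<Rightarrow> real ^ 'n \<Rightarrow> real ^ 'n" and \<mu> \<nu> :: "'c \<Rightarrow> real ^ 'n \<Rightarrow> real"
  assumes atlas: "compact_atlas X C dm co'"
    and \<Phi>: "bij_betw \<Phi> (topspace X) (topspace X)"
      "\<And>U. openin X U \<Longrightarrow> openin X {p \<in> topspace X. \<Phi> p \<in> U}"
    and deriv: "\<And>c d p. c \<in> C \<Longrightarrow> d \<in> C \<Longrightarrow> p \<in> dm c \<Longrightarrow> \<Phi> p \<in> dm d \<Longrightarrow>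
      ((\<lambda>x. co' d (\<Phi> (inv_into (dm c) (co' c) x))) has_derivative \<phi>' c d p) (at (co' c p))"
    and cont: "\<And>c. c \<in> C \<Longrightarrow> continuous_on (co' c ` dm c) (\<mu> c)"
      "\<And>c. c \<in> C \<Longrightarrow> continuous_on (co' c ` dm c) (\<nu> c)"
    and eq: "\<And>c d p. c \<in> C \<Longrightarrow> d \<in> C \<Longrightarrow> p \<in> dm c \<Longrightarrow> \<Phi> p \<in> dm d \<Longrightarrow>
      \<nu> c (co' c p) = \<bar>det (matrix (\<phi>' c d p))\<bar> * \<mu> d (co' d (\<Phi> p))"
    and le: "\<And>c p. c \<in> C \<Longrightarrow> p \<in> dm c \<Longrightarrow> \<nu> c (co' c p) \<le> \<mu> c (co' c p)"
    and p0: "c0 \<in> C" "p0 \<in> dm c0"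
  shows "\<nu> c0 (co' c0 p0) = \<mu> c0 (co' c0 p0)"
proof -
  interpret a: compact_atlas X C dm co' by (rule atlas)
  let ?co = "\<lambda>c p. relabel (co' c p)"
  note blr = bounded_linear_relabel and blu = bounded_linear_unrelabel
  have image: "relabel ` S = unrelabel -` S" for S :: "(real ^ 'n) set"
    by (auto simp: image_iff intro!: bexI[of _ "unrelabel _"])
  have open_relabel: "open (relabel ` S)" if "open S" for S :: "(real ^ 'n) set"
    unfolding image using that by (rule open_vimage) (rule linear_continuous_on[OF blu])
  have inv: "inv_into (dm c) (?co c) x = inv_into (dm c) (co' c) (unrelabel x)" for c x
  proof -
    have "relabel (co' c y) = x \<longleftrightarrow> co' c y = unrelabel x" for y
      by (metis relabel_inverse)
    then show ?thesis by (simp add: inv_into_def)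
  qed
  interpret w: wellordered_atlas X C dm ?co \<Phi> "\<lambda>c d p v. relabel (\<phi>' c d p (unrelabel v))"
    "\<lambda>c y. \<mu> c (unrelabel y)" "\<lambda>c y. \<nu> c (unrelabel y)"
  proof
    fix c d p assume cd: "c \<in> C" "d \<in> C" "p \<in> dm c" "\<Phi> p \<in> dm d"
    have "((\<lambda>x. relabel (co' d (\<Phi> (inv_into (dm c) (co' c) (unrelabel x))))) has_derivative
        (\<lambda>v. relabel (\<phi>' c d p (unrelabel v)))) (at (?co c p))"
      by (intro bounded_linear.has_derivative[OF blr]
          has_derivative_compose[OF bounded_linear.has_derivative[OF blu has_derivative_ident]])
        (simp add: deriv[OF cd])
    then show "((\<lambda>x. ?co d (\<Phi> (inv_into (dm c) (?co c) x))) has_derivative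
        (\<lambda>v. relabel (\<phi>' c d p (unrelabel v)))) (at (?co c p))"
      by (simp add: inv)
    have "matrix (\<lambda>v. relabel (\<phi>' c d p (unrelabel v))) = (\<chi> i j. matrix (\<phi>' c d p) $ Rep_ranked i $ Rep_ranked j)"
    proof -
      have "unrelabel (axis j 1) = axis (Rep_ranked j) 1" for j :: "'n ranked"
        by (auto simp: unrelabel_def axis_def vec_eq_iff)
      note e = this
      show ?thesis by (simp add: e matrix_def relabel_def vec_eq_iff)
    qed
    then show "\<nu> c (unrelabel (?co c p)) = \<bar>det (matrix (\<lambda>v. relabel (\<phi>' c d p (unrelabel v))))\<bar>
        * \<mu> d (unrelabel (?co d (\<Phi> p)))"
      using eq[OF cd] by (simp add: det_relabel)
  next
    fix c assume c: "c \<in> C"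
    show "inj_on (?co c) (dm c)"
      using a.co_inj[OF c] by (auto simp: inj_on_def) (metis relabel_inverse(1))
    show "open (?co c ` U)" if "openin X U" "U \<subseteq> dm c" for U
      using open_relabel[OF a.co_open[OF c that]] by (simp add: image_image)
    show "openin X {p \<in> dm c. ?co c p \<in> V}" if "open V" for V
    proof -
      have "open (relabel -` V)"
        using that by (rule open_vimage) (rule linear_continuous_on[OF blr])
      from a.co_cont[OF c this] show ?thesis by simp
    qed
    show "continuous_on (?co c ` dm c) (\<lambda>y. \<mu> c (unrelabel y))"
      by (rule continuous_on_compose2[OF cont(1)[OF c] linear_continuous_on[OF blu]]) auto
    show "continuous_on (?co c ` dm c) (\<lambda>y. \<nu> c (unrelabel y))"
      by (rule continuous_on_compose2[OF cont(2)[OF c] linear_continuous_on[OF blu]]) auto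
  qed (use a.compact a.dm_open a.dm_cover \<Phi> le in auto)
  show ?thesis using w.density_preserved[OF p0] by simp
qed

section \<open>Charts and metrics on manifolds\<close>

text \<open>
  Open sets correspond to open sets under a chart because its domain is open in the manifold and its
  image is open in Euclidean space.
\<close>

lemma is_chart_facts:
  assumes "is_chart X c"
  shows "openin X (chart_dom c)" "open (chart_image c)" "inj_on (snd c) (chart_dom c)"
    "\<And>U. openin X U \<Longrightarrow> U \<subseteq> chart_dom c \<Longrightarrow> open (snd c ` U)"
    "\<And>V. open V \<Longrightarrow> openin X {p \<in> chart_dom c. snd c p \<in> V}"
proof -
  have hom: "homeomorphic_map (subtopology X (chart_dom c)) (top_of_set (chart_image c)) (snd c)"
    and o: "openin X (chart_dom c)" and oi: "open (chart_image c)"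
    using assms by (auto simp: is_chart_def)
  have top: "topspace (subtopology X (chart_dom c)) = chart_dom c"
    using openin_subset[OF o] by (simp add: Int_absorb1)
  show "openin X (chart_dom c)" "open (chart_image c)" by (rule o oi)+
  show "inj_on (snd c) (chart_dom c)"
    using homeomorphic_imp_injective_map[OF hom] unfolding top .
  show "open (snd c ` U)" if "openin X U" "U \<subseteq> chart_dom c" for U
  proof -
    have "openin (subtopology X (chart_dom c)) U" using that by (simp add: openin_open_subtopology[OF o])
    then have "openin (top_of_set (chart_image c)) (snd c ` U)"
      using homeomorphic_imp_open_map[OF hom] by (simp add: open_map_def)
    then show ?thesis using oi by (simp add: openin_open_eq)
  qed
  show "openin X {p \<in> chart_dom c. snd c p \<in> V}" if "open V" for V
  proof -
    have "openin (top_of_set (chart_image c)) (chart_image c \<inter> V)" using that by (rule openin_open_Int)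
    then have "openin (subtopology X (chart_dom c)) {p \<in> topspace (subtopology X (chart_dom c)). snd c p \<in> chart_image c \<inter> V}"
      by (rule openin_continuous_map_preimage[OF homeomorphic_imp_continuous_map[OF hom]])
    moreover have "{p \<in> topspace (subtopology X (chart_dom c)). snd c p \<in> chart_image c \<inter> V} = {p \<in> chart_dom c. snd c p \<in> V}"
      unfolding top by auto
    ultimately show ?thesis by (simp add: openin_open_subtopology[OF o])
  qed
qed

lemma compact_atlas_charts:
  assumes "smooth_manifold X A" "compact_space X"
  shows "compact_atlas X A chart_dom snd"
proof
  have ch: "is_chart X c" if "c \<in> A" for c using that assms by (simp add: smooth_manifold_def)
  show "compact_space X" by fact
  show "topspace X = (\<Union>c\<in>A. chart_dom c)" using assms by (simp add: smooth_manifold_def)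
  fix c assume c: "c \<in> A"
  show "openin X (chart_dom c)" "inj_on (snd c) (chart_dom c)"
    by (rule is_chart_facts[OF ch[OF c]])+
  show "open (snd c ` U)" if "openin X U" "U \<subseteq> chart_dom c" for U
    by (rule is_chart_facts(4)[OF ch[OF c] that])
  show "openin X {p \<in> chart_dom c. snd c p \<in> V}" if "open V" for V
    by (rule is_chart_facts(5)[OF ch[OF c] that])
qed

lemma (in compact_atlas) inv_co: "c \<in> C \<Longrightarrow> p \<in> dm c \<Longrightarrow> inv_into (dm c) (co c) (co c p) = p"
  by (rule inv_into_f_f[OF co_inj])

lemma smooth_on_entry: "smooth_on S M \<Longrightarrow> smooth_on S (\<lambda>x. M x $ i $ j)"
  by (intro smooth_on_vec_nth)

lemma riemannian_metric_facts:
  assumes "riemannian_metric A g" "c \<in> A"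
  shows "smooth_on (chart_image c) (\<lambda>x. g c x $ i $ j)" "x \<in> chart_image c \<Longrightarrow> pos_def (g c x)"
  using assms by (auto simp: riemannian_metric_def smooth_tensor2_def pos_def_def intro: smooth_on_entry)

lemma open_local_rep_dom:
  assumes "smooth_manifold X A" "smooth_map X A X A F" "c \<in> A" "d \<in> A"
  shows "open (local_rep_dom c d F)"
proof -
  have ch: "is_chart X c" "is_chart X d" using assms by (auto simp: smooth_manifold_def)
  have "openin X {q \<in> topspace X. F q \<in> chart_dom d}"
    using assms(2) is_chart_facts(1)[OF ch(2)] by (auto simp: smooth_map_def intro: openin_continuous_map_preimage)
  then have "openin X (chart_dom c \<inter> {q \<in> topspace X. F q \<in> chart_dom d})"
    by (intro openin_Int is_chart_facts(1)[OF ch(1)])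
  moreover have "chart_dom c \<inter> {q \<in> topspace X. F q \<in> chart_dom d} = {q \<in> chart_dom c. F q \<in> chart_dom d}"
    using openin_subset[OF is_chart_facts(1)[OF ch(1)]] by auto
  ultimately show ?thesis
    unfolding local_rep_dom_def by (intro is_chart_facts(4)[OF ch(1)]) auto
qed

lemma scalar_curvature_natural:
  assumes M: "smooth_manifold X A" and F: "smooth_map X A X A F"
    and g1: "riemannian_metric A g1" and g2: "riemannian_metric A g2"
    and a: "a \<noteq> 0"
    and c: "c \<in> A" "d \<in> A" "p \<in> chart_dom c" "F p \<in> chart_dom d"
    and pull: "\<And>x. x \<in> local_rep_dom c d F \<Longrightarrow> g2 c x = a *\<^sub>R pullback c d F g1 x"
  shows "scalar_curvature (g2 c) (snd c p) = (1 / a) * scalar_curvature (g1 d) (snd d (F p))"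
proof -
  have ch: "is_chart X c" "is_chart X d" using M c by (auto simp: smooth_manifold_def)
  let ?U = "local_rep_dom c d F" and ?\<phi> = "local_rep c d F"
  have inv: "chart_inv c (snd c q) = q" if "q \<in> chart_dom c" for q
    by (rule inv_into_f_f[OF is_chart_facts(3)[OF ch(1)] that])
  have openU: "open ?U" by (rule open_local_rep_dom[OF M F c(1,2)])
  have \<phi>: "?\<phi> (snd c p) = snd d (F p)" using c by (simp add: local_rep_def inv)
  have Usub: "?U \<subseteq> chart_image c" by (auto simp: local_rep_dom_def)
  let ?J = "\<lambda>y. matrix (frechet_derivative ?\<phi> (at y))"
  have g2J: "g2 c y = a *\<^sub>R (transpose (?J y) ** g1 d (?\<phi> y) ** ?J y)" if "y \<in> ?U" for y
    using pull[OF that] by (simp add: pullback_def Let_def)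
  have "scalar_curvature (g2 c) (snd c p) = (1 / a) * scalar_curvature (g1 d) (?\<phi> (snd c p))"
  proof (rule scalar_curvature_pullback[OF openU _ _ is_chart_facts(2)[OF ch(2)], where J = ?J])
    show "snd c p \<in> ?U" using c by (auto simp: local_rep_dom_def)
    show "smooth_on ?U ?\<phi>" using F c by (simp add: smooth_map_def)
    show "?\<phi> ` ?U \<subseteq> chart_image d" by (auto simp: local_rep_dom_def local_rep_def inv)
    show "smooth_on (chart_image d) (\<lambda>y. g1 d y $ i $ j)" for i j by (rule riemannian_metric_facts(1)[OF g1 c(2)])
    show "transpose (g1 d y) = g1 d y" "det (g1 d y) \<noteq> 0" if "y \<in> chart_image d" for y
      using pos_def_sym pos_def_det riemannian_metric_facts(2)[OF g1 c(2) that] by fastforce+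
    show "det (?J y) \<noteq> 0" if "y \<in> ?U" for y
    proof -
      have "det (g2 c y) > 0" using that Usub by (intro pos_def_det riemannian_metric_facts(2)[OF g2 c(1)]) auto
      then show ?thesis by (auto simp: g2J[OF that] det_scaleR det_mul)
    qed
  qed (use a g2J in auto)
  then show ?thesis by (simp add: \<phi>)
qed

lemma smooth_map_id: "smooth_manifold X A \<Longrightarrow> smooth_map X A X A id"
  by (simp add: smooth_map_def smooth_manifold_def)

section \<open>The scalar curvature along a Ricci flow on a closed manifold\<close>

locale closed_ricci_flow =
  fixes X :: "'m topology" and A :: "('m, 'n::finite) chart set"
    and g :: "real \<Rightarrow> ('m, 'n) tensor2" and t1 t2 :: real
  assumes manifold: "smooth_manifold X A" and compact_X: "compact_space X"
    and t12: "t1 < t2" and flow: "ricci_flow A t1 t2 g"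
begin

sublocale compact_atlas X A chart_dom snd
  by (rule compact_atlas_charts[OF manifold compact_X])

lemma metric: "t \<in> {t1..t2} \<Longrightarrow> riemannian_metric A (g t)"
  and slab: "c \<in> A \<Longrightarrow> smooth_on ({t1..t2} \<times> chart_image c) (\<lambda>(t, x). g t c x)"
  and flow_eq: "c \<in> A \<Longrightarrow> x \<in> chart_image c \<Longrightarrow> t \<in> {t1..t2} \<Longrightarrow>
      ((\<lambda>s. g s c x) has_vector_derivative (- 2) *\<^sub>R ricci (g t c) x) (at t within {t1..t2})"
  using flow by (auto simp: ricci_flow_def)

lemma pos_def_metric: "c \<in> A \<Longrightarrow> x \<in> chart_image c \<Longrightarrow> t \<in> {t1..t2} \<Longrightarrow> pos_def (g t c x)"
  using riemannian_metric_facts(2)[OF metric] by blast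

lemma time_derivative_unique:
  fixes f :: "real \<Rightarrow> 'a::euclidean_space"
  assumes "t \<in> {t1..t2}" "(f has_vector_derivative a) (at t within {t1..t2})"
    "(f has_vector_derivative b) (at t within {t1..t2})"
  shows "a = b"
  using vector_derivative_unique_within_closed_interval[of t1 t2 t f a b] assms t12
  by (simp add: cbox_interval)

text \<open>
  The Ricci tensor is \<open>- 1/2\<close> times the time derivative of the metric, and the time derivative is
  continuous up to the end points of the interval because the flow is smooth there.
\<close>

lemma ricci_continuous:
  assumes c: "c \<in> A"
  shows "continuous_on ({t1..t2} \<times> chart_image c) (\<lambda>(t, x). ricci (g t c) x)"
proof -
  let ?S = "{t1..t2} \<times> chart_image c" and ?f = "\<lambda>(t, x). g t c x"
  have "C_k_on (Suc 0) ?S ?f" using slab[OF c] by (simp add: smooth_on_def del: C_k_on.simps)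
  then obtain f' where f': "\<And>p. p \<in> ?S \<Longrightarrow> (?f has_derivative f' p) (at p within ?S)"
    "\<And>v. C_k_on 0 ?S (\<lambda>p. f' p v)"
    by (rule C_k_on_SucE) blast
  have eq: "(- 2) *\<^sub>R ricci (g t c) x = f' (t, x) (1, 0)" if "t \<in> {t1..t2}" "x \<in> chart_image c" for t x
  proof -
    have "((\<lambda>s. (s, x)) has_derivative (\<lambda>v. (v, 0))) (at t within {t1..t2})"
      by (auto intro!: derivative_eq_intros)
    moreover have "(?f has_derivative f' (t, x)) (at (t, x) within (\<lambda>s. (s, x)) ` {t1..t2})"
      by (rule has_derivative_subset[OF f'(1)]) (use that in auto)
    ultimately have 1: "((\<lambda>s. ?f (s, x)) has_derivative (\<lambda>v. f' (t, x) (v, 0))) (at t within {t1..t2})"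
      by (rule has_derivative_in_compose)
    have 2: "f' (t, x) (v, 0) = v *\<^sub>R f' (t, x) (1, 0)" for v
    proof -
      have "linear (f' (t, x))" using f'(1)[of "(t, x)"] that by (auto intro: has_derivative_linear)
      from linear_scale[OF this, of v "(1, 0)"] show ?thesis by simp
    qed
    have "((\<lambda>s. g s c x) has_vector_derivative f' (t, x) (1, 0)) (at t within {t1..t2})"
      using 1 unfolding has_vector_derivative_def ext[OF 2] prod.case .
    then show ?thesis
      by (rule time_derivative_unique[OF that(1) flow_eq[OF c that(2,1)]])
  qed
  have "continuous_on ?S (\<lambda>p. (- (1 / 2)) *\<^sub>R f' p (1, 0))"
    using f'(2) by (intro continuous_intros) simp
  moreover have "(- (1 / 2)) *\<^sub>R f' p (1, 0) = (\<lambda>(t, x). ricci (g t c) x) p" if "p \<in> ?S" for p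
  proof -
    obtain t x where "p = (t, x)" "t \<in> {t1..t2}" "x \<in> chart_image c" using \<open>p \<in> ?S\<close> by auto
    then have "(- (1 / 2)) *\<^sub>R f' p (1, 0) = (- (1 / 2)) *\<^sub>R ((- 2) *\<^sub>R ricci (g t c) x)"
      by (simp only: eq)
    also have "\<dots> = ricci (g t c) x" unfolding scaleR_scaleR by simp
    finally show ?thesis using \<open>p = (t, x)\<close> by (simp only: prod.case)
  qed
  ultimately show ?thesis by (simp cong: continuous_on_cong)
qed

text \<open>
  The choice of the chart is immaterial by naturality (lemma \<open>R_chart\<close>).
\<close>

definition R :: "real \<Rightarrow> 'm \<Rightarrow> real" where
  "R t p = (let c = SOME c. c \<in> A \<and> p \<in> chart_dom c in scalar_curvature (g t c) (snd c p))"

lemma R_chart: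
  assumes c: "c \<in> A" "p \<in> chart_dom c" and t: "t \<in> {t1..t2}"
  shows "R t p = scalar_curvature (g t c) (snd c p)"
proof -
  define d where "d = (SOME c. c \<in> A \<and> p \<in> chart_dom c)"
  have d: "d \<in> A" "p \<in> chart_dom d"
    unfolding d_def using someI[of "\<lambda>c. c \<in> A \<and> p \<in> chart_dom c", OF conjI[OF c]] by auto
  have tr: "g t c x = 1 *\<^sub>R pullback c d id (g t) x" if "x \<in> local_rep_dom c d id" for x
  proof -
    have "g t c x = pullback c d id (g t) x"
      using metric[OF t] c d that unfolding riemannian_metric_def smooth_tensor2_def by blast
    then show ?thesis by simp
  qed
  have "scalar_curvature (g t c) (snd c p) = (1 / 1) * scalar_curvature (g t d) (snd d (id p))"
    by (rule scalar_curvature_natural[where F = id and a = 1])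
      (rule manifold smooth_map_id metric t one_neq_zero c d(1) tr | simp only: id_apply d(2) | assumption)+
  then show ?thesis by (simp add: R_def Let_def d_def)
qed

lemma R_chart_inv:
  assumes "c \<in> A" "x \<in> chart_image c" "t \<in> {t1..t2}"
  shows "R t (chart_inv c x) = scalar_curvature (g t c) x"
  using assms by (auto simp: R_chart inv_co)

lemma R_continuous:
  assumes c: "c \<in> A"
  shows "continuous_on ({t1..t2} \<times> chart_image c) (\<lambda>(t, x). R t (chart_inv c x))"
proof -
  let ?S = "{t1..t2} \<times> chart_image c"
  have "smooth_on ?S (\<lambda>p. g (fst p) c (snd p) $ i $ j)" for i j
    using smooth_on_entry[OF slab[OF c]] by (simp add: case_prod_unfold)
  then have "smooth_on ?S (\<lambda>p. matrix_inv (g (fst p) c (snd p)) $ j $ k)" for j k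
  proof (rule smooth_on_matrix_inv)
    show "det (g (fst p) c (snd p)) \<noteq> 0" if "p \<in> ?S" for p
      using pos_def_det[OF pos_def_metric[OF c]] that by (metis less_irrefl mem_Times_iff)
  qed
  then have "continuous_on ?S (\<lambda>p. matrix_inv (g (fst p) c (snd p)) $ j $ k)" for j k
    by (rule smooth_on_imp_continuous_on)
  then have "continuous_on ?S (\<lambda>p. scalar_curvature (g (fst p) c) (snd p))"
    unfolding scalar_curvature_def
  proof (intro continuous_on_sum continuous_on_mult)
    show "continuous_on ?S (\<lambda>p. ricci (g (fst p) c) (snd p) $ j $ k)" for j k
      using ricci_continuous[OF c] by (intro continuous_intros) (simp add: case_prod_unfold)
  qed
  moreover have "scalar_curvature (g (fst p) c) (snd p) = (\<lambda>(t, x). R t (chart_inv c x)) p" if "p \<in> ?S" for p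
    using that by (auto simp: R_chart_inv[OF c])
  ultimately show ?thesis by (simp cong: continuous_on_cong)
qed

lemma R_continuous_time:
  assumes "p \<in> topspace X"
  shows "continuous_on {t1..t2} (\<lambda>t. R t p)"
proof -
  obtain c where c: "c \<in> A" "p \<in> chart_dom c" using assms dm_cover by blast
  have "continuous_on {t1..t2} (\<lambda>t. (\<lambda>(t, x). R t (chart_inv c x)) (t, snd c p))"
    by (rule continuous_on_compose2[OF R_continuous[OF c(1)]]) (use c in \<open>auto intro!: continuous_intros\<close>)
  then show ?thesis using c by (simp add: inv_co)
qed

definition ric_norm_sq :: "real ^ 'n ^ 'n \<Rightarrow> real ^ 'n ^ 'n \<Rightarrow> real" where
  "ric_norm_sq G S = (\<Sum>j\<in>UNIV. \<Sum>k\<in>UNIV. (matrix_inv G ** S ** matrix_inv G) $ j $ k * S $ j $ k)"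

lemma smooth_metric_chart:
  assumes c: "c \<in> A"
  shows "smooth_metric ({t1<..<t2} \<times> chart_image c) (\<lambda>t. g t c)"
proof
  let ?W = "{t1<..<t2} \<times> chart_image c"
  have "is_chart X c" using manifold c by (simp add: smooth_manifold_def)
  then show "open ?W" by (intro open_Times is_chart_facts(2)) simp_all
  have "smooth_on ?W (\<lambda>(t, x). g t c x)"
    by (rule smooth_on_subset[OF slab[OF c]]) auto
  from smooth_on_entry[OF this] show "smooth_on ?W (\<lambda>p. g (fst p) c (snd p) $ i $ j)" for i j
    by (simp add: case_prod_unfold)
  fix p assume "p \<in> ?W"
  then have "pos_def (g (fst p) c (snd p))" by (intro pos_def_metric c) auto
  then show "transpose (g (fst p) c (snd p)) = g (fst p) c (snd p)" "det (g (fst p) c (snd p)) \<noteq> 0"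
    using pos_def_sym pos_def_det by (blast, fastforce)
qed

lemma ricci_sym:
  assumes c: "c \<in> A" "x \<in> chart_image c" "t \<in> {t1..t2}"
  shows "transpose (ricci (g t c) x) = ricci (g t c) x"
proof -
  have tr: "bounded_linear (transpose :: real ^ 'n ^ 'n \<Rightarrow> _)"
    by (auto intro!: linear_conv_bounded_linear[THEN iffD1] linearI simp: transpose_def vec_eq_iff)
  have "((\<lambda>s. transpose (g s c x)) has_vector_derivative transpose ((- 2) *\<^sub>R ricci (g t c) x)) (at t within {t1..t2})"
    by (rule bounded_linear.has_vector_derivative[OF tr flow_eq[OF c]])
  then have "((\<lambda>s. g s c x) has_vector_derivative transpose ((- 2) *\<^sub>R ricci (g t c) x)) (at t within {t1..t2})"
    by (rule has_vector_derivative_transform[OF c(3), rotated])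
       (simp add: pos_def_sym[OF pos_def_metric[OF c(1,2)]])
  then have "transpose ((- 2) *\<^sub>R ricci (g t c) x) = (- 2) *\<^sub>R ricci (g t c) x"
    by (rule time_derivative_unique[OF c(3) _ flow_eq[OF c]])
  then show ?thesis by (simp only: transpose_scalar scaleR_cancel_left) simp
qed

text \<open>
  At a spatial minimum the gradient term of the Laplacian vanishes and the trace of the Hessian is
  nonnegative. If \<open>R\<close> is constant in space, then its Laplacian vanishes.
\<close>

lemma R_evolution:
  assumes c: "c \<in> A" "p \<in> chart_dom c" and t: "t \<in> {t1<..<t2}"
  defines "N \<equiv> ric_norm_sq (g t c (snd c p)) (ricci (g t c) (snd c p))"
  shows "(\<And>q. q \<in> topspace X \<Longrightarrow> R t p \<le> R t q) \<Longrightarrow>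
      \<exists>D. ((\<lambda>s. R s p) has_real_derivative D) (at t) \<and> 2 * N \<le> D"
    and "(\<And>s q q'. s \<in> {t1<..<t2} \<Longrightarrow> q \<in> topspace X \<Longrightarrow> q' \<in> topspace X \<Longrightarrow> R s q = R s q') \<Longrightarrow>
      ((\<lambda>s. R s p) has_real_derivative 2 * N) (at t)"
proof -
  let ?W = "{t1<..<t2} \<times> chart_image c" and ?x = "snd c p"
  let ?f = "\<lambda>z. scalar_curvature (g (fst z) c) (snd z)"
  interpret smooth_metric ?W "\<lambda>t. g t c" by (rule smooth_metric_chart[OF c(1)])
  have z: "(t, ?x) \<in> ?W" using c t by auto
  have fR: "?f (s, snd c q) = R s q" if "s \<in> {t1<..<t2}" "q \<in> chart_dom c" for s q
    using that R_chart[OF c(1)] by simp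
  have top: "chart_dom c \<subseteq> topspace X" using dm_open[OF c(1)] by (rule openin_subset)
  let ?D = "dir_deriv tdir ?f (t, ?x)"
  let ?H = "matrix_inv (g t c ?x)"
  have der: "((\<lambda>s. R s p) has_real_derivative ?D) (at t)"
  proof -
    have "((\<lambda>s. ?f (s, ?x)) has_real_derivative ?D) (at t)"
      using has_real_derivative_line[OF smooth_scf open_W, of "(0, ?x)" t tdir] z by (simp add: tdir_def)
    then show ?thesis
      by (rule has_field_derivative_transform_within_open[of _ _ _ "{t1<..<t2}"]) (use t fR c in auto)
  qed
  have evo: "?D = 2 * N + (\<Sum>j\<in>UNIV. \<Sum>k\<in>UNIV. ?H $ j $ k * (dir_deriv (xdir j) (dir_deriv (xdir k) ?f) (t, ?x)
          - (\<Sum>q\<in>UNIV. christoffel (g t c) q j k ?x * dir_deriv (xdir q) ?f (t, ?x))))"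
  proof -
    have fl: "((\<lambda>s. g s c (snd z)) has_vector_derivative - 2 *\<^sub>R ricci (g (fst z) c) (snd z)) (at (fst z))"
      if "z \<in> ?W" for z
    proof -
      have "at (fst z) within {t1..t2} = at (fst z)"
        using that by (intro at_within_interior) auto
      then show ?thesis using flow_eq[OF c(1), of "snd z" "fst z"] that by auto
    qed
    show ?thesis
      using scalar_curvature_evolution[OF smooth_metric_chart[OF c(1)] z fl] by (simp add: N_def ric_norm_sq_def)
  qed
  have slice: "dir_deriv (0, v) ?f (s, y) = 0" "dir_deriv (0, v) (dir_deriv (0, v) ?f) (s, y) \<ge> 0"
    if "(s, y) \<in> ?W" "\<And>q. q \<in> topspace X \<Longrightarrow> R s (chart_inv c y) \<le> R s q" for s y v
  proof -
    have "?f (s, y) \<le> ?f ((s, y) + h *\<^sub>R (0, v))" if hW: "(s, y) + h *\<^sub>R (0, v) \<in> ?W" for h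
    proof -
      obtain q where q: "q \<in> chart_dom c" "y + h *\<^sub>R v = snd c q" using hW by auto
      obtain q' where q': "q' \<in> chart_dom c" "y = snd c q'" using \<open>(s, y) \<in> ?W\<close> by auto
      have "?f (s, y) = R s q'" "?f ((s, y) + h *\<^sub>R (0, v)) = R s q"
        using fR[of s] \<open>(s, y) \<in> ?W\<close> q q' by auto
      then show ?thesis using \<open>\<And>q. q \<in> topspace X \<Longrightarrow> R s (chart_inv c y) \<le> R s q\<close>[of q] q q' top inv_co[OF c(1) q'(1)] by auto
    qed
    from second_derivative_at_min[OF smooth_scf open_W \<open>(s, y) \<in> ?W\<close> this]
    show "dir_deriv (0, v) ?f (s, y) = 0" "dir_deriv (0, v) (dir_deriv (0, v) ?f) (s, y) \<ge> 0" by auto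
  qed
  show "\<exists>D. ((\<lambda>s. R s p) has_real_derivative D) (at t) \<and> 2 * N \<le> D"
    if min: "\<And>q. q \<in> topspace X \<Longrightarrow> R t p \<le> R t q"
  proof -
    have min': "R t (chart_inv c ?x) \<le> R t q" if "q \<in> topspace X" for q
      using min[OF that] inv_co[OF c] by simp
    have grad: "dir_deriv (xdir k) ?f (t, ?x) = 0" for k
      unfolding xdir_def using slice(1)[OF z min'] .
    define B where "B = (\<chi> j k. dir_deriv (xdir j) (dir_deriv (xdir k) ?f) (t, ?x))"
    have B_alt: "B $ j $ k = dir_deriv (xdir k) (dir_deriv (xdir j) ?f) (t, ?x)" for j k
      unfolding B_def by (simp add: dir_deriv_commute[OF smooth_scf open_W z, of "xdir j" "xdir k"])
    have "v \<bullet> (B *v v) \<ge> 0" for v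
    proof -
      have lin: "dir_deriv (0, v) F y = (\<Sum>k\<in>UNIV. v $ k * dir_deriv (xdir k) F y)"
        if "smooth_on ?W F" "y \<in> ?W" for F y
      proof -
        have "(0, v) = (\<Sum>k\<in>UNIV. v $ k *\<^sub>R xdir k :: 'n spacetime)"
          by (simp add: prod_eq_iff fst_sum snd_sum xdir_def vec_eq_iff axis_def if_distrib cong: if_cong)
        then show ?thesis
          by (simp add: linear_sum[OF dir_deriv_linear[OF that(1) open_W that(2)]]
              linear_scale[OF dir_deriv_linear[OF that(1) open_W that(2)]])
      qed
      have "dir_deriv (0, v) (dir_deriv (0, v) ?f) (t, ?x)
          = (\<Sum>j\<in>UNIV. v $ j * dir_deriv (xdir j) (dir_deriv (0, v) ?f) (t, ?x))"
        by (rule lin[OF smooth_D[OF smooth_scf] z])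
      also have "\<dots> = (\<Sum>j\<in>UNIV. v $ j * dir_deriv (0, v) (dir_deriv (xdir j) ?f) (t, ?x))"
        by (simp only: dir_deriv_commute[OF smooth_scf open_W z, of _ "(0, v)"])
      also have "\<dots> = (\<Sum>j\<in>UNIV. v $ j * (\<Sum>k\<in>UNIV. v $ k * dir_deriv (xdir k) (dir_deriv (xdir j) ?f) (t, ?x)))"
        by (simp only: lin[OF smooth_D[OF smooth_scf] z])
      also have "\<dots> = v \<bullet> (B *v v)"
        by (simp add: B_alt inner_vec_def matrix_vector_mult_def mult.commute)
      finally show ?thesis using slice(2)[OF z min', of v] by simp
    qed
    then have "(\<Sum>j\<in>UNIV. \<Sum>k\<in>UNIV. ?H $ j $ k * B $ j $ k) \<ge> 0"
      using c t by (intro trace_pos_def_nonneg pos_def_metric) auto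
    then show ?thesis using der evo by (auto simp: grad B_def)
  qed
  show "((\<lambda>s. R s p) has_real_derivative 2 * N) (at t)"
    if const: "\<And>s q q'. s \<in> {t1<..<t2} \<Longrightarrow> q \<in> topspace X \<Longrightarrow> q' \<in> topspace X \<Longrightarrow> R s q = R s q'"
  proof -
    have grad: "dir_deriv (xdir k) ?f y = 0" if "y \<in> ?W" for k y
    proof -
      obtain s u where y: "y = (s, u)" "s \<in> {t1<..<t2}" "u \<in> chart_image c" using \<open>y \<in> ?W\<close> by auto
      have cu: "chart_inv c u \<in> topspace X" using inv_into_into[OF y(3)] top by blast
      show ?thesis
        using that unfolding y(1) xdir_def
        by (rule slice(1)) (rule eq_refl, rule const[OF y(2) cu])
    qed
    have "dir_deriv (xdir j) (dir_deriv (xdir k) ?f) (t, ?x) = 0" for j k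
    proof -
      have "dir_deriv (xdir j) (dir_deriv (xdir k) ?f) (t, ?x) = dir_deriv (xdir j) (\<lambda>_. 0) (t, ?x)"
        by (rule dir_deriv_cong[OF open_W z grad])
      also have "\<dots> = 0" by (rule dir_deriv_eqI[OF has_derivative_const])
      finally show ?thesis .
    qed
    then show ?thesis using der evo by (simp add: grad[OF z])
  qed
qed

lemma R_space_min:
  assumes t: "t \<in> {t1..t2}" and ne: "topspace X \<noteq> {}"
  shows "\<exists>p\<in>topspace X. \<forall>q\<in>topspace X. R t p \<le> R t q"
proof -
  have "continuous_on ({t..t} \<times> chart_image c) (\<lambda>(t, x). R t (chart_inv c x))" if "c \<in> A" for c
    using t by (intro continuous_on_subset[OF R_continuous[OF that]]) auto
  from attains_min[OF this ne order_refl] show ?thesis by auto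
qed

lemma ric_norm_sq_ge:
  assumes c: "c \<in> A" "p \<in> chart_dom c" and t: "t \<in> {t1..t2}"
  shows "(R t p)\<^sup>2 / CARD('n) \<le> ric_norm_sq (g t c (snd c p)) (ricci (g t c) (snd c p))"
    and "ric_norm_sq (g t c (snd c p)) (ricci (g t c) (snd c p)) = (R t p)\<^sup>2 / CARD('n) \<Longrightarrow>
      ricci (g t c) (snd c p) = (R t p / CARD('n)) *\<^sub>R g t c (snd c p)"
proof -
  have x: "snd c p \<in> chart_image c" using c by auto
  note * = norm_sq_minus_trace[OF pos_def_metric[OF c(1) x t] ricci_sym[OF c(1) x t],
      folded scalar_curvature_def ric_norm_sq_def R_chart[OF c t]]
  show "(R t p)\<^sup>2 / CARD('n) \<le> ric_norm_sq (g t c (snd c p)) (ricci (g t c) (snd c p))"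
    by (rule *(1))
  show "ricci (g t c) (snd c p) = (R t p / CARD('n)) *\<^sub>R g t c (snd c p)"
    if "ric_norm_sq (g t c (snd c p)) (ricci (g t c) (snd c p)) = (R t p)\<^sup>2 / CARD('n)"
    by (rule *(2)[OF that])
qed

section \<open>Comparison with the homogeneous solution\<close>

context
  fixes r :: real
  assumes r: "r \<le> 0" and initial: "\<And>p. p \<in> topspace X \<Longrightarrow> r \<le> R t1 p"
begin

text \<open>
  If \<open>R = r\<close> at time \<open>t1\<close> on an Einstein manifold, then \<open>dil\<close> is the factor by which the Ricci flow
  dilates the metric, and \<open>\<rho>\<close> is the scalar curvature at later times.
\<close>

definition dil :: "real \<Rightarrow> real" where
  "dil t = 1 - (2 / CARD('n)) * r * (t - t1)"

definition \<rho> :: "real \<Rightarrow> real" where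
  "\<rho> t = r / dil t"

lemma dil_ge_1: "t1 \<le> t \<Longrightarrow> 1 \<le> dil t"
  using r by (simp add: dil_def mult_nonpos_nonneg divide_nonpos_pos mult_le_0_iff)

lemma dil_pos: "t1 \<le> t \<Longrightarrow> dil t > 0"
  using dil_ge_1 by fastforce

lemma \<rho>_nonpos: "t1 \<le> t \<Longrightarrow> \<rho> t \<le> 0"
  using r dil_pos by (simp add: \<rho>_def divide_nonpos_pos)

lemma dil_derivative: "(dil has_real_derivative - (2 / CARD('n)) * r) (at t within S)"
  unfolding dil_def[abs_def] by (auto intro!: derivative_eq_intros)

lemma \<rho>_derivative:
  assumes "t1 \<le> t"
  shows "(\<rho> has_real_derivative 2 * ((\<rho> t)\<^sup>2 / CARD('n))) (at t within S)"
  unfolding \<rho>_def[abs_def] using dil_pos[OF assms]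
  by (auto intro!: derivative_eq_intros dil_derivative simp: power2_eq_square field_simps)

lemma \<rho>_continuous: "continuous_on {t1..t2} \<rho>"
  using \<rho>_derivative by (meson DERIV_continuous_on atLeastAtMost_iff)

text \<open>
  Consider a negative minimum of \<open>R - \<rho>\<close> over \<open>[t1, t] \<times> M\<close>. There \<open>R < \<rho> \<le> 0\<close>, so that
  \<open>R\<^sup>2 > \<rho>\<^sup>2\<close> and the time derivative of \<open>R - \<rho>\<close> is positive, which is impossible at a minimum
  attained after the initial time. The sign of \<open>\<rho>\<close> thus replaces the usual exponential factor.
\<close>

lemma R_ge_interior:
  assumes t: "t \<in> {t1..<t2}" and p: "p \<in> topspace X"
  shows "\<rho> t \<le> R t p"
proof (rule ccontr)
  assume neg: "\<not> ?thesis"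
  let ?w = "\<lambda>s q. R s q - \<rho> s"
  have "continuous_on ({t1..t} \<times> chart_image c) (\<lambda>(s, x). ?w s (chart_inv c x))" if "c \<in> A" for c
  proof -
    have "continuous_on ({t1..t} \<times> chart_image c) (\<lambda>z. (case z of (s, x) \<Rightarrow> R s (chart_inv c x)) - \<rho> (fst z))"
      using t by (intro continuous_intros continuous_on_subset[OF R_continuous[OF that]]
          continuous_on_compose2[OF \<rho>_continuous]) auto
    then show ?thesis by (simp add: case_prod_unfold)
  qed
  moreover have "topspace X \<noteq> {}" "t1 \<le> t" using t p by auto
  ultimately have "\<exists>s\<in>{t1..t}. \<exists>m\<in>topspace X. \<forall>s'\<in>{t1..t}. \<forall>q\<in>topspace X. ?w s m \<le> ?w s' q"
    by (rule attains_min)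
  then obtain s m where sm: "s \<in> {t1..t}" "m \<in> topspace X"
    and min: "\<And>s' q. s' \<in> {t1..t} \<Longrightarrow> q \<in> topspace X \<Longrightarrow> ?w s m \<le> ?w s' q"
    by blast
  have w: "?w s m < 0" using min[of t p] neg t p by auto
  have "\<rho> t1 = r" by (simp add: \<rho>_def dil_def)
  then have "s \<noteq> t1" using w initial[OF sm(2)] by auto
  then have s: "s \<in> {t1<..<t2}" using sm t by auto
  obtain c where c: "c \<in> A" "m \<in> chart_dom c" using sm(2) dm_cover by blast
  have "R s m \<le> R s q" if "q \<in> topspace X" for q using min[OF sm(1) that] by simp
  then obtain D where D: "((\<lambda>s. R s m) has_real_derivative D) (at s)"
    "2 * ric_norm_sq (g s c (snd c m)) (ricci (g s c) (snd c m)) \<le> D"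
    using R_evolution(1)[OF c s] by blast
  have "2 * ((R s m)\<^sup>2 / CARD('n)) \<le> D" using ric_norm_sq_ge(1)[OF c, of s] D(2) s by auto
  moreover have "(\<rho> s)\<^sup>2 < (R s m)\<^sup>2"
    using w \<rho>_nonpos[of s] s by (simp add: abs_le_square_iff[symmetric] not_le[symmetric]) 
  ultimately have "D - 2 * ((\<rho> s)\<^sup>2 / CARD('n)) > 0"
    by (smt (verit) divide_strict_right_mono of_nat_0_less_iff zero_less_card_finite)
  moreover have "((\<lambda>s. ?w s m) has_real_derivative D - 2 * ((\<rho> s)\<^sup>2 / CARD('n))) (at s)"
    using s by (intro derivative_intros D \<rho>_derivative) auto
  ultimately obtain e where e: "e > 0" "\<And>h. h > 0 \<Longrightarrow> h < e \<Longrightarrow> ?w (s - h) m < ?w s m"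
    using DERIV_pos_inc_left by blast
  define h where "h = min e (s - t1) / 2"
  have h: "h > 0" "h < e" "s - h \<in> {t1..t}" using e(1) s sm(1) by (auto simp: h_def min_def field_simps)
  then show False using e(2)[OF h(1,2)] min[OF h(3) sm(2)] by simp
qed

lemma R_ge:
  assumes t: "t \<in> {t1..t2}" and p: "p \<in> topspace X"
  shows "\<rho> t \<le> R t p"
proof -
  have "continuous_on {t1..t2} (\<lambda>t. R t p - \<rho> t)"
    by (intro continuous_intros R_continuous_time p \<rho>_continuous)
  then have "continuous_on (closure {t1..<t2}) (\<lambda>t. R t p - \<rho> t)" using t12 by simp
  then have "R t p - \<rho> t \<ge> 0"
    by (rule continuous_ge_on_closure) (use t12 t R_ge_interior[OF _ p] in auto)
  then show ?thesis by simp
qed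

text \<open>
  The logarithmic derivative of the density \<open>det g\<close> is \<open>tr (G\<^sup>-\<^sup>1 \<partial>\<^sub>tG) = - 2 R\<close>, and that of \<open>q\<^sup>n\<close>, with
  \<open>q = dil\<close>, is \<open>- 2 \<rho>\<close>.
\<close>

lemma density_antimono:
  assumes c: "c \<in> A" "p \<in> chart_dom c"
  defines "m \<equiv> \<lambda>t. det (g t c (snd c p)) / dil t ^ CARD('n)"
  shows "t \<in> {t1..t2} \<Longrightarrow> (m has_real_derivative - 2 * m t * (R t p - \<rho> t)) (at t within {t1..t2})"
    and "a \<in> {t1..t2} \<Longrightarrow> b \<in> {t1..t2} \<Longrightarrow> a \<le> b \<Longrightarrow> m b \<le> m a"
proof -
  let ?x = "snd c p" and ?n = "CARD('n)"
  have x: "?x \<in> chart_image c" using c by auto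
  have top: "p \<in> topspace X" using c dm_cover by auto
  have det: "det (g t c ?x) > 0" if "t \<in> {t1..t2}" for t
    by (rule pos_def_det[OF pos_def_metric[OF c(1) x that]])
  show der: "(m has_real_derivative - 2 * m t * (R t p - \<rho> t)) (at t within {t1..t2})" if t: "t \<in> {t1..t2}" for t
  proof -
    let ?G = "g t c ?x" and ?S = "ricci (g t c) ?x"
    have qt: "dil t > 0" using t dil_pos by auto
    have S: "?S $ j $ k = ?S $ k $ j" for j k
      using arg_cong[OF ricci_sym[OF c(1) x t], of "\<lambda>M. M $ k $ j"] by (simp add: transpose_def)
    have "trace (matrix_inv ?G ** ((- 2) *\<^sub>R ?S)) = - 2 * R t p"
      unfolding R_chart[OF c t] scalar_curvature_def trace_def matrix_matrix_mult_def
      by (simp add: S sum_distrib_left sum_negf mult_ac)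
    then have 1: "((\<lambda>s. det (g s c ?x)) has_real_derivative det ?G * (- 2 * R t p)) (at t within {t1..t2})"
      using has_real_derivative_det[OF flow_eq[OF c(1) x t]] det[OF t] by simp
    have 2: "((\<lambda>s. dil s ^ ?n) has_real_derivative real ?n * (- (2 / ?n) * r * dil t ^ (?n - 1))) (at t within {t1..t2})"
      by (rule DERIV_cong[OF DERIV_power[OF dil_derivative]]) simp
    have 3: "real ?n * (- (2 / ?n) * r * dil t ^ (?n - 1)) = - 2 * \<rho> t * dil t ^ ?n"
    proof -
      have "dil t ^ ?n = dil t * dil t ^ (?n - 1)" by (simp add: power_eq_if)
      then show ?thesis using qt by (simp add: \<rho>_def)
    qed
    have "(m has_real_derivative (det ?G * (- 2 * R t p) * dil t ^ ?n - det ?G * (- 2 * \<rho> t * dil t ^ ?n)) / (dil t ^ ?n * dil t ^ ?n))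
        (at t within {t1..t2})"
      unfolding m_def using DERIV_divide[OF 1 2[unfolded 3]] qt by simp
    moreover have "(det ?G * (- 2 * R t p) * dil t ^ ?n - det ?G * (- 2 * \<rho> t * dil t ^ ?n)) / (dil t ^ ?n * dil t ^ ?n)
        = - 2 * m t * (R t p - \<rho> t)"
      using qt by (simp add: m_def field_simps)
    ultimately show ?thesis by simp
  qed
  show "m b \<le> m a" if ab: "a \<in> {t1..t2}" "b \<in> {t1..t2}" "a \<le> b"
  proof (rule ccontr)
    assume less: "\<not> m b \<le> m a"
    then have "a < b" using ab(3) by (cases "a = b") auto
    have at: "(m has_real_derivative - 2 * m t * (R t p - \<rho> t)) (at t)" if "a < t" "t < b" for t
    proof -
      have "at t within {t1..t2} = at t" using that ab by (intro at_within_interior) auto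
      then show ?thesis using der[of t] that ab by auto
    qed
    have "continuous_on {a..b} m"
      by (rule continuous_on_subset[OF DERIV_continuous_on[OF der]]) (use ab in auto)
    moreover have "m differentiable (at t)" if "a < t" "t < b" for t
      using at[OF that] real_differentiable_def by blast
    ultimately obtain l t where t: "a < t" "t < b" "(m has_real_derivative l) (at t)" "m b - m a = (b - a) * l"
      using MVT[OF \<open>a < b\<close>] by blast
    have "l = - 2 * m t * (R t p - \<rho> t)" by (rule DERIV_unique[OF t(3) at[OF t(1,2)]])
    moreover have "m t \<ge> 0" using det[of t] dil_pos[of t] t ab by (simp add: m_def)
    ultimately have "l \<le> 0"
      using R_ge[OF _ top, of t] t ab by (simp add: mult_nonneg_nonneg)
    then have "m b - m a \<le> 0" using t(4) \<open>a < b\<close> by (simp add: mult_nonneg_nonpos)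
    then show False using less by simp
  qed
qed

lemma R_eq_of_density_eq:
  assumes c: "c \<in> A" "p \<in> chart_dom c"
    and eq: "det (g t2 c (snd c p)) = dil t2 ^ CARD('n) * det (g t1 c (snd c p))"
    and t: "t \<in> {t1<..<t2}"
  shows "R t p = \<rho> t"
proof -
  define m where "m = (\<lambda>t. det (g t c (snd c p)) / dil t ^ CARD('n))"
  have der: "(m has_real_derivative - 2 * m t * (R t p - \<rho> t)) (at t within {t1..t2})" if "t \<in> {t1..t2}" for t
    unfolding m_def by (rule density_antimono(1)[OF c that])
  have mono: "m b \<le> m a" if "a \<in> {t1..t2}" "b \<in> {t1..t2}" "a \<le> b" for a b
    unfolding m_def by (rule density_antimono(2)[OF c that])
  have "dil t1 = 1" by (simp add: dil_def)
  then have ends: "m t1 = m t2" using eq dil_pos[of t2] t12 by (simp add: m_def)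
  have const: "m s = m t1" if "s \<in> {t1..t2}" for s
    using mono[of t1 s] mono[of s t2] that ends t12 by auto
  have "at t within {t1..t2} = at t" using t by (intro at_within_interior) auto
  then have "(m has_real_derivative - 2 * m t * (R t p - \<rho> t)) (at t)" using der[of t] t by auto
  moreover have "(m has_real_derivative 0) (at t)"
    by (rule has_field_derivative_transform_within_open[OF DERIV_const[of "m t1"], where S = "{t1<..<t2}"])
      (use t const[symmetric] in \<open>simp_all only: open_greaterThanLessThan greaterThanLessThan_iff atLeastAtMost_iff less_imp_le simp_thms\<close>)
  ultimately have "- 2 * m t * (R t p - \<rho> t) = 0" by (rule DERIV_unique)
  moreover have "m t > 0"
    using pos_def_det[OF pos_def_metric[OF c(1), of "snd c p" t]] c t dil_pos[of t] by (simp add: m_def)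
  ultimately show ?thesis by simp
qed

text \<open>
  At interior times the evolution of \<open>R = \<rho>\<close> yields equality in \<open>|Rc|\<^sup>2 \<ge> R\<^sup>2 / n\<close>; the end points follow
  by continuity.
\<close>

lemma einstein_of_R_eq:
  assumes R: "\<And>t p. t \<in> {t1<..<t2} \<Longrightarrow> p \<in> topspace X \<Longrightarrow> R t p = \<rho> t"
    and c: "c \<in> A" "x \<in> chart_image c" and t: "t \<in> {t1..t2}"
  shows "ricci (g t c) x = (\<rho> t / CARD('n)) *\<^sub>R g t c x"
proof -
  let ?F = "\<lambda>t. ricci (g t c) x - (\<rho> t / CARD('n)) *\<^sub>R g t c x"
  obtain p where p: "p \<in> chart_dom c" "x = snd c p" using c(2) by auto
  have top: "p \<in> topspace X" using p c dm_cover by auto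
  have interior: "?F s = 0" if s: "s \<in> {t1<..<t2}" for s
  proof -
    let ?N = "ric_norm_sq (g s c (snd c p)) (ricci (g s c) (snd c p))"
    have "((\<lambda>s. R s p) has_real_derivative 2 * ?N) (at s)"
      by (rule R_evolution(2)[OF c(1) p(1) s]) (simp add: R)
    moreover have "((\<lambda>s. R s p) has_real_derivative 2 * ((\<rho> s)\<^sup>2 / CARD('n))) (at s)"
      by (rule has_field_derivative_transform_within_open[OF \<rho>_derivative, where S = "{t1<..<t2}"])
        (use s R top in auto)
    ultimately have "2 * ?N = 2 * ((\<rho> s)\<^sup>2 / CARD('n))" by (rule DERIV_unique)
    then show ?thesis
      using ric_norm_sq_ge(2)[OF c(1) p(1), of s] R[OF s top] s p(2) by simp
  qed
  have "continuous_on {t1..t2} (\<lambda>t. (\<lambda>(t, x). ricci (g t c) x) (t, x))"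
    by (rule continuous_on_compose2[OF ricci_continuous[OF c(1)]]) (use c in \<open>auto intro!: continuous_intros\<close>)
  moreover have "continuous_on {t1..t2} (\<lambda>t. (\<lambda>(t, x). g t c x) (t, x))"
    by (rule continuous_on_compose2[OF smooth_on_imp_continuous_on[OF slab[OF c(1)]]])
      (use c in \<open>auto intro!: continuous_intros\<close>)
  ultimately have "continuous_on {t1..t2} ?F"
    by (intro continuous_intros \<rho>_continuous) simp_all
  then have "continuous_on (closure {t1<..<t2}) ?F" using t12 by simp
  then have "?F t = 0"
    by (rule continuous_constant_on_closure) (use interior t t12 in auto)
  then show ?thesis by simp
qed

end

lemma einstein_imp_soliton:
  assumes t: "t \<in> {t1..t2}" and neg: "k < 0"
    and ein: "\<And>c x. c \<in> A \<Longrightarrow> x \<in> chart_image c \<Longrightarrow> ricci (g t c) x = k *\<^sub>R g t c x"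
  shows "expanding_gradient_ricci_soliton A (g t)"
  unfolding expanding_gradient_ricci_soliton_def
proof (intro conjI exI[of _ "\<lambda>_. 0"] exI[of _ "- 1 / (2 * k)"] ballI)
  show "riemannian_metric A (g t)" by (rule metric[OF t])
  show "smooth_function A (\<lambda>_. 0)" by (simp add: smooth_function_def smooth_on_const)
  show "- 1 / (2 * k) > 0" using neg by (simp add: divide_neg_neg)
  fix c x assume c: "c \<in> A" "x \<in> chart_image c"
  have "partial_deriv i (\<lambda>_. 0) = (\<lambda>_. 0)" for i :: 'n
    by (simp add: partial_deriv_def fun_eq_iff)
  then have "hessian (g t c) (\<lambda>_. 0) x = 0"
    by (simp add: hessian_def vec_eq_iff)
  then show "ricci (g t c) x + hessian (g t c) (\<lambda>y. 0) x + (1 / (2 * (- 1 / (2 * k)))) *\<^sub>R g t c x = 0"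
    using neg by (simp add: ein[OF c])
qed

end

section \<open>Expanding breathers\<close>

theorem corollary7p1:
  fixes X :: "'m topology"
    and A :: "('m, 'n::finite) chart set"
    and g :: "real \<Rightarrow> ('m, 'n) tensor2"
    and \<Phi> :: "'m \<Rightarrow> 'm"
    and t1 t2 \<alpha> :: real
  assumes "smooth_manifold X A"
    and "compact_space X"
    and "connected_space X"
    and "t1 < t2"
    and "ricci_flow A t1 t2 g"
    and "\<alpha> > 1"
    and "diffeomorphism X A X A \<Phi>"
    and "\<forall>c\<in>A. \<forall>d\<in>A. \<forall>x\<in>local_rep_dom c d \<Phi>.
           g t2 c x = \<alpha> *\<^sub>R pullback c d \<Phi> (g t1) x"
  shows "\<forall>t\<in>{t1..t2}. expanding_gradient_ricci_soliton A (g t)"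
proof
  fix t assume t: "t \<in> {t1..t2}"
  interpret closed_ricci_flow X A g t1 t2 by unfold_locales (rule assms)+
  note \<alpha> = assms(6)
  have \<Phi>_bij: "bij_betw \<Phi> (topspace X) (topspace X)" and \<Phi>: "smooth_map X A X A \<Phi>"
    using assms(7) by (auto simp: diffeomorphism_def)
  have \<Phi>_cont: "continuous_map X X \<Phi>" using \<Phi> by (simp add: smooth_map_def)
  have end1: "t1 \<in> {t1..t2}" and end2: "t2 \<in> {t1..t2}" using t12 by auto
  show "expanding_gradient_ricci_soliton A (g t)"
  proof (cases "topspace X = {}")
    case True
    then have "chart_image c = {}" if "c \<in> A" for c using dm_cover that by auto
    \<comment> \<open>on the empty manifold every condition on tensors is vacuous\<close>
    then show ?thesis by (intro einstein_imp_soliton[OF t, of "-1"]) auto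
  next
    case False
    obtain p1 where p1: "p1 \<in> topspace X" "\<And>q. q \<in> topspace X \<Longrightarrow> R t1 p1 \<le> R t1 q"
      using R_space_min[OF end1 False] by blast
    define r where "r = min (R t1 p1) 0"
    have r: "r \<le> 0" and init: "\<And>p. p \<in> topspace X \<Longrightarrow> r \<le> R t1 p"
      using p1(2) by (fastforce simp: r_def)+
    let ?dil = "dil r" and ?\<rho> = "\<rho> r"
    have q2: "?dil t2 \<ge> 1" by (rule dil_ge_1[OF r init]) (use t12 in auto)
    have q2_eq: "?dil t2 = 1 - 2 / CARD('n) * r * (t2 - t1)" by (simp add: dil_def[OF r init])
    have q1: "?dil t1 = 1" by (simp add: dil_def[OF r init])
    \<comment> \<open>compares \<open>R\<close> at time \<open>t2\<close>, at the preimage of a point where the minimum \<open>r\<close> is attained, with \<open>\<rho> t2\<close>\<close>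
    have q_le: "?dil t2 \<le> \<alpha>"
    proof (cases "r = 0")
      case True
      then show ?thesis unfolding q2_eq using \<alpha> by simp
    next
      case False
      then have r0: "r < 0" "r = R t1 p1" using r by (auto simp: r_def min_def split: if_splits)
      obtain p where p: "p \<in> topspace X" "\<Phi> p = p1" using \<Phi>_bij p1(1) by (metis bij_betw_def imageE)
      obtain c where c: "c \<in> A" "p \<in> chart_dom c" using p dm_cover by blast
      obtain d where d: "d \<in> A" "p1 \<in> chart_dom d" using p1 dm_cover by blast
      have "scalar_curvature (g t2 c) (snd c p) = (1 / \<alpha>) * scalar_curvature (g t1 d) (snd d (\<Phi> p))"
        by (rule scalar_curvature_natural[OF manifold \<Phi> metric[OF end1] metric[OF end2] _ c(1) d(1) c(2)])
          (use \<alpha> d p assms(8) c in auto)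
      then have "R t2 p = r / \<alpha>"
        using R_chart[OF c end2] R_chart[OF d end1] by (simp add: p r0)
      moreover have "r / ?dil t2 \<le> R t2 p"
        using R_ge[OF r init end2 p(1)] by (simp add: \<rho>_def[OF r init])
      ultimately have "r / ?dil t2 \<le> r / \<alpha>" by simp
      then show ?thesis using r0 q2 \<alpha> by (simp add: field_simps)
    qed
    let ?n = "CARD('n)"
    let ?\<mu> = "\<lambda>c x. sqrt (det (g t1 c x))" and ?\<nu> = "\<lambda>c x. sqrt (det (g t2 c x)) / sqrt (\<alpha> ^ ?n)"
    have det1: "det (g t1 c x) > 0" and det2: "det (g t2 c x) > 0" if "c \<in> A" "x \<in> chart_image c" for c x
      using that by (auto intro!: pos_def_det pos_def_metric end1 end2)
    have compare: "det (g t2 c (snd c p)) \<le> ?dil t2 ^ ?n * det (g t1 c (snd c p))" if "c \<in> A" "p \<in> chart_dom c" for c p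
      using density_antimono(2)[OF r init that end1 end2] t12 q1 q2 by (simp add: field_simps)
    have qn: "?dil t2 ^ ?n \<le> \<alpha> ^ ?n" using q_le q2 by (intro power_mono) auto
    have \<nu>_le: "?\<nu> c (snd c p) \<le> ?\<mu> c (snd c p)" if c: "c \<in> A" "p \<in> chart_dom c" for c p
    proof -
      have "det (g t1 c (snd c p)) > 0" using det1 c by auto
      then have "det (g t2 c (snd c p)) \<le> \<alpha> ^ ?n * det (g t1 c (snd c p))"
        by (intro order_trans[OF compare[OF c] mult_right_mono[OF qn]] less_imp_le)
      then have "sqrt (det (g t2 c (snd c p))) \<le> sqrt (\<alpha> ^ ?n) * sqrt (det (g t1 c (snd c p)))"
        by (simp flip: real_sqrt_mult)
      then show ?thesis using \<alpha> by (simp add: field_simps)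
    qed
    have preserved: "?\<nu> c (snd c p) = ?\<mu> c (snd c p)" if c: "c \<in> A" "p \<in> chart_dom c" for c p
    proof (rule volume_density_preserved[OF compact_atlas_charts[OF manifold compact_X] \<Phi>_bij, where \<mu> = ?\<mu> and \<nu> = ?\<nu>])
      show "openin X {p \<in> topspace X. \<Phi> p \<in> U}" if "openin X U" for U
        by (rule openin_continuous_map_preimage[OF \<Phi>_cont that])
      have smooth_det: "continuous_on (chart_image c) (\<lambda>x. det (g s c x))" if "s \<in> {t1..t2}" "c \<in> A" for s c
        by (intro smooth_on_imp_continuous_on smooth_on_det riemannian_metric_facts(1)[OF metric[OF that(1)] that(2)])
      show "continuous_on (chart_image c) (?\<mu> c)" "continuous_on (chart_image c) (?\<nu> c)" if "c \<in> A" for c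
        using \<alpha> by (auto intro!: continuous_intros smooth_det end1 end2 that)
      show "?\<nu> c (snd c p) \<le> ?\<mu> c (snd c p)" if "c \<in> A" "p \<in> chart_dom c" for c p by (rule \<nu>_le[OF that])
      show "c \<in> A" "p \<in> chart_dom c" by (rule c)+
      fix c d p assume cd: "c \<in> A" "d \<in> A" "p \<in> chart_dom c" "\<Phi> p \<in> chart_dom d"
      have x: "snd c p \<in> local_rep_dom c d \<Phi>" using cd by (auto simp: local_rep_dom_def)
      have loc: "local_rep c d \<Phi> (snd c p) = snd d (\<Phi> p)" using cd by (simp add: local_rep_def inv_co)
      let ?\<phi>' = "frechet_derivative (local_rep c d \<Phi>) (at (snd c p))"
      show "((\<lambda>x. snd d (\<Phi> (chart_inv c x))) has_derivative ?\<phi>') (at (snd c p))"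
      proof -
        have "smooth_on (local_rep_dom c d \<Phi>) (local_rep c d \<Phi>)" using \<Phi> cd by (simp add: smooth_map_def)
        from smooth_on_frechet_derivative[OF this open_local_rep_dom[OF manifold \<Phi> cd(1,2)] x]
        show ?thesis unfolding local_rep_def[abs_def] .
      qed
      have "det (g t2 c (snd c p)) = \<alpha> ^ ?n * (det (matrix ?\<phi>'))\<^sup>2 * det (g t1 d (snd d (\<Phi> p)))"
        using assms(8) cd x by (simp add: pullback_def Let_def det_scaleR det_mul loc power2_eq_square mult_ac)
      then show "?\<nu> c (snd c p) = \<bar>det (matrix ?\<phi>')\<bar> * ?\<mu> d (snd d (\<Phi> p))"
        using \<alpha> by (simp add: real_sqrt_mult)
    qed
    have det_eq: "det (g t2 c (snd c p)) = \<alpha> ^ ?n * det (g t1 c (snd c p))" if c: "c \<in> A" "p \<in> chart_dom c" for c p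
    proof -
      have "sqrt (det (g t2 c (snd c p))) = sqrt (\<alpha> ^ ?n * det (g t1 c (snd c p)))"
        using preserved[OF c] \<alpha> by (simp add: real_sqrt_mult field_simps)
      then show ?thesis by simp
    qed
    \<comment> \<open>equality of the volume elements leaves no room in \<open>det g(t2) \<le> (dil t2)\<^sup>n det g(t1) \<le> \<alpha>\<^sup>n det g(t1)\<close>\<close>
    have q\<alpha>: "?dil t2 = \<alpha>"
    proof -
      obtain c where c: "c \<in> A" "p1 \<in> chart_dom c" using p1 dm_cover by blast
      have "\<alpha> ^ ?n * det (g t1 c (snd c p1)) \<le> ?dil t2 ^ ?n * det (g t1 c (snd c p1))"
        using compare[OF c] det_eq[OF c] by simp
      then have "\<alpha> ^ ?n \<le> ?dil t2 ^ ?n" using det1[OF c(1), of "snd c p1"] c by simp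
      then have "\<alpha> \<le> ?dil t2" using \<alpha> q2 by (simp add: power_mono_iff)
      then show ?thesis using q_le by simp
    qed
    have "r \<noteq> 0"
    proof
      assume "r = 0"
      then show False using q\<alpha> \<alpha> unfolding q2_eq by simp
    qed
    then have r_neg: "r < 0" using r by simp
    have R_eq: "R s p = ?\<rho> s" if s: "s \<in> {t1<..<t2}" and p: "p \<in> topspace X" for s p
    proof -
      obtain c where c: "c \<in> A" "p \<in> chart_dom c" using p dm_cover by blast
      show ?thesis by (rule R_eq_of_density_eq[OF r init c _ s]) (simp_all add: q\<alpha> det_eq[OF c])
    qed
    show ?thesis
    proof (rule einstein_imp_soliton[OF t, of "?\<rho> t / ?n"])
      show "?\<rho> t / ?n < 0"
        using r_neg dil_pos[OF r init, of t] t by (simp add: \<rho>_def[OF r init] divide_neg_pos)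
      show "ricci (g t c) x = (?\<rho> t / ?n) *\<^sub>R g t c x" if "c \<in> A" "x \<in> chart_image c" for c x
        by (rule einstein_of_R_eq[OF r init R_eq that t])
    qed
  qed
qed

end
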